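(* For every rational $\alpha\in(0,1)$, the set $\mathrm{FOC}(G(n,n^{-\alpha}))$ is not totally bounded in $\ell^\infty/c_0$.
   Context: $\ell^\infty$ is the Banach space of bounded real sequences with the sup norm, $c_0$ the subspace of sequences converging to $0$, and $\ell^\infty/c_0$ the quotient with norm $\|x+c_0\|=\limsup_n|x_n|$; $\pi$ is the canonical projection. For a sequence $(D_n)$ of random structures with domain $[n]$, $\mathrm{FOC}(D_n)=\{\pi((\Pr(D_n\models\varphi))_{n\in\mathbb{N}}) : \varphi\text{ a first order sentence}\}$. $G(n,p)$ is the binomial random graph on $[n]$ (each of the $\binom n2$ edges present independently with probability $p$), over the signature of equality and adjacency. *)

theory Defs
  imports "HOL-Probability.Probability"
begin

section \<open>The Banach space of bounded sequences modulo null sequences\<close>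

text \<open>
  Every sequence is continuous for the discrete topology of \<^typ>\<open>nat\<close>, so the type of bounded
  continuous functions on \<^typ>\<open>nat\<close>, with the supremum norm, is the space of all bounded
  sequences.
\<close>

type_synonym linf = "nat \<Rightarrow>\<^sub>C real"

definition c0 :: "linf set" where
  "c0 = {x. (\<lambda>n. apply_bcontfun x n) \<longlonglongrightarrow> 0}"

definition c0_rel :: "linf \<Rightarrow> linf \<Rightarrow> bool" where
  "c0_rel x y \<longleftrightarrow> x - y \<in> c0"

lemma c0_zero: "0 \<in> c0"
  by (simp add: c0_def)

lemma c0_add: "x \<in> c0 \<Longrightarrow> y \<in> c0 \<Longrightarrow> x + y \<in> c0"
  unfolding c0_def using tendsto_add[of "apply_bcontfun x" 0 sequentially "apply_bcontfun y" 0]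
  by simp

lemma c0_scaleR: "x \<in> c0 \<Longrightarrow> r *\<^sub>R x \<in> c0"
  unfolding c0_def using tendsto_mult_right_zero[of "apply_bcontfun x" sequentially r]
  by simp

lemma c0_uminus: "x \<in> c0 \<Longrightarrow> - x \<in> c0"
  using c0_scaleR[of x "-1"] by simp

quotient_type linf_mod_c0 = linf / c0_rel
  morphisms rep_linf_mod_c0 c0_proj
proof (rule equivpI)
  show "reflp c0_rel"
    by (simp add: reflp_def c0_rel_def c0_zero)
  show "symp c0_rel"
    unfolding symp_def c0_rel_def using c0_uminus[of "x - y" for x y] by simp
  show "transp c0_rel"
    unfolding transp_def c0_rel_def using c0_add[of "x - y" "y - z" for x y z] by simp
qed

definition limsup_norm :: "linf \<Rightarrow> real" where
  "limsup_norm x = real_of_ereal (limsup (\<lambda>n. ereal \<bar>apply_bcontfun x n\<bar>))"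

lemma limsup_norm_ereal:
  "ereal (limsup_norm x) = limsup (\<lambda>n. ereal \<bar>apply_bcontfun x n\<bar>)"
proof -
  have "limsup (\<lambda>n. ereal \<bar>apply_bcontfun x n\<bar>) \<le> ereal (norm x)"
    using norm_bounded[of x] by (intro Limsup_bounded always_eventually) simp
  moreover have "0 \<le> limsup (\<lambda>n. ereal \<bar>apply_bcontfun x n\<bar>)"
    by (intro le_Limsup always_eventually) simp_all
  ultimately have "\<bar>limsup (\<lambda>n. ereal \<bar>apply_bcontfun x n\<bar>)\<bar> \<noteq> \<infinity>"
    by auto
  then show ?thesis
    by (simp add: limsup_norm_def ereal_real')
qed

lemma limsup_norm_nonneg: "0 \<le> limsup_norm x"
proof -
  have "0 \<le> limsup (\<lambda>n. ereal \<bar>apply_bcontfun x n\<bar>)"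
    by (intro le_Limsup always_eventually) simp_all
  then show ?thesis
    by (simp flip: limsup_norm_ereal)
qed

lemma limsup_norm_add: "limsup_norm (x + y) \<le> limsup_norm x + limsup_norm y"
proof -
  have "limsup (\<lambda>n. ereal \<bar>apply_bcontfun (x + y) n\<bar>)
      \<le> limsup (\<lambda>n. ereal \<bar>apply_bcontfun x n\<bar> + ereal \<bar>apply_bcontfun y n\<bar>)"
    by (intro Limsup_mono always_eventually) (simp add: abs_triangle_ineq)
  also have "\<dots> \<le> limsup (\<lambda>n. ereal \<bar>apply_bcontfun x n\<bar>) + limsup (\<lambda>n. ereal \<bar>apply_bcontfun y n\<bar>)"
    by (rule ereal_limsup_add_mono)
  finally show ?thesis
    unfolding limsup_norm_ereal[symmetric] by simp
qed

lemma limsup_norm_scaleR: "limsup_norm (r *\<^sub>R x) = \<bar>r\<bar> * limsup_norm x"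
proof -
  have "limsup (\<lambda>n. ereal \<bar>apply_bcontfun (r *\<^sub>R x) n\<bar>)
      = limsup (\<lambda>n. ereal \<bar>r\<bar> * ereal \<bar>apply_bcontfun x n\<bar>)"
    by (simp add: abs_mult)
  also have "\<dots> = ereal \<bar>r\<bar> * limsup (\<lambda>n. ereal \<bar>apply_bcontfun x n\<bar>)"
    by (rule Limsup_ereal_mult_left) simp_all
  finally show ?thesis
    unfolding limsup_norm_ereal[symmetric] by simp
qed

lemma limsup_norm_eq_0_iff: "limsup_norm x = 0 \<longleftrightarrow> x \<in> c0"
proof
  assume "limsup_norm x = 0"
  then have L: "limsup (\<lambda>n. ereal \<bar>apply_bcontfun x n\<bar>) = 0"
    by (metis limsup_norm_ereal zero_ereal_def)
  moreover have "0 \<le> liminf (\<lambda>n. ereal \<bar>apply_bcontfun x n\<bar>)"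
    by (intro Liminf_bounded always_eventually) simp
  moreover have "liminf (\<lambda>n. ereal \<bar>apply_bcontfun x n\<bar>) \<le> limsup (\<lambda>n. ereal \<bar>apply_bcontfun x n\<bar>)"
    by (intro Liminf_le_Limsup) simp
  ultimately have "(\<lambda>n. ereal \<bar>apply_bcontfun x n\<bar>) \<longlonglongrightarrow> ereal 0"
    by (intro Liminf_eq_Limsup) (simp_all add: zero_ereal_def)
  then show "x \<in> c0"
    unfolding c0_def lim_ereal by (simp add: tendsto_rabs_zero_iff)
next
  assume "x \<in> c0"
  then have "(\<lambda>n. ereal \<bar>apply_bcontfun x n\<bar>) \<longlonglongrightarrow> ereal 0"
    unfolding c0_def lim_ereal by (simp add: tendsto_rabs_zero_iff)
  then have "limsup (\<lambda>n. ereal \<bar>apply_bcontfun x n\<bar>) = ereal 0"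
    by (intro lim_imp_Limsup) simp_all
  then show "limsup_norm x = 0"
    by (simp add: limsup_norm_def)
qed

lemma limsup_norm_cong:
  assumes "c0_rel x y" shows "limsup_norm x = limsup_norm y"
proof -
  have "limsup_norm (x - y) = 0" "limsup_norm (y - x) = 0"
    using assms c0_uminus[of "x - y"] by (simp_all add: limsup_norm_eq_0_iff c0_rel_def)
  then show ?thesis
    using limsup_norm_add[of "x - y" y] limsup_norm_add[of "y - x" x] by simp
qed

instantiation linf_mod_c0 :: real_vector
begin

lift_definition zero_linf_mod_c0 :: linf_mod_c0 is 0 .

lift_definition plus_linf_mod_c0 :: "linf_mod_c0 \<Rightarrow> linf_mod_c0 \<Rightarrow> linf_mod_c0" is "(+)"
proof -
  fix a b c d :: linf
  assume "c0_rel a b" "c0_rel c d"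
  then have "(a - b) + (c - d) \<in> c0"
    unfolding c0_rel_def by (rule c0_add)
  then show "c0_rel (a + c) (b + d)"
    by (simp add: c0_rel_def add_diff_add)
qed

lift_definition uminus_linf_mod_c0 :: "linf_mod_c0 \<Rightarrow> linf_mod_c0" is uminus
proof -
  fix a b :: linf
  assume "c0_rel a b"
  then show "c0_rel (- a) (- b)"
    using c0_uminus[of "a - b"] by (simp add: c0_rel_def)
qed

lift_definition minus_linf_mod_c0 :: "linf_mod_c0 \<Rightarrow> linf_mod_c0 \<Rightarrow> linf_mod_c0" is "(-)"
proof -
  fix a b c d :: linf
  assume "c0_rel a b" "c0_rel c d"
  then have "(a - b) + - (c - d) \<in> c0"
    unfolding c0_rel_def by (intro c0_add c0_uminus)
  then show "c0_rel (a - c) (b - d)"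
    by (simp add: c0_rel_def algebra_simps)
qed

lift_definition scaleR_linf_mod_c0 :: "real \<Rightarrow> linf_mod_c0 \<Rightarrow> linf_mod_c0" is "scaleR"
proof -
  fix r and a b :: linf
  assume "c0_rel a b"
  then show "c0_rel (r *\<^sub>R a) (r *\<^sub>R b)"
    using c0_scaleR[of "a - b" r] by (simp add: c0_rel_def scaleR_diff_right)
qed

instance
proof
  fix X Y Z :: linf_mod_c0 and a b :: real
  show "X + Y + Z = X + (Y + Z)"
    by transfer (simp add: c0_rel_def c0_zero algebra_simps)
  show "X + Y = Y + X"
    by transfer (simp add: c0_rel_def c0_zero algebra_simps)
  show "0 + X = X"
    by transfer (simp add: c0_rel_def c0_zero)
  show "- X + X = 0"
    by transfer (simp add: c0_rel_def c0_zero)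
  show "X - Y = X + - Y"
    by transfer (simp add: c0_rel_def c0_zero)
  show "a *\<^sub>R (X + Y) = a *\<^sub>R X + a *\<^sub>R Y"
    by transfer (simp add: c0_rel_def c0_zero algebra_simps)
  show "(a + b) *\<^sub>R X = a *\<^sub>R X + b *\<^sub>R X"
    by transfer (simp add: c0_rel_def c0_zero algebra_simps)
  show "a *\<^sub>R b *\<^sub>R X = (a * b) *\<^sub>R X"
    by transfer (simp add: c0_rel_def c0_zero)
  show "1 *\<^sub>R X = X"
    by transfer (simp add: c0_rel_def c0_zero)
qed

end

instantiation linf_mod_c0 :: real_normed_vector
begin

lift_definition norm_linf_mod_c0 :: "linf_mod_c0 \<Rightarrow> real" is limsup_norm
  by (rule limsup_norm_cong)

definition "dist (X :: linf_mod_c0) Y = norm (X - Y)"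

definition "sgn (X :: linf_mod_c0) = X /\<^sub>R norm X"

definition uniformity_linf_mod_c0 :: "(linf_mod_c0 \<times> linf_mod_c0) filter" where
  "uniformity_linf_mod_c0 = (INF e\<in>{0 <..}. principal {(X, Y). dist X Y < e})"

definition open_linf_mod_c0 :: "linf_mod_c0 set \<Rightarrow> bool" where
  "open_linf_mod_c0 S \<longleftrightarrow> (\<forall>X\<in>S. \<forall>\<^sub>F (X', Y) in uniformity. X' = X \<longrightarrow> Y \<in> S)"

instance
proof
  fix X Y :: linf_mod_c0 and a :: real
  show "norm X = 0 \<longleftrightarrow> X = 0"
    by transfer (simp add: c0_rel_def limsup_norm_eq_0_iff)
  show "norm (X + Y) \<le> norm X + norm Y"
    by transfer (rule limsup_norm_add)
  show "norm (a *\<^sub>R X) = \<bar>a\<bar> * norm X"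
    by transfer (rule limsup_norm_scaleR)
qed (rule dist_linf_mod_c0_def sgn_linf_mod_c0_def uniformity_linf_mod_c0_def
      open_linf_mod_c0_def)+

end

lemma norm_c0_proj:
  "ereal (norm (c0_proj x)) = limsup (\<lambda>n. ereal \<bar>apply_bcontfun x n\<bar>)"
  by (simp add: norm_linf_mod_c0.abs_eq limsup_norm_ereal)


section \<open>First-order logic of graphs\<close>

text \<open>Variables are named by natural numbers.\<close>

datatype fo =
    Eq nat nat
  | Adj nat nat
  | Neg fo
  | Conj fo fo
  | Ex nat fo

primrec free_vars :: "fo \<Rightarrow> nat set" where
  "free_vars (Eq x y) = {x, y}"
| "free_vars (Adj x y) = {x, y}"
| "free_vars (Neg \<phi>) = free_vars \<phi>"
| "free_vars (Conj \<phi> \<psi>) = free_vars \<phi> \<union> free_vars \<psi>"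
| "free_vars (Ex x \<phi>) = free_vars \<phi> - {x}"

definition sentence :: "fo \<Rightarrow> bool" where
  "sentence \<phi> \<longleftrightarrow> free_vars \<phi> = {}"

text \<open>
  A graph is given by its vertex set \<open>V\<close> and its set \<open>E\<close> of edges, which are two-element
  subsets of \<open>V\<close>.
\<close>

primrec sat :: "'v set \<Rightarrow> 'v set set \<Rightarrow> (nat \<Rightarrow> 'v) \<Rightarrow> fo \<Rightarrow> bool" where
  "sat V E s (Eq x y) \<longleftrightarrow> s x = s y"
| "sat V E s (Adj x y) \<longleftrightarrow> {s x, s y} \<in> E"
| "sat V E s (Neg \<phi>) \<longleftrightarrow> \<not> sat V E s \<phi>"
| "sat V E s (Conj \<phi> \<psi>) \<longleftrightarrow> sat V E s \<phi> \<and> sat V E s \<psi>"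
| "sat V E s (Ex x \<phi>) \<longleftrightarrow> (\<exists>v\<in>V. sat V E (s(x := v)) \<phi>)"

lemma sat_cong:
  "(\<And>x. x \<in> free_vars \<phi> \<Longrightarrow> s x = t x) \<Longrightarrow> sat V E s \<phi> \<longleftrightarrow> sat V E t \<phi>"
proof (induction \<phi> arbitrary: s t)
  case (Neg \<phi>)
  have "sat V E s \<phi> \<longleftrightarrow> sat V E t \<phi>"
    using Neg.prems by (intro Neg.IH) simp
  then show ?case by simp
next
  case (Conj \<phi> \<psi>)
  have "sat V E s \<phi> \<longleftrightarrow> sat V E t \<phi>" "sat V E s \<psi> \<longleftrightarrow> sat V E t \<psi>"
    using Conj.prems by (intro Conj.IH; simp)+
  then show ?case by simp
next
  case (Ex x \<phi>)
  have "sat V E (s(x := v)) \<phi> \<longleftrightarrow> sat V E (t(x := v)) \<phi>" for v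
    using Ex.prems by (intro Ex.IH) simp
  then show ?case by simp
qed simp_all

text \<open>
  The assignments below are not restricted to \<open>V\<close>, so that the empty graph (\<open>V = {}\<close>) needs no
  special treatment; for sentences the choice of the assignment is immaterial.
\<close>

definition models :: "'v set \<Rightarrow> 'v set set \<Rightarrow> fo \<Rightarrow> bool" where
  "models V E \<phi> \<longleftrightarrow> (\<forall>s. sat V E s \<phi>)"

lemma models_iff_sat:
  assumes "sentence \<phi>" shows "models V E \<phi> \<longleftrightarrow> sat V E s \<phi>"
  using assms sat_cong[of \<phi>] unfolding models_def sentence_def by blast


section \<open>Random graphs and first-order convergence\<close>

definition pairs :: "nat \<Rightarrow> nat set set" where
  "pairs n = {e. e \<subseteq> {1..n} \<and> card e = 2}"

text \<open>A random graph on \<open>{1..n}\<close> is represented by the distribution of its edge set.\<close>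

(* bernoulli_pmf clamps its parameter to the unit interval, so p is meant to lie in [0,1]. *)

definition binomial_graph :: "nat \<Rightarrow> real \<Rightarrow> nat set set pmf" where
  "binomial_graph n p =
     map_pmf (\<lambda>f. {e \<in> pairs n. f e}) (Pi_pmf (pairs n) False (\<lambda>_. bernoulli_pmf p))"

context includes bcontfun.lifting
begin

lift_definition prob_seq :: "(nat \<Rightarrow> nat set set pmf) \<Rightarrow> fo \<Rightarrow> linf"
  is "\<lambda>D \<phi> n. measure_pmf.prob (D n) {E. models {1..n} E \<phi>}"
  by (rule bcontfun_normI[where b = 1]) simp_all

end

definition FOC :: "(nat \<Rightarrow> nat set set pmf) \<Rightarrow> linf_mod_c0 set" where
  "FOC D = {c0_proj (prob_seq D \<phi>) | \<phi>. sentence \<phi>}"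

end

theory Submission
  imports Defs "HOL-Real_Asymp.Real_Asymp"
begin

text \<open>
  Write \<open>\<alpha> = a/b\<close> in lowest terms. A set \<open>A\<close> of about \<open>n\<^sup>\<theta>\<close> vertices can be turned into its
  neighbourhood, which has about \<open>n\<^sup>\<theta>\<^sup>+\<^sup>1\<^sup>-\<^sup>\<alpha>\<close> elements as long as \<open>\<theta> < \<alpha>\<close>, or be intersected with the
  neighbourhood of one vertex, which leaves about \<open>n\<^sup>\<theta>\<^sup>-\<^sup>\<alpha>\<close> elements if \<open>\<theta> > \<alpha>\<close>. As \<open>a\<close> and \<open>b\<close> are coprime,
  \<open>b - 1\<close> such operations lead from a single vertex to a set of about \<open>n\<^sup>\<alpha>\<close> vertices; this is where
  rationality enters. A vertex \<open>w\<close> is adjacent to some element of such a set with probability bounded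
  away from \<open>0\<close> and \<open>1\<close>. Hence, if sets of this kind are attached to the elements, and to the pairs of
  elements, of a small vertex set \<open>S\<close>, then every subset of \<open>S\<close> and every graph on \<open>S\<close> is coded by
  some \<open>w\<close>. All this follows from three properties of the edge set that hold with high probability by
  Chernoff bounds and union bounds over all vertex sets.

  So first-order sentences can quantify over arbitrary graphs on definable vertex sets of size up to
  about \<open>log log log log n\<close>, and can verify that the size of a definable set is a tower
  \<open>2\<^sup>2\<^sup>\<dots>\<close> of height \<open>k\<close>, together with the residue of \<open>k\<close> modulo a fixed number. The largest such \<open>k\<close> is
  determined by \<open>n\<close> up to an additive constant. This gives sentences \<open>\<phi>\<^sub>k\<close> and sizes \<open>n\<^sub>i\<close> such
  that \<open>\<phi>\<^sub>k\<close> holds with probability at least \<open>3/4\<close> at \<open>n\<^sub>i\<close> if \<open>k\<close> divides \<open>i\<close>, and at most \<open>1/4\<close> otherwise.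
  Any two of them are at distance at least \<open>1/2\<close>.
\<close>

section \<open>Product measures and Chernoff bounds\<close>

text \<open>The vertices chosen during a construction depend on the graph, so no fresh randomness is
  left for later steps; everything is therefore derived from properties quantified over all vertex
  sets. Following the size of one set is not enough: up to s^2 sets are carried along together and
  must stay distinguishable, which is the purpose of the private parts. The constants lost on the
  way grow like an exponential of s^s; this limits the coded structures and dictates the fourfold
  exponential that relates n to s. A coding vertex yields only a symmetric relation, and only on a
  set fixed in advance. Hence a definable set of prescribed size comes first, and directed relations
  go through auxiliary partner vertices. The exact maximal height is never computed. If height h is
  guaranteed and n < tow (h + 8), the maximum lies in a window of eight heights; h is taken to be a
  multiple of 8, and the sentence asks whether the residue of the maximum modulo 8 k is below 8,
  which has the same answer throughout the window.\<close>

definition depends_on :: "'a set \<Rightarrow> (('a \<Rightarrow> 'b) \<Rightarrow> 'c) \<Rightarrow> bool" where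
  "depends_on A F \<longleftrightarrow> (\<forall>f g. (\<forall>x\<in>A. f x = g x) \<longrightarrow> F f = F g)"

lemma depends_onD: "depends_on A F \<Longrightarrow> (\<And>x. x \<in> A \<Longrightarrow> f x = g x) \<Longrightarrow> F f = F g"
  by (simp add: depends_on_def)

lemma expectation_pair_pmf_times:
  fixes f :: "'a \<Rightarrow> real" and g :: "'b \<Rightarrow> real"
  assumes "finite (set_pmf p)" "finite (set_pmf q)"
  shows "measure_pmf.expectation (pair_pmf p q) (\<lambda>(x, y). f x * g y) =
    measure_pmf.expectation p f * measure_pmf.expectation q g"
proof -
  have "measure_pmf.expectation (pair_pmf p q) (\<lambda>(x, y). f x * g y) =
      (\<Sum>z\<in>set_pmf p \<times> set_pmf q. pmf (pair_pmf p q) z * (case z of (x, y) \<Rightarrow> f x * g y))"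
    using assms by (subst integral_measure_pmf[of "set_pmf p \<times> set_pmf q"]) auto
  also have "\<dots> = (\<Sum>x\<in>set_pmf p. \<Sum>y\<in>set_pmf q. (pmf p x * f x) * (pmf q y * g y))"
    by (subst sum.cartesian_product) (auto simp: pmf_pair mult_ac intro!: sum.cong)
  also have "\<dots> = (\<Sum>x\<in>set_pmf p. pmf p x * f x) * (\<Sum>y\<in>set_pmf q. pmf q y * g y)"
    by (simp add: sum_product)
  also have "\<dots> = measure_pmf.expectation p f * measure_pmf.expectation q g"
    using assms by (subst (1 2) integral_measure_pmf[of "set_pmf _"]) auto
  finally show ?thesis .
qed

context
  fixes I :: "'a set" and M :: "'a \<Rightarrow> bool pmf"
  assumes fin: "finite I"
begin

private abbreviation (input) "P \<equiv> Pi_pmf I False M"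
private abbreviation (input) "Pr \<equiv> measure_pmf.prob P"
private abbreviation (input) "EP \<equiv> measure_pmf.expectation P :: (('a \<Rightarrow> bool) \<Rightarrow> real) \<Rightarrow> real"

lemma finite_set_Pi_pmf_bool: "finite (set_pmf P)"
  using fin by (rule finite_subset[OF set_Pi_pmf_subset'])
    (auto intro!: finite_PiE_dflt fin intro: finite_subset[OF subset_UNIV])

text \<open>Splitting the index set into A and its complement writes the measure as a product; F
  reads only the first factor and, B being disjoint from A, G only the second.\<close>

lemma expectation_indep_times:
  fixes F G :: "('a \<Rightarrow> bool) \<Rightarrow> real"
  assumes F: "depends_on A F" and G: "depends_on B G" and AB: "A \<inter> B = {}" "A \<subseteq> I"
  shows "EP (\<lambda>f. F f * G f) = EP F * EP G"
proof -
  let ?m = "\<lambda>(f, g) x. if x \<in> A then f x else g x"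
  let ?PA = "Pi_pmf A False M" and ?PB = "Pi_pmf (I - A) False M"
  have finA: "finite A" "finite (I - A)" using AB fin finite_subset by auto
  have fins: "finite (set_pmf ?PA)" "finite (set_pmf ?PB)"
    using finA by (auto intro!: finite_subset[OF set_Pi_pmf_subset'] finite_PiE_dflt intro: finite_subset[OF subset_UNIV])
  have "Pi_pmf (A \<union> (I - A)) False M = map_pmf ?m (pair_pmf ?PA ?PB)"
    using finA by (intro Pi_pmf_union) auto
  moreover have "A \<union> (I - A) = I" using AB by auto
  ultimately have eq: "P = map_pmf ?m (pair_pmf ?PA ?PB)" by simp
  have Fm: "F (?m z) = F (fst z)" for z
    by (rule depends_onD[OF F]) (auto split: prod.splits)
  have Gm: "G (?m z) = G (snd z)" for z
    by (rule depends_onD[OF G]) (use AB in \<open>auto split: prod.splits\<close>)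
  have E: "EP (\<lambda>f. H f * K f) = measure_pmf.expectation ?PA H' * measure_pmf.expectation ?PB K'"
    if "\<And>z. H (?m z) = H' (fst z)" "\<And>z. K (?m z) = K' (snd z)" for H K H' K' :: "('a \<Rightarrow> bool) \<Rightarrow> real"
    unfolding eq using expectation_pair_pmf_times[OF fins, of H' K'] that
    by (simp add: case_prod_unfold)
  show ?thesis
    \<comment> \<open>Putting the constant 1 for one of the two functions identifies the
      expectations under the factors with those under the whole measure.\<close>
    using E[of F F G G, OF Fm Gm] E[of F F "\<lambda>_. 1" "\<lambda>_. 1", OF Fm] E[of "\<lambda>_. 1" "\<lambda>_. 1" G G, OF _ Gm]
    by simp
qed

lemma expectation_indep_prod:
  fixes F :: "'u \<Rightarrow> ('a \<Rightarrow> bool) \<Rightarrow> real"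
  assumes "finite U" "\<And>u. u \<in> U \<Longrightarrow> depends_on (B u) (F u)" "disjoint_family_on B U"
    "\<And>u. u \<in> U \<Longrightarrow> B u \<subseteq> I"
  shows "EP (\<lambda>f. \<Prod>u\<in>U. F u f) = (\<Prod>u\<in>U. EP (F u))"
  using assms
proof (induction U rule: finite_induct)
  case empty
  then show ?case by simp
next
  case (insert v U)
  have "depends_on (\<Union>u\<in>U. B u) (\<lambda>f. \<Prod>u\<in>U. F u f)"
    unfolding depends_on_def
  proof (intro allI impI prod.cong refl)
    fix f g :: "'a \<Rightarrow> bool" and u assume *: "\<forall>x\<in>\<Union>u\<in>U. B u. f x = g x" "u \<in> U"
    have "depends_on (B u) (F u)" using insert.prems(1)[of u] *(2) by simp
    then show "F u f = F u g"
      by (rule depends_onD) (use * in blast)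
  qed
  moreover have "depends_on (B v) (F v)" using insert.prems by simp
  moreover have "B v \<inter> (\<Union>u\<in>U. B u) = {}"
    using insert.prems(2) insert.hyps by (force simp: disjoint_family_on_def)
  ultimately have "EP (\<lambda>f. F v f * (\<Prod>u\<in>U. F u f)) =
      EP (F v) * EP (\<lambda>f. \<Prod>u\<in>U. F u f)"
    using insert.prems(3)[of v] by (intro expectation_indep_times[where A = "B v" and B = "\<Union>u\<in>U. B u"]) simp_all
  also have "EP (\<lambda>f. \<Prod>u\<in>U. F u f) = (\<Prod>u\<in>U. EP (F u))"
    using insert.prems by (intro insert.IH) (auto simp: disjoint_family_on_def)
  finally show ?case using insert.hyps by simp
qed

text \<open>The generating function of a count of independent events; c = 1/2 serves the lower tail
  and c = 2 the upper one.\<close>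

lemma expectation_power_card:
  fixes Q :: "'u \<Rightarrow> ('a \<Rightarrow> bool) \<Rightarrow> bool" and c :: real
  assumes "finite U" "\<And>u. u \<in> U \<Longrightarrow> depends_on (B u) (Q u)" "disjoint_family_on B U"
    "\<And>u. u \<in> U \<Longrightarrow> B u \<subseteq> I"
  shows "EP (\<lambda>f. c ^ card {u\<in>U. Q u f}) =
    (\<Prod>u\<in>U. 1 + (c - 1) * Pr {f. Q u f})"
proof -
  have "(\<Prod>u\<in>U. if Q u f then c else 1) = c ^ card {u\<in>U. Q u f}" for f
    using assms(1) by (simp add: prod.If_cases Collect_conj_eq)
  then have "EP (\<lambda>f. c ^ card {u\<in>U. Q u f}) =
      EP (\<lambda>f. \<Prod>u\<in>U. if Q u f then c else 1)" by simp
  also have "\<dots> = (\<Prod>u\<in>U. EP (\<lambda>f. if Q u f then c else 1))"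
    using assms by (intro expectation_indep_prod[where B = B]) (auto simp: depends_on_def)
  also have "\<dots> = (\<Prod>u\<in>U. 1 + (c - 1) * Pr {f. Q u f})"
  proof (intro prod.cong refl)
    fix u
    have "EP (\<lambda>f. if Q u f then c else 1) =
        EP (\<lambda>f. 1 + (c - 1) * indicator {f. Q u f} f)"
      by (intro Bochner_Integration.integral_cong refl) (auto simp: indicator_def)
    also have "\<dots> = 1 + (c - 1) * Pr {f. Q u f}"
      by (subst Bochner_Integration.integral_add)
        (auto simp: integrable_measure_pmf_finite[OF finite_set_Pi_pmf_bool])
    finally show "EP (\<lambda>f. if Q u f then c else 1) =
      1 + (c - 1) * Pr {f. Q u f}" .
  qed
  finally show ?thesis .
qed

section \<open>Tail bounds for the number of independent events that occur\<close>

lemma prob_le_expectation: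
  fixes h :: "('a \<Rightarrow> bool) \<Rightarrow> real"
  assumes "\<And>f. h f \<ge> 0" "\<And>f. f \<in> X \<Longrightarrow> h f \<ge> c" "c > 0"
  shows "Pr X \<le> EP h / c"
proof -
  have "c * Pr X = EP (\<lambda>f. c * indicator X f)"
    by simp
  also have "\<dots> \<le> EP h"
    by (intro integral_mono integrable_measure_pmf_finite[OF finite_set_Pi_pmf_bool])
      (use assms in \<open>auto simp: indicator_def\<close>)
  finally show ?thesis using assms(3) by (simp add: field_simps)
qed

text \<open>Markov's inequality for (1/2)^count. With T = card U * \<mu> / 4 the expectation is at
  most exp (- 2 T), and dividing by (1/2)^T costs only exp (T ln 2) <= exp T.\<close>

lemma chernoff_lower:
  fixes Q :: "'u \<Rightarrow> ('a \<Rightarrow> bool) \<Rightarrow> bool" and \<mu> :: real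
  assumes "finite U" "\<And>u. u \<in> U \<Longrightarrow> depends_on (B u) (Q u)" "disjoint_family_on B U"
    "\<And>u. u \<in> U \<Longrightarrow> B u \<subseteq> I"
    and \<mu>: "\<And>u. u \<in> U \<Longrightarrow> \<mu> \<le> Pr {f. Q u f}"
  shows "Pr {f. real (card {u\<in>U. Q u f}) < card U * \<mu> / 4} \<le> exp (- (card U * \<mu> / 4))"
proof -
  let ?t = "card U * \<mu> / 4"
  have "Pr {f. real (card {u\<in>U. Q u f}) < ?t} \<le>
      EP (\<lambda>f. (1/2) ^ card {u\<in>U. Q u f}) / ((1/2) powr ?t)"
  proof (rule prob_le_expectation)
    fix f assume "f \<in> {f. real (card {u\<in>U. Q u f}) < ?t}"
    then show "(1/2) powr ?t \<le> (1/2 :: real) ^ card {u\<in>U. Q u f}"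
      by (subst powr_realpow[symmetric]) (auto intro!: powr_mono')
  qed auto
  also have "EP (\<lambda>f. (1/2) ^ card {u\<in>U. Q u f}) =
      (\<Prod>u\<in>U. 1 + (1/2 - 1) * Pr {f. Q u f})"
    by (rule expectation_power_card) (use assms in auto)
  also have "\<dots> \<le> (\<Prod>u\<in>U. exp (- \<mu> / 2))"
  proof (intro prod_mono conjI)
    fix u assume "u \<in> U"
    show "0 \<le> 1 + (1/2 - 1) * Pr {f. Q u f}"
      using order_trans[OF measure_pmf.prob_le_1[of P "{f. Q u f}"], of 2] by simp
    have "1 + (1/2 - 1) * Pr {f. Q u f} \<le> 1 + (- \<mu> / 2)"
      using \<mu>[OF \<open>u \<in> U\<close>] by simp
    also have "\<dots> \<le> exp (- \<mu> / 2)" by (rule exp_ge_add_one_self)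
    finally show "1 + (1/2 - 1) * Pr {f. Q u f} \<le> exp (- \<mu> / 2)" .
  qed
  also have "(\<Prod>u\<in>U. exp (- \<mu> / 2)) = exp (- 2 * ?t)"
    by (simp flip: exp_of_nat_mult)
  finally have le: "Pr {f. real (card {u\<in>U. Q u f}) < ?t} \<le> exp (- 2 * ?t) / ((1/2) powr ?t)"
    by (simp add: divide_right_mono)
  show ?thesis
  proof (cases "?t \<ge> 0")
    case True
    have "(1/2 :: real) powr ?t = exp (- (?t * ln 2))" by (simp add: powr_def ln_div)
    then have "exp (- 2 * ?t) / ((1/2) powr ?t) = exp (- 2 * ?t + ?t * ln 2)"
      by (simp flip: exp_diff)
    also have "ln 2 \<le> (1 :: real)" using ln_le_minus_one[of "2::real"] by simp
    then have "?t * ln 2 \<le> ?t * 1" using True mult_left_mono by blast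
    then have "exp (- 2 * ?t + ?t * ln 2) \<le> exp (- ?t)" unfolding exp_le_cancel_iff by linarith
    finally show ?thesis using le by linarith
  next
    \<comment> \<open>A negative \<mu> gives a negative threshold, and no count lies below
      it.\<close>
    case False
    then have "\<not> real (card {u\<in>U. Q u f}) < ?t" for f
      using of_nat_0_le_iff[of "card {u\<in>U. Q u f}", where ?'a = real] by linarith
    then show ?thesis by simp
  qed
qed

text \<open>Markov's inequality for 2^count: the expectation is at most exp (card U * \<mu>) <= exp
  (t / 4), whereas 2 powr t is at least exp (t / 2).\<close>

lemma chernoff_upper:
  fixes Q :: "'u \<Rightarrow> ('a \<Rightarrow> bool) \<Rightarrow> bool" and \<mu> :: real
  assumes "finite U" "\<And>u. u \<in> U \<Longrightarrow> depends_on (B u) (Q u)" "disjoint_family_on B U"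
    "\<And>u. u \<in> U \<Longrightarrow> B u \<subseteq> I"
    and \<mu>: "\<And>u. u \<in> U \<Longrightarrow> Pr {f. Q u f} \<le> \<mu>"
    and t: "t \<ge> 4 * card U * \<mu>" "\<mu> \<ge> 0"
  shows "Pr {f. real (card {u\<in>U. Q u f}) > t} \<le> exp (- t / 4)"
proof -
  have "Pr {f. real (card {u\<in>U. Q u f}) > t} \<le>
      EP (\<lambda>f. 2 ^ card {u\<in>U. Q u f}) / (2 powr t)"
  proof (rule prob_le_expectation)
    fix f assume "f \<in> {f. real (card {u\<in>U. Q u f}) > t}"
    then show "2 powr t \<le> (2 :: real) ^ card {u\<in>U. Q u f}"
      by (subst powr_realpow[symmetric]) (auto intro!: powr_mono)
  qed auto
  also have "EP (\<lambda>f. 2 ^ card {u\<in>U. Q u f}) =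
      (\<Prod>u\<in>U. 1 + (2 - 1) * Pr {f. Q u f})"
    by (rule expectation_power_card) (use assms in auto)
  also have "\<dots> \<le> (\<Prod>u\<in>U. exp \<mu>)"
  proof (intro prod_mono conjI)
    fix u assume "u \<in> U"
    show "0 \<le> 1 + (2 - 1) * Pr {f. Q u f}" by simp
    have "1 + (2 - 1) * Pr {f. Q u f} \<le> 1 + \<mu>"
      using \<mu>[OF \<open>u \<in> U\<close>] by simp
    also have "\<dots> \<le> exp \<mu>" by (rule exp_ge_add_one_self)
    finally show "1 + (2 - 1) * Pr {f. Q u f} \<le> exp \<mu>" .
  qed
  also have "(\<Prod>u\<in>U. exp \<mu>) = exp (card U * \<mu>)"
    by (simp flip: exp_of_nat_mult)
  also have "\<dots> \<le> exp (t / 4)" using t by simp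
  also have "exp (t / 4) / (2 powr t) \<le> exp (- t / 4)"
  proof -
    have "0 \<le> 4 * card U * \<mu>" using t(2) by simp
    then have "t \<ge> 0" using t(1) by linarith
    have "2 powr t = exp (t * ln 2)" by (simp add: powr_def)
    moreover have "ln 2 \<ge> (1/2 :: real)" using ln_ge_iff[of "2::real" "1/2"] exp_bound[of "1/2"] 
      by (simp add: power2_eq_square)
    then have "t * ln 2 \<ge> t * (1/2)" using \<open>t \<ge> 0\<close> mult_left_mono by blast
    ultimately show ?thesis by (simp flip: exp_diff)
  qed
  finally show ?thesis by (simp add: divide_right_mono)
qed

lemma prob_indep_Ball:
  fixes Q :: "'u \<Rightarrow> ('a \<Rightarrow> bool) \<Rightarrow> bool"
  assumes "finite U" "\<And>u. u \<in> U \<Longrightarrow> depends_on (B u) (Q u)" "disjoint_family_on B U"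
    "\<And>u. u \<in> U \<Longrightarrow> B u \<subseteq> I"
  shows "Pr {f. \<forall>u\<in>U. Q u f} = (\<Prod>u\<in>U. Pr {f. Q u f})"
proof -
  have "Pr {f. \<forall>u\<in>U. Q u f} = EP (indicator {f. \<forall>u\<in>U. Q u f})"
    by simp
  also have "(indicator {f. \<forall>u\<in>U. Q u f} :: _ \<Rightarrow> real) = (\<lambda>f. \<Prod>u\<in>U. indicator {f. Q u f} f)"
    using assms(1) by (auto simp: indicator_def fun_eq_iff)
  also have "EP \<dots> = (\<Prod>u\<in>U. EP (indicator {f. Q u f}))"
    using assms by (intro expectation_indep_prod[where B = B]) (auto simp: depends_on_def indicator_def)
  finally show ?thesis by simp
qed

end

section \<open>Pseudorandomness of the binomial random graph\<close>

definition nbr :: "'v set set \<Rightarrow> 'v \<Rightarrow> 'v set" where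
  "nbr E v = {u. {u, v} \<in> E}"

definition graph_of :: "nat \<Rightarrow> (nat set \<Rightarrow> bool) \<Rightarrow> nat set set" where
  "graph_of n f = {e \<in> pairs n. f e}"

text \<open>The event behind all codings: with private parts of a family as CC and the union of the
  family as C, it fixes which members u is adjacent to and which it avoids.\<close>

definition one_each :: "'v set set \<Rightarrow> 'v set \<Rightarrow> 'v set set \<Rightarrow> 'v \<Rightarrow> bool" where
  "one_each E C CC u \<longleftrightarrow> (\<forall>A\<in>CC. card (nbr E u \<inter> A) = 1) \<and> nbr E u \<inter> C \<subseteq> \<Union>CC"

text \<open>A lower bound for the probability of \<open>one_each\<close>: the product counts the
  choices of one neighbour in each member of CC, and the exponent card C rounds up the number of
  edges that must be absent.\<close>

definition one_each_weight :: "real \<Rightarrow> 'v set \<Rightarrow> 'v set set \<Rightarrow> real" where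
  "one_each_weight p C CC = p ^ card CC * (\<Prod>A\<in>CC. real (card A)) * (1 - p) ^ card C"

lemma finite_pairs [simp]: "finite (pairs n)"
  by (rule finite_subset[of _ "Pow {1..n}"]) (auto simp: pairs_def)

lemma doubleton_in_pairs: "{u, v} \<in> pairs n \<longleftrightarrow> u \<in> {1..n} \<and> v \<in> {1..n} \<and> u \<noteq> v"
  by (cases "u = v") (auto simp: pairs_def)

lemma nbr_graph_of:
  "nbr (graph_of n f) v = {u \<in> {1..n}. v \<in> {1..n} \<and> u \<noteq> v \<and> f {u, v}}"
  by (auto simp: nbr_def graph_of_def doubleton_in_pairs)

lemma sum_power_card_Pow:
  fixes x :: real
  assumes "finite S" shows "(\<Sum>A\<in>Pow S. x ^ card A) = (1 + x) ^ card S"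
proof -
  have "(\<Prod>i\<in>S. x + 1) = (\<Sum>A\<in>Pow S. (\<Prod>i\<in>A. x) * (\<Prod>i\<in>S - A. 1))"
    by (rule prod_add[OF assms])
  then show ?thesis by (simp add: add.commute)
qed

lemma union_bound:
  assumes "finite X" "\<And>x. x \<in> X \<Longrightarrow> measure_pmf.prob M (A x) \<le> g x"
  shows "measure_pmf.prob M (\<Union>x\<in>X. A x) \<le> sum g X"
proof -
  have "measure_pmf.prob M (\<Union>x\<in>X. A x) \<le> (\<Sum>x\<in>X. measure_pmf.prob M (A x))"
    using assms(1) by (intro measure_pmf.finite_measure_subadditive_finite) auto
  also have "\<dots> \<le> sum g X" by (intro sum_mono assms(2))
  finally show ?thesis .
qed

lemma measure_pmf_mono: "A \<subseteq> B \<Longrightarrow> measure_pmf.prob M A \<le> measure_pmf.prob M B"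
  by (rule measure_pmf.finite_measure_mono) auto

lemma ex2_iff_Bex: "(\<And>x y. R x y \<Longrightarrow> (x, y) \<in> S) \<Longrightarrow> (\<exists>x y. R x y) \<longleftrightarrow> (\<exists>u\<in>S. R (fst u) (snd u))"
  by force

text \<open>With at least 100 n expected edges between X and Z, a single failure has probability at
  most exp (- 25 n), which survives a union bound over the 4^n pairs of sets.\<close>

definition sparse_cut :: "nat \<Rightarrow> real \<Rightarrow> nat set \<Rightarrow> nat set \<Rightarrow> nat set set \<Rightarrow> bool" where
  "sparse_cut n p X Z E \<longleftrightarrow> X \<subseteq> {1..n} \<and> Z \<subseteq> {1..n} \<and> X \<inter> Z = {} \<and> card X * card Z * p \<ge> 100 * n \<and>
    real (\<Sum>z\<in>Z. card (nbr E z \<inter> X)) < card X * card Z * p / 4" for n :: nat and p :: real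

text \<open>The logarithmic factor pays for a union bound over all C and all families CC of subsets
  of C. The divisor 8 combines the 4 of the lower tail with the loss of at most half of the vertices
  to C.\<close>

definition few_one_each :: "nat \<Rightarrow> real \<Rightarrow> nat set \<Rightarrow> nat set set \<Rightarrow> nat set set \<Rightarrow> bool" where
  "few_one_each n p C CC E \<longleftrightarrow> C \<subseteq> {1..n} \<and> CC \<subseteq> Pow C \<and> disjoint CC \<and> 2 * card C \<le> n \<and>
    n * one_each_weight p C CC \<ge> 100 * (card CC + 2) * (card C + 1) * ln n \<and>
    real (card {u \<in> {1..n} - C. one_each E C CC u}) < n * one_each_weight p C CC / 8" for n :: nat and p :: real

definition pseudo_random :: "nat \<Rightarrow> real \<Rightarrow> nat set set \<Rightarrow> bool" where
  "pseudo_random n p E \<longleftrightarrow> E \<subseteq> pairs n \<and> (\<forall>v\<in>{1..n}. real (card (nbr E v)) \<le> 4 * n * p) \<and>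
    (\<forall>X Z. \<not> sparse_cut n p X Z E) \<and> (\<forall>C CC. \<not> few_one_each n p C CC E)" for n :: nat and p :: real

section \<open>Failure probabilities of the three graph properties\<close>

context
  fixes n :: nat and p :: real
  assumes p: "0 \<le> p" "p \<le> 1"
begin

private abbreviation (input) "PG \<equiv> Pi_pmf (pairs n) False (\<lambda>_. bernoulli_pmf p)"
private abbreviation (input) "PrG \<equiv> measure_pmf.prob PG"

lemma prob_edge:
  assumes "e \<in> pairs n" shows "PrG {f. f e} = p" "PrG {f. \<not> f e} = 1 - p"
proof -
  have "map_pmf (\<lambda>f. f e) PG = bernoulli_pmf p"
    using assms by (simp add: Pi_pmf_component)
  then have "PrG ((\<lambda>f. f e) -` {b}) = pmf (bernoulli_pmf p) b" for b
    by (metis measure_map_pmf measure_pmf_single)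
  from this[of True] this[of False] show "PrG {f. f e} = p" "PrG {f. \<not> f e} = 1 - p"
    using p by (simp_all add: vimage_def)
qed

lemma prob_degree:
  "PrG {f. \<exists>v\<in>{1..n}. real (card (nbr (graph_of n f) v)) > 4 * n * p} \<le> n * exp (- (n * p))"
proof -
  have "PrG {f. real (card (nbr (graph_of n f) v)) > 4 * n * p} \<le> exp (- (n * p))"
    if v: "v \<in> {1..n}" for v
  proof -
    let ?U = "{1..n} - {v}"
    have "PrG {f. real (card {u\<in>?U. f {u, v}}) > 4 * n * p} \<le> exp (- (4 * n * p) / 4)"
    proof (rule chernoff_upper[where B = "\<lambda>u. {{u, v}}" and \<mu> = p])
      show "4 * n * p \<ge> 4 * card ?U * p"
        using p v by (intro mult_right_mono) auto
      show "PrG {f. f {u, v}} \<le> p" if "u \<in> ?U" for u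
        using that v by (subst prob_edge) (auto simp: doubleton_in_pairs)
      show "disjoint_family_on (\<lambda>u. {{u, v}}) ?U"
        by (auto simp: disjoint_family_on_def doubleton_eq_iff)
      show "{{u, v}} \<subseteq> pairs n" if "u \<in> ?U" for u
        using that v by (auto simp: doubleton_in_pairs)
    qed (auto simp: depends_on_def p)
    moreover have "nbr (graph_of n f) v = {u\<in>?U. f {u, v}}" for f
      using v by (auto simp: nbr_graph_of)
    ultimately show ?thesis by simp
  qed
  then have "PrG (\<Union>v\<in>{1..n}. {f. real (card (nbr (graph_of n f) v)) > 4 * n * p})
      \<le> (\<Sum>v\<in>{1..n}. exp (- (n * p)))"
    by (intro union_bound) auto
  also have "(\<Union>v\<in>{1..n}. {f. real (card (nbr (graph_of n f) v)) > 4 * n * p}) =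
      {f. \<exists>v\<in>{1..n}. real (card (nbr (graph_of n f) v)) > 4 * n * p}" by auto
  finally show ?thesis by simp
qed

lemma prob_sparse_cut:
  "PrG {f. \<exists>X Z. sparse_cut n p X Z (graph_of n f)} \<le> exp (- real n)"
proof -
  have one: "PrG {f. sparse_cut n p X Z (graph_of n f)} \<le> exp (- (25 * real n))" for X Z
  proof (cases "X \<subseteq> {1..n} \<and> Z \<subseteq> {1..n} \<and> X \<inter> Z = {} \<and> card X * card Z * p \<ge> 100 * n")
    case True
    then have fin: "finite X" "finite Z" by (auto intro: finite_subset)
    let ?U = "Z \<times> X"
    have "PrG {f. real (card {u\<in>?U. f {snd u, fst u}}) < card ?U * p / 4} \<le> exp (- (card ?U * p / 4))"
    proof (rule chernoff_lower[where B = "\<lambda>u. {{snd u, fst u}}" and \<mu> = p])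
      show "p \<le> PrG {f. f {snd u, fst u}}" if "u \<in> ?U" for u
        using that True by (subst prob_edge) (auto simp: doubleton_in_pairs)
      show "disjoint_family_on (\<lambda>u. {{snd u, fst u}}) ?U"
        using True by (auto simp: disjoint_family_on_def doubleton_eq_iff)
      show "{{snd u, fst u}} \<subseteq> pairs n" if "u \<in> ?U" for u
        using that True by (auto simp: doubleton_in_pairs)
    qed (auto simp: depends_on_def p fin)
    moreover have "exp (- (card ?U * p / 4)) \<le> exp (- (25 * real n))"
      using True by (simp add: card_cartesian_product mult_ac)
    moreover have "(\<Sum>z\<in>Z. card (nbr (graph_of n f) z \<inter> X)) = card {u\<in>?U. f {snd u, fst u}}" for f
    proof -
      have "{u\<in>?U. f {snd u, fst u}} = (SIGMA z:Z. nbr (graph_of n f) z \<inter> X)"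
        using True by (auto simp: nbr_graph_of)
      moreover have "finite (nbr (graph_of n f) z \<inter> X)" for z using fin by auto
      ultimately show ?thesis using fin by (simp add: card_SigmaI)
    qed
    ultimately show ?thesis using True
      by (simp add: sparse_cut_def card_cartesian_product mult_ac) (erule order_trans, simp)
  next
    case False
    then have "{f. sparse_cut n p X Z (graph_of n f)} = {}" by (auto simp: sparse_cut_def)
    then show ?thesis by simp
  qed
  have "{f. \<exists>X Z. sparse_cut n p X Z (graph_of n f)} =
      (\<Union>u\<in>Pow {1..n} \<times> Pow {1..n}. {f. sparse_cut n p (fst u) (snd u) (graph_of n f)})"
  proof -
    have "(\<exists>X Z. sparse_cut n p X Z E) \<longleftrightarrow> (\<exists>u\<in>Pow {1..n} \<times> Pow {1..n}. sparse_cut n p (fst u) (snd u) E)" for E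
      by (rule ex2_iff_Bex) (simp add: sparse_cut_def)
    then show ?thesis by (intro set_eqI) (simp only: mem_Collect_eq UN_iff)
  qed
  also have "PrG \<dots> \<le> (\<Sum>u\<in>Pow {1..n} \<times> Pow {1..n}. exp (- (25 * real n)))"
    by (intro union_bound one) auto
  also have "\<dots> = 4 ^ n * exp (- (25 * real n))"
    by (simp add: card_cartesian_product card_Pow flip: power_mult_distrib)
  \<comment> \<open>25 = 24 + 1: the crude bound 4 <= exp 24 absorbs the number of pairs and leaves
    exp (- n).\<close>
  also have "(4 :: real) ^ n \<le> exp 24 ^ n"
    using exp_ge_add_one_self[of 24] by (intro power_mono) auto
  then have "4 ^ n * exp (- (25 * real n)) \<le> exp 24 ^ n * exp (- (25 * real n))"
    by simp
  also have "\<dots> = exp (- real n)"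
    by (simp flip: exp_of_nat_mult exp_add)
  finally show ?thesis .
qed

lemma prob_nbr_eq:
  assumes "u \<in> {1..n}" "C \<subseteq> {1..n}" "u \<notin> C" "W \<subseteq> C"
  shows "PrG {f. \<forall>v\<in>C. f {v, u} \<longleftrightarrow> v \<in> W} = p ^ card W * (1 - p) ^ (card C - card W)"
proof -
  have fin: "finite C" "finite W" using assms by (auto intro: finite_subset)
  have "PrG {f. \<forall>v\<in>C. f {v, u} \<longleftrightarrow> v \<in> W} =
      (\<Prod>v\<in>C. PrG {f. f {v, u} \<longleftrightarrow> v \<in> W})"
    using assms fin by (intro prob_indep_Ball[where B = "\<lambda>v. {{v, u}}"])
      (auto simp: depends_on_def disjoint_family_on_def doubleton_eq_iff doubleton_in_pairs)
  also have "\<dots> = (\<Prod>v\<in>C. if v \<in> W then p else 1 - p)"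
    using assms by (intro prod.cong refl) (auto simp: doubleton_in_pairs intro!: prob_edge)
  also have "\<dots> = p ^ card (C \<inter> W) * (1 - p) ^ card (C - W)"
    using fin by (simp add: prod.If_cases Diff_eq)
  also have "C \<inter> W = W" using assms by auto
  finally show ?thesis using fin assms by (simp add: card_Diff_subset)
qed

text \<open>Each choice h of one element from every member of CC gives the event that the
  neighbourhood of u in C is exactly the image of h. Since CC is disjoint, different choices have
  different images, so these events exclude each other and their probabilities add up.\<close>

lemma prob_one_each:
  assumes "u \<in> {1..n}" "C \<subseteq> {1..n}" "u \<notin> C" "CC \<subseteq> Pow C" "disjoint CC"
  shows "one_each_weight p C CC \<le> PrG {f. one_each (graph_of n f) C CC u}"
proof (cases "{} \<in> CC")
  case True
  have "finite C" using assms by (auto intro: finite_subset)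
  then have "finite CC" using assms(4) by (auto intro: finite_subset)
  then have "(\<Prod>A\<in>CC. real (card A)) = 0" using True by (intro prod_zero bexI[of _ "{}"]) auto
  then show ?thesis by (simp add: one_each_weight_def)
next
  case False
  have fin: "finite C" using assms by (auto intro: finite_subset)
  then have finCC: "finite CC" using assms(4) by (auto intro: finite_subset)
  have finA: "finite A" if "A \<in> CC" for A using that assms fin by (auto intro: finite_subset)
  let ?H = "PiE CC (\<lambda>A. A)"
  have H: "h ` CC \<inter> A = {h A}" if "h \<in> ?H" "A \<in> CC" for h A
  proof -
    have "B = A" if "B \<in> CC" "h B \<in> A" for B
      using disjointD[OF assms(5) \<open>B \<in> CC\<close> \<open>A \<in> CC\<close>] PiE_mem[OF \<open>h \<in> ?H\<close> \<open>B \<in> CC\<close>] that by blast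
    then show ?thesis using PiE_mem[OF that] that(2) by blast
  qed
  have HC: "h ` CC \<subseteq> C" if "h \<in> ?H" for h using PiE_mem[OF that] assms(4) by blast
  have inj: "h = h'" if "h \<in> ?H" "h' \<in> ?H" "h ` CC = h' ` CC" for h h'
  proof (rule PiE_ext[OF that(1,2)])
    fix A assume "A \<in> CC"
    then have "{h A} = {h' A}" using H that by metis
    then show "h A = h' A" by simp
  qed
  have cardH: "card (h ` CC) = card CC" if "h \<in> ?H" for h
  proof (rule card_image, rule inj_onI)
    fix A B assume *: "A \<in> CC" "B \<in> CC" "h A = h B"
    then have "h A \<in> A \<inter> B" using PiE_mem[OF that *(1)] PiE_mem[OF that *(2)] by simp
    then show "A = B" using assms(5) * by (auto simp: disjoint_def)
  qed
  have cardle: "card CC \<le> card C" if "h \<in> ?H" for h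
    using card_mono[OF fin HC[OF that]] cardH[OF that] by simp
  let ?W = "\<lambda>h. {f. \<forall>v\<in>C. f {v, u} \<longleftrightarrow> v \<in> h ` CC}"
  have "one_each_weight p C CC = (\<Sum>h\<in>?H. p ^ card CC * (1 - p) ^ card C)"
    using finCC by (simp add: one_each_weight_def card_PiE of_nat_prod)
  also have "\<dots> \<le> (\<Sum>h\<in>?H. PrG (?W h))"
  proof (rule sum_mono)
    fix h assume h: "h \<in> ?H"
    have "(1 - p) ^ card C \<le> (1 - p) ^ (card C - card (h ` CC))"
      using p by (intro power_decreasing) auto
    then show "p ^ card CC * (1 - p) ^ card C \<le> PrG (?W h)"
      using HC[OF h] assms p cardH[OF h] by (subst prob_nbr_eq) (auto intro!: mult_left_mono)
  qed
  also have "\<dots> = PrG (\<Union>h\<in>?H. ?W h)"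
  proof (rule measure_pmf.finite_measure_finite_Union[symmetric])
    show "finite ?H" using finCC finA by (intro finite_PiE) auto
    show "disjoint_family_on ?W ?H"
      unfolding disjoint_family_on_def
    proof (intro ballI impI)
      fix h h' assume h: "h \<in> ?H" "h' \<in> ?H" "h \<noteq> h'"
      then have "h ` CC \<noteq> h' ` CC" using inj by blast
      then obtain v where "v \<in> C" "v \<in> h ` CC \<longleftrightarrow> v \<notin> h' ` CC"
        using HC[OF h(1)] HC[OF h(2)] by blast
      then show "?W h \<inter> ?W h' = {}" by auto
    qed
  qed auto
  also have "\<dots> \<le> PrG {f. one_each (graph_of n f) C CC u}"
  proof (rule measure_pmf.finite_measure_mono)
    show "(\<Union>h\<in>?H. ?W h) \<subseteq> {f. one_each (graph_of n f) C CC u}"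
    proof safe
      fix h f assume h: "h \<in> ?H" and f: "\<forall>v\<in>C. f {v, u} \<longleftrightarrow> v \<in> h ` CC"
      have eq: "nbr (graph_of n f) u \<inter> C = h ` CC"
      proof -
        have "nbr (graph_of n f) u \<inter> C = {v\<in>C. f {v, u}}"
          using assms(1-3) by (auto simp: nbr_graph_of)
        then show ?thesis using f HC[OF h] by blast
      qed
      have "nbr (graph_of n f) u \<inter> A = {h A}" if "A \<in> CC" for A
        using H[OF h that] eq assms(4) that by blast
      moreover have "h ` CC \<subseteq> \<Union>CC" using PiE_mem[OF h] by blast
      ultimately show "one_each (graph_of n f) C CC u"
        using eq by (auto simp: one_each_def)
    qed
  qed auto
  finally show ?thesis .
qed

text \<open>A weighted union bound. With x = 1/n, the factor (x ^ (card C + 1)) ^ card CC keeps the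
  sum over all families CC bounded, (x ^ 2) ^ card C does the same for the sum over C, and x ^ 3
  remains as gain.\<close>

lemma prob_few_one_each:
  assumes n: "n \<ge> 2"
  shows "PrG {f. \<exists>C CC. few_one_each n p C CC (graph_of n f)} \<le> 9 / n"
proof -
  define x where "x = 1 / real n"
  have x: "0 < x" "x \<le> 1 / 2" using n by (auto simp: x_def field_simps)
  have lnx: "exp (- real k * ln n) = x ^ k" for k
  proof -
    have "exp (- ln n) = x" using n by (simp add: x_def exp_minus inverse_eq_divide)
    then show ?thesis using exp_of_nat_mult[of k "- ln n"] by simp
  qed
  have one: "PrG {f. few_one_each n p C CC (graph_of n f)}
      \<le> x ^ 3 * ((x ^ 2) ^ card C * (x ^ (card C + 1)) ^ card CC)" for C CC
  proof (cases "C \<subseteq> {1..n} \<and> CC \<subseteq> Pow C \<and> disjoint CC \<and> 2 * card C \<le> n \<and>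
      n * one_each_weight p C CC \<ge> 100 * (card CC + 2) * (card C + 1) * ln n")
    case True
    let ?U = "{1..n} - C" and ?\<mu> = "one_each_weight p C CC"
    have finC: "finite C" using True by (auto intro: finite_subset)
    have \<mu>0: "0 \<le> ?\<mu>" using p by (auto simp: one_each_weight_def intro!: mult_nonneg_nonneg prod_nonneg)
    have cU: "real (card ?U) \<ge> n / 2"
      using True finC by (subst card_Diff_subset) auto
    have le: "n * ?\<mu> / 8 \<le> card ?U * ?\<mu> / 4"
      using mult_right_mono[OF cU \<mu>0] by simp
    have "PrG {f. real (card {u\<in>?U. one_each (graph_of n f) C CC u}) < card ?U * ?\<mu> / 4}
        \<le> exp (- (card ?U * ?\<mu> / 4))"
    proof (rule chernoff_lower[where B = "\<lambda>u. (\<lambda>v. {v, u}) ` C"])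
      show "?\<mu> \<le> PrG {f. one_each (graph_of n f) C CC u}" if "u \<in> ?U" for u
        using that True by (intro prob_one_each) auto
      show "disjoint_family_on (\<lambda>u. (\<lambda>v. {v, u}) ` C) ?U"
        by (auto simp: disjoint_family_on_def doubleton_eq_iff)
      show "(\<lambda>v. {v, u}) ` C \<subseteq> pairs n" if "u \<in> ?U" for u
        using that True by (auto simp: doubleton_in_pairs)
      show "depends_on ((\<lambda>v. {v, u}) ` C) (\<lambda>f. one_each (graph_of n f) C CC u)" if "u \<in> ?U" for u
        unfolding depends_on_def
      proof (intro allI impI)
        fix f g :: "nat set \<Rightarrow> bool" assume fg: "\<forall>e\<in>(\<lambda>v. {v, u}) ` C. f e = g e"
        have eq: "nbr (graph_of n f) u \<inter> A = nbr (graph_of n g) u \<inter> A" if "A \<subseteq> C" for A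
          using fg that by (auto simp: nbr_graph_of)
        have "A \<subseteq> C" if "A \<in> CC" for A using that True by auto
        then show "one_each (graph_of n f) C CC u = one_each (graph_of n g) C CC u"
          unfolding one_each_def using eq by (metis order_refl)
      qed
    qed auto
    moreover have "{f. few_one_each n p C CC (graph_of n f)} \<subseteq>
        {f. real (card {u\<in>?U. one_each (graph_of n f) C CC u}) < card ?U * ?\<mu> / 4}"
      using le by (auto simp: few_one_each_def)
    ultimately have "PrG {f. few_one_each n p C CC (graph_of n f)} \<le> exp (- (card ?U * ?\<mu> / 4))"
      by (meson measure_pmf_mono order_trans)
    also have "\<dots> \<le> exp (- (n * ?\<mu> / 8))" using le by simp
    also have "\<dots> \<le> exp (- real (3 + 2 * card C + (card C + 1) * card CC) * ln n)"
    proof -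
      let ?c = "real (card C)" and ?r = "real (card CC)"
      \<comment> \<open>The factor 12 fits below 100 / 8, where 100 is the constant of
        \<open>few_one_each\<close> and 8 that of the tail bound.\<close>
      have "3 + 2 * ?c + (?c + 1) * ?r \<le> 12 * ((?r + 2) * (?c + 1))"
        by (simp add: algebra_simps)
      then have "(3 + 2 * ?c + (?c + 1) * ?r) * ln n \<le> 12 * ((?r + 2) * (?c + 1)) * ln n"
        using n by (intro mult_right_mono) auto
      also have "\<dots> \<le> 100 * ((?r + 2) * (?c + 1)) * ln n / 8"
        using n by (simp add: field_simps)
      also have "\<dots> \<le> n * ?\<mu> / 8" using True by (simp add: algebra_simps)
      finally show ?thesis by (simp add: algebra_simps)
    qed
    also have "\<dots> = x ^ 3 * ((x ^ 2) ^ card C * (x ^ (card C + 1)) ^ card CC)"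
      unfolding lnx by (simp only: power_add power_mult mult.assoc)
    finally show ?thesis .
  next
    case False
    then have "{f. few_one_each n p C CC (graph_of n f)} = {}" by (auto simp: few_one_each_def)
    then have "PrG {f. few_one_each n p C CC (graph_of n f)} = 0" by simp
    then show ?thesis using x by simp
  qed
  let ?X = "SIGMA C:Pow {1..n}. Pow (Pow C)"
  have "{f. \<exists>C CC. few_one_each n p C CC (graph_of n f)} =
      (\<Union>u\<in>?X. {f. few_one_each n p (fst u) (snd u) (graph_of n f)})"
  proof -
    have "(\<exists>X Z. few_one_each n p X Z E) \<longleftrightarrow> (\<exists>u\<in>?X. few_one_each n p (fst u) (snd u) E)" for E
      by (rule ex2_iff_Bex) (simp add: few_one_each_def)
    then show ?thesis by (intro set_eqI) (simp only: mem_Collect_eq UN_iff)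
  qed
  also have "PrG \<dots> \<le> (\<Sum>u\<in>?X. x ^ 3 * ((x ^ 2) ^ card (fst u) * (x ^ (card (fst u) + 1)) ^ card (snd u)))"
    by (intro union_bound one finite_SigmaI) (auto intro: finite_subset)
  also have "\<dots> = x ^ 3 * (\<Sum>C\<in>Pow {1..n}. (x ^ 2) ^ card C * (\<Sum>CC\<in>Pow (Pow C). (x ^ (card C + 1)) ^ card CC))"
    unfolding sum_distrib_left
    by (subst sum.Sigma) (auto intro: finite_subset simp: case_prod_unfold)
  also have "\<dots> \<le> x ^ 3 * (\<Sum>C\<in>Pow {1..n}. (x ^ 2) ^ card C * 3)"
  proof (intro mult_left_mono sum_mono)
    fix C assume C: "C \<in> Pow {1..n}"
    then have fin: "finite C" by (auto intro: finite_subset)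
    have "(\<Sum>CC\<in>Pow (Pow C). (x ^ (card C + 1)) ^ card CC) = (1 + x ^ (card C + 1)) ^ (2 ^ card C)"
      using fin by (simp only: sum_power_card_Pow finite_Pow_iff card_Pow)
    also have "\<dots> \<le> exp (x ^ (card C + 1)) ^ (2 ^ card C)"
      using x by (intro power_mono exp_ge_add_one_self) auto
    also have "\<dots> = exp (2 ^ card C * x ^ (card C + 1))" by (simp flip: exp_of_nat_mult)
    also have "2 ^ card C * x ^ (card C + 1) \<le> 2 ^ card C * (1 / 2) ^ (card C + 1)"
      using x by (intro mult_left_mono power_mono) auto
    also have "\<dots> = 1 / 2" by (simp add: power_one_over)
    also have "exp (1 / 2 :: real) \<le> exp 1" by simp
    also have "\<dots> \<le> 3" by (rule exp_le)
    finally show "(\<Sum>CC\<in>Pow (Pow C). (x ^ (card C + 1)) ^ card CC) \<le> 3" by simp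
  qed (use x in auto)
  also have "\<dots> = x ^ 3 * (3 * (1 + x ^ 2) ^ n)"
    by (simp add: sum_power_card_Pow mult.commute flip: sum_distrib_left)
  also have "(1 + x ^ 2) ^ n \<le> exp (x ^ 2) ^ n"
    using x by (intro power_mono exp_ge_add_one_self) auto
  also have "exp (x ^ 2) ^ n = exp x"
    using n by (simp add: x_def power2_eq_square flip: exp_of_nat_mult)
  also have "exp x \<le> exp 1" using x by simp
  also have "\<dots> \<le> 3" by (rule exp_le)
  also have "x ^ 3 * (3 * 3) \<le> x ^ 1 * (3 * 3)"
    using x by (intro mult_right_mono power_decreasing) auto
  also have "\<dots> = 9 / n" by (simp add: x_def)
  finally show ?thesis using x by (simp add: mult_left_mono)
qed

lemma prob_not_pseudo_random:
  assumes "n \<ge> 2"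
  shows "measure_pmf.prob (binomial_graph n p) {E. \<not> pseudo_random n p E} \<le> n * exp (- (n * p)) + exp (- real n) + 9 / n"
proof -
  let ?A = "{f. \<exists>v\<in>{1..n}. real (card (nbr (graph_of n f) v)) > 4 * n * p}"
    and ?B = "{f. \<exists>X Z. sparse_cut n p X Z (graph_of n f)}"
    and ?C = "{f. \<exists>C CC. few_one_each n p C CC (graph_of n f)}"
  have "measure_pmf.prob (binomial_graph n p) {E. \<not> pseudo_random n p E} =
      PrG {f. \<not> pseudo_random n p (graph_of n f)}"
    by (simp add: binomial_graph_def graph_of_def vimage_def)
  also have "{f. \<not> pseudo_random n p (graph_of n f)} = ?A \<union> ?B \<union> ?C"
    by (auto simp: pseudo_random_def graph_of_def not_le)
  also have "PrG \<dots> \<le> PrG ?A + PrG ?B + PrG ?C"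
    by (intro order_trans[OF measure_Un_le] add_right_mono) (auto intro: measure_Un_le)
  also have "\<dots> \<le> n * exp (- (n * p)) + exp (- real n) + 9 / n"
    by (intro add_mono prob_degree prob_sparse_cut prob_few_one_each assms)
  finally show ?thesis .
qed

end

section \<open>Sets of prescribed size attached to vertices\<close>

text \<open>Sizes are recorded as exponents of \<nu>, where n = \<nu>^b and p = \<nu>^(-a). A
  neighbourhood adds b - a to the exponent and a selection subtracts a. Both are the same modulo b,
  so the exponent after j steps, kept between 0 and b - 1, is this residue.\<close>

definition rot :: "nat \<Rightarrow> nat \<Rightarrow> nat \<Rightarrow> nat" where
  "rot a b j = (j * (b - a)) mod b"

definition nbrs :: "'v set \<Rightarrow> 'v set set \<Rightarrow> 'v set \<Rightarrow> 'v set" where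
  "nbrs V E A = {u \<in> V. \<exists>v\<in>A. {u, v} \<in> E}"

definition step :: "nat \<Rightarrow> nat \<Rightarrow> 'v set \<Rightarrow> 'v set set \<Rightarrow> nat \<Rightarrow> 'v \<Rightarrow> 'v set \<Rightarrow> 'v set" where
  "step a b V E j q A = (if rot a b j < a then nbrs V E A else {u \<in> A. {u, q} \<in> E})"

text \<open>Steps are numbered absolutely, from i on, and step j reads Q j. A run can thus begin in
  the middle of the exponent sequence, as the one for pairs does, and the kind of each step is fixed
  independently of the graph.\<close>

primrec run :: "nat \<Rightarrow> nat \<Rightarrow> 'v set \<Rightarrow> 'v set set \<Rightarrow> (nat \<Rightarrow> 'v) \<Rightarrow> 'v set \<Rightarrow> nat \<Rightarrow> nat \<Rightarrow> 'v set" where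
  "run a b V E Q A i 0 = A"
| "run a b V E Q A i (Suc m) = step a b V E (i + m) (Q (i + m)) (run a b V E Q A i m)"

lemma run_cong: "(\<And>j. i \<le> j \<Longrightarrow> j < i + m \<Longrightarrow> Q j = Q' j) \<Longrightarrow> run a b V E Q A i m = run a b V E Q' A i m"
  by (induction m) auto

section \<open>Arithmetic of the exponents\<close>

lemma rot_0 [simp]: "rot a b 0 = 0"
  by (simp add: rot_def)

lemma rot_less: "0 < b \<Longrightarrow> rot a b j < b"
  by (simp add: rot_def)

lemma rot_Suc:
  assumes "0 < a" "a < b"
  shows "rot a b (Suc j) = (if rot a b j < a then rot a b j + (b - a) else rot a b j - a)"
proof -
  have "rot a b (Suc j) = (rot a b j + (b - a)) mod b"
    by (simp add: rot_def mod_simps add.commute)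
  moreover have "(rot a b j + (b - a)) mod b = rot a b j - a" if "\<not> rot a b j < a"
  proof -
    have "rot a b j + (b - a) = (rot a b j - a) + b" using that assms by simp
    then have "(rot a b j + (b - a)) mod b = (rot a b j - a) mod b" by (simp only: mod_add_self2)
    also have "\<dots> = rot a b j - a"
      by (rule mod_less) (use rot_less[of b a j] assms in linarith)
    finally show ?thesis .
  qed
  moreover have "(rot a b j + (b - a)) mod b = rot a b j + (b - a)" if "rot a b j < a"
    by (rule mod_less) (use that assms in linarith)
  ultimately show ?thesis by simp
qed

lemma rot_last:
  assumes "0 < a" "a < b" shows "rot a b (b - 1) = a"
proof -
  obtain d where b: "b = a + Suc d" using assms less_imp_Suc_add by auto
  have "b - 1 = a + d" "b - a = Suc d" using b by simp_all
  then have "rot a b (b - 1) = ((a + d) * Suc d) mod b" by (simp only: rot_def)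
  also have "(a + d) * Suc d = a + b * d" unfolding b by (simp add: algebra_simps)
  also have "(a + b * d) mod b = a" using assms by simp
  finally show ?thesis .
qed

text \<open>At exponent a a selection would leave only boundedly many elements, so this value must
  not occur before the end. If it occurs at step j, the next exponent is 0; then b divides (j + 1) *
  (b - a) and, by coprimality, j + 1.\<close>

lemma rot_neq:
  assumes "0 < a" "a < b" "coprime a b" "j < b - 1" shows "rot a b j \<noteq> a"
proof
  assume "rot a b j = a"
  then have "rot a b (Suc j) = 0" using rot_Suc[of a b j] assms by simp
  then have "b dvd Suc j * (b - a)" by (simp add: rot_def mod_eq_0_iff_dvd)
  moreover have "coprime b (b - a)"
  proof -
    obtain c where "b = a + c" using assms by (metis less_imp_add_positive)
    then show ?thesis using assms(3) by (simp add: coprime_iff_gcd_eq_1 gcd.commute[of c])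
  qed
  ultimately have "b dvd Suc j" using coprime_dvd_mult_left_iff by blast
  then show False using assms(4) by (auto dest!: dvd_imp_le)
qed

section \<open>Families of sets with private parts, and the neighbourhood step\<close>

definition priv :: "'i set \<Rightarrow> ('i \<Rightarrow> 'v set) \<Rightarrow> 'i \<Rightarrow> 'v set" where
  "priv X A x = A x - \<Union>(A ` (X - {x}))"

lemma priv_subset: "priv X A x \<subseteq> A x"
  by (auto simp: priv_def)

lemma priv_disjoint: "x \<in> X \<Longrightarrow> y \<in> X \<Longrightarrow> x \<noteq> y \<Longrightarrow> priv X A x \<inter> A y = {}"
  by (auto simp: priv_def)

lemma exp_le_one_minus:
  fixes q :: real assumes "0 \<le> q" "q \<le> 1 / 3" shows "exp (- 2 * q) \<le> 1 - q"
proof -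
  have "1 + 2 * q \<le> exp (2 * q)" by (rule exp_ge_add_one_self)
  then have "(1 - q) * (1 + 2 * q) \<le> (1 - q) * exp (2 * q)" using assms by (intro mult_left_mono) auto
  moreover have "q * q \<le> q * (1 / 3)" using assms by (intro mult_left_mono) auto
  moreover have "(1 - q) * (1 + 2 * q) = 1 + q - 2 * (q * q)" by (simp add: algebra_simps)
  ultimately have "1 \<le> (1 - q) * exp (2 * q)" using assms by linarith
  then show ?thesis by (simp add: exp_minus field_simps)
qed

text \<open>Restricting to n = \<nu>^b makes n^(-a/b) equal to \<nu>^(-a), so that all relevant
  sizes are integral powers of \<nu> up to constants. Infinitely many such n suffice for the limsup
  norm.\<close>

locale pseudo_random_graph =
  fixes a b \<nu> :: nat and E :: "nat set set"
  assumes ab: "0 < a" "a < b" "coprime a b"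
    and nu: "3 \<le> \<nu>"
    and pr: "pseudo_random (\<nu> ^ b) (1 / real \<nu> ^ a) E"
begin

abbreviation "n \<equiv> \<nu> ^ b"
abbreviation "p \<equiv> 1 / real \<nu> ^ a"
abbreviation "V \<equiv> {1..n}"

text \<open>Members may overlap, so each is required to keep a private part of full order; this lets
  a later neighbour hit one member and miss the others. K absorbs all constants.\<close>

definition spread :: "real \<Rightarrow> nat \<Rightarrow> 'i set \<Rightarrow> ('i \<Rightarrow> nat set) \<Rightarrow> bool" where
  "spread K t X A \<longleftrightarrow> (\<forall>x\<in>X. A x \<subseteq> V \<and> real (card (A x)) \<le> K * real \<nu> ^ t \<and>
    real \<nu> ^ t / K \<le> real (card (priv X A x)))"

text \<open>Collects what the counting arguments demand of \<nu>: powers of K come from up to s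
  private parts that are too small by a factor K, exp (2 s K) from (1 - p) ^ card C when p * card C
  <= s K, and ln n from \<open>few_one_each\<close>.\<close>

definition large :: "nat \<Rightarrow> real \<Rightarrow> bool" where
  "large s K \<longleftrightarrow> 1 \<le> s \<and> 1 \<le> K \<and> 10000 * real s ^ 2 * K ^ (s + 2) * exp (2 * s * K) * ln n \<le> \<nu>"

lemma n_ge: "\<nu> \<le> n"
  using ab nu self_le_power[of \<nu> b] by auto

lemma ln_n: "1 \<le> ln n"
proof -
  have "exp 1 \<le> (3::real)" by (rule exp_le)
  also have "\<dots> \<le> n" using n_ge nu by linarith
  finally show ?thesis using n_ge nu by (subst ln_ge_iff) auto
qed

lemma np: "n * p = real \<nu> ^ (b - a)"
  using ab nu by (simp add: power_diff)

lemma p_bounds: "0 < p" "p \<le> 1 / 3"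
proof -
  have "3 \<le> \<nu>" "\<nu> \<le> \<nu> ^ a" using nu ab self_le_power[of \<nu> a] by auto
  then have "3 \<le> real (\<nu> ^ a)" by linarith
  then show "0 < p" "p \<le> 1 / 3" using nu by (auto simp: field_simps)
qed

lemma degree: "v \<in> V \<Longrightarrow> card (nbr E v) \<le> 4 * real \<nu> ^ (b - a)"
proof -
  assume "v \<in> V"
  then have "card (nbr E v) \<le> 4 * n * p" using pr unfolding pseudo_random_def by blast
  also have "\<dots> = 4 * (n * p)" by simp
  finally show ?thesis unfolding np .
qed

lemma edges: "E \<subseteq> pairs n"
  using pr nu by (auto simp: pseudo_random_def)

lemma nbr_subset: "nbr E v \<subseteq> V"
  using edges by (auto simp: nbr_def doubleton_in_pairs)

lemma finite_nbr [simp]: "finite (nbr E v)"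
  using nbr_subset by (rule finite_subset) simp

lemma nbr_sym: "u \<in> nbr E v \<longleftrightarrow> v \<in> nbr E u"
  by (simp add: nbr_def insert_commute)

lemma nbrs_eq: "nbrs V E A = (\<Union>v\<in>A. nbr E v)"
  using nbr_subset by (auto simp: nbrs_def nbr_def simp del: atLeastAtMost_iff)

lemma one_minus_p_power:
  assumes "p * k \<le> G" shows "exp (- 2 * G) \<le> (1 - p) ^ k"
proof -
  have "exp (- 2 * p) \<le> 1 - p" using p_bounds by (intro exp_le_one_minus) auto
  then have "exp (- 2 * p) ^ k \<le> (1 - p) ^ k" by (intro power_mono) auto
  moreover have "exp (- 2 * p) ^ k = exp (- 2 * (p * k))"
    by (simp flip: exp_of_nat_mult add: mult_ac)
  moreover have "exp (- 2 * G) \<le> exp (- 2 * (p * k))" using assms by simp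
  ultimately show ?thesis by linarith
qed

lemma many_one_each:
  assumes "C \<subseteq> V" "CC \<subseteq> Pow C" "disjoint CC" "2 * card C \<le> n"
    "100 * (card CC + 2) * (card C + 1) * ln n \<le> n * one_each_weight p C CC"
  shows "n * one_each_weight p C CC / 8 \<le> card {u \<in> V - C. one_each E C CC u}"
  using pr assms by (auto simp: pseudo_random_def few_one_each_def not_less)

lemma many_edges:
  assumes "X \<subseteq> V" "Z \<subseteq> V" "X \<inter> Z = {}" "100 * n \<le> card X * card Z * p"
  shows "card X * card Z * p / 4 \<le> (\<Sum>z\<in>Z. card (nbr E z \<inter> X))"
  using pr assms by (auto simp: pseudo_random_def sparse_cut_def not_less)


lemma spread_finite: "spread K t X A \<Longrightarrow> x \<in> X \<Longrightarrow> finite (A x)"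
  by (auto simp: spread_def intro: finite_subset)

lemma spread_priv_pos:
  fixes K :: real
  assumes "spread K t X A" "1 \<le> K" "x \<in> X"
  shows "0 < card (priv X A x)" "priv X A x \<noteq> {}"
proof -
  have "0 < real \<nu> ^ t / K" using assms nu by auto
  also have "\<dots> \<le> card (priv X A x)" using assms by (auto simp: spread_def)
  finally show "0 < card (priv X A x)" by simp
  then show "priv X A x \<noteq> {}" by auto
qed

lemma spread_card_Union:
  fixes K :: real
  assumes "spread K t X A" "finite X" "card X \<le> s" "1 \<le> K"
  shows "card (\<Union>(A ` X)) \<le> s * K * real \<nu> ^ t"
proof -
  have "real (card (\<Union>(A ` X))) \<le> real (\<Sum>x\<in>X. card (A x))"
    using card_UN_le[OF assms(2), of A] by (simp flip: of_nat_sum)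
  also have "\<dots> = (\<Sum>x\<in>X. real (card (A x)))" by simp
  also have "\<dots> \<le> (\<Sum>x\<in>X. K * real \<nu> ^ t)"
    using assms(1) by (intro sum_mono) (auto simp: spread_def)
  also have "\<dots> = card X * (K * real \<nu> ^ t)" by simp
  also have "\<dots> \<le> s * (K * real \<nu> ^ t)"
    using assms by (intro mult_right_mono) auto
  finally show ?thesis by (simp add: mult.assoc)
qed

text \<open>Each private part indexed by I contributes at least p * \<nu>^t / K to the weight, and G
  controls the probability that the absent edges to the union are indeed absent.\<close>

lemma spread_weight:
  fixes K :: real
  assumes "spread K t X A" "finite X" "I \<subseteq> X" "1 \<le> K" "p * card (\<Union>(A ` X)) \<le> G"
  shows "(p * real \<nu> ^ t / K) ^ card I * exp (- 2 * G) \<le> one_each_weight p (\<Union>(A ` X)) (priv X A ` I)"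
    "card (priv X A ` I) = card I"
proof -
  have inj: "inj_on (priv X A) I"
  proof (rule inj_onI)
    fix x y assume xy: "x \<in> I" "y \<in> I" "priv X A x = priv X A y"
    then show "x = y"
      using spread_priv_pos(2)[OF assms(1,4), of x] assms(3) priv_disjoint[of x X y A] priv_subset[of X A y]
      by blast
  qed
  then show card: "card (priv X A ` I) = card I" by (rule card_image)
  have "(real \<nu> ^ t / K) ^ card I = (\<Prod>x\<in>I. real \<nu> ^ t / K)" by simp
  also have "\<dots> \<le> (\<Prod>x\<in>I. real (card (priv X A x)))"
    using assms by (intro prod_mono) (auto simp: spread_def)
  also have "\<dots> = (\<Prod>B\<in>priv X A ` I. real (card B))"
    using inj by (simp add: prod.reindex)
  finally have 1: "(real \<nu> ^ t / K) ^ card I \<le> (\<Prod>B\<in>priv X A ` I. real (card B))" .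
  have 2: "exp (- 2 * G) \<le> (1 - p) ^ card (\<Union>(A ` X))"
    using assms(5) by (rule one_minus_p_power)
  have "0 \<le> p" using p_bounds by simp
  have "(p * real \<nu> ^ t / K) ^ card I = (p * (real \<nu> ^ t / K)) ^ card I" by simp
  also have "\<dots> = p ^ card I * (real \<nu> ^ t / K) ^ card I" by (rule power_mult_distrib)
  finally have "(p * real \<nu> ^ t / K) ^ card I * exp (- 2 * G) = (p ^ card I * (real \<nu> ^ t / K) ^ card I) * exp (- 2 * G)"
    by (rule arg_cong)
  also have "\<dots> \<le> (p ^ card I * (\<Prod>B\<in>priv X A ` I. real (card B))) * (1 - p) ^ card (\<Union>(A ` X))"
    using mult_left_mono[OF 1 zero_le_power[OF \<open>0 \<le> p\<close>]] 2
    by (rule mult_mono) (auto intro!: mult_nonneg_nonneg prod_nonneg zero_le_power \<open>0 \<le> p\<close>)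
  finally show "(p * real \<nu> ^ t / K) ^ card I * exp (- 2 * G) \<le> one_each_weight p (\<Union>(A ` X)) (priv X A ` I)"
    by (simp only: one_each_weight_def card)
qed

text \<open>A neighbour of u in the union lies in the private part of some y in I, hence in A y and
  no other member; conversely the private part of every x in I contains a neighbour.\<close>

lemma one_each_hits:
  assumes "one_each E (\<Union>(A ` X)) (priv X A ` I) u" "I \<subseteq> X" "x \<in> X"
  shows "(\<exists>v\<in>A x. {v, u} \<in> E) \<longleftrightarrow> x \<in> I"
proof
  assume "\<exists>v\<in>A x. {v, u} \<in> E"
  then obtain v where v: "v \<in> A x" "v \<in> nbr E u" by (auto simp: nbr_def)
  then obtain y where y: "y \<in> I" "v \<in> priv X A y"
    using assms(1,3) by (auto simp: one_each_def)
  then show "x \<in> I" using v assms(2,3) priv_disjoint[of y X x A] by (cases "x = y") auto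
next
  assume "x \<in> I"
  then have "card (nbr E u \<inter> priv X A x) = 1" using assms(1) by (auto simp: one_each_def)
  then obtain v where "v \<in> nbr E u \<inter> priv X A x" by (metis card.empty equals0I zero_neq_one)
  then show "\<exists>v\<in>A x. {v, u} \<in> E" using priv_subset[of X A x] by (auto simp: nbr_def)
qed

lemma largeD:
  fixes K :: real
  assumes "large s K"
  shows "1 \<le> real s" "1 \<le> K" "10000 * real s * K ^ 2 * ln n \<le> \<nu>" "10000 * real s * K \<le> \<nu>"
    "10000 * real s ^ 2 * K * ln n \<le> \<nu> * (1 / K ^ s * exp (- 2 * (real s * K)))"
proof -
  have s: "1 \<le> real s" "1 \<le> s" and g: "1 \<le> K" using assms by (auto simp: large_def)
  then show "1 \<le> real s" "1 \<le> K" by auto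
  have l: "10000 * real s ^ 2 * K ^ (s + 2) * exp (2 * real s * K) * ln n \<le> \<nu>"
    using assms by (simp add: large_def)
  have "real s ^ 1 \<le> real s ^ 2" using s by (intro power_increasing) auto
  moreover have "K ^ 2 \<le> K ^ (s + 2)" using g by (intro power_increasing) auto
  moreover have "1 \<le> exp (2 * real s * K)" using s g by simp
  ultimately have "10000 * real s ^ 1 * K ^ 2 * 1 * ln n \<le> 10000 * real s ^ 2 * K ^ (s + 2) * exp (2 * real s * K) * ln n"
    using s g ln_n by (intro mult_mono) auto
  then show l2: "10000 * real s * K ^ 2 * ln n \<le> \<nu>" using l by simp
  have "K ^ 1 \<le> K ^ 2" using g by (intro power_increasing) auto
  then have "10000 * real s * K ^ 1 * 1 \<le> 10000 * real s * K ^ 2 * ln n"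
    using s g ln_n by (intro mult_mono) auto
  then show "10000 * real s * K \<le> \<nu>" using l2 by simp
  have "10000 * real s ^ 2 * K * ln n * (K ^ s * exp (2 * real s * K)) * 1 \<le> 10000 * real s ^ 2 * K * ln n * (K ^ s * exp (2 * real s * K)) * K"
    using s g ln_n by (intro mult_left_mono) auto
  also have "\<dots> = 10000 * real s ^ 2 * K ^ (s + 2) * exp (2 * real s * K) * ln n"
    by (simp add: power_add power2_eq_square mult_ac)
  also have "\<dots> \<le> \<nu>" by (rule l)
  finally show "10000 * real s ^ 2 * K * ln n \<le> \<nu> * (1 / K ^ s * exp (- 2 * (real s * K)))"
    using g by (simp add: exp_minus field_simps)
qed

lemma power_nu_mono: "i \<le> j \<Longrightarrow> real \<nu> ^ i \<le> real \<nu> ^ j"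
  using nu by (intro power_increasing) auto

text \<open>The upper bound comes from the degrees. For the lower bound, a vertex outside the union
  whose only neighbour in the union lies in the private part of A x is private for the neighbourhood
  of A x. Since t < a, p times the size of the union is at most 1, so avoiding the other elements
  costs only a constant factor.\<close>

lemma spread_nbrs:
  fixes K :: real
  assumes sp: "spread K t X A" and X: "finite X" "card X \<le> s" and t: "t < a" and l: "large s K"
  shows "spread (100 * real s * K) (t + (b - a)) X (\<lambda>x. nbrs V E (A x))"
  unfolding spread_def
proof (intro ballI conjI)
  fix x assume x: "x \<in> X"
  note L = largeD[OF l]
  let ?N = "real \<nu>" and ?C = "\<Union>(A ` X)" and ?CC = "priv X A ` {x}"
  show "nbrs V E (A x) \<subseteq> V" by (auto simp: nbrs_def)
  have "real (card (nbrs V E (A x))) \<le> real (\<Sum>v\<in>A x. card (nbr E v))"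
    unfolding nbrs_eq using card_UN_le[OF spread_finite[OF sp x], of "nbr E"] by (simp flip: of_nat_sum)
  also have "\<dots> = (\<Sum>v\<in>A x. real (card (nbr E v)))" by simp
  also have "\<dots> \<le> (\<Sum>v\<in>A x. 4 * ?N ^ (b - a))"
    using sp x by (intro sum_mono degree) (auto simp: spread_def simp del: atLeastAtMost_iff)
  also have "\<dots> = card (A x) * (4 * ?N ^ (b - a))" by simp
  also have "\<dots> \<le> (K * ?N ^ t) * (4 * ?N ^ (b - a))"
    using sp x by (intro mult_right_mono) (auto simp: spread_def)
  also have "\<dots> = (4 * K) * ?N ^ (t + (b - a))" by (simp add: power_add)
  also have "\<dots> \<le> (100 * real s * K) * ?N ^ (t + (b - a))"
    using L by (intro mult_right_mono) (auto intro!: mult_right_mono)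
  finally show "real (card (nbrs V E (A x))) \<le> 100 * real s * K * ?N ^ (t + (b - a))" .
  have cU: "card ?C \<le> real s * K * ?N ^ t" using spread_card_Union[OF sp X] L by simp
  have "?N ^ t * ?N \<le> ?N ^ a" using power_nu_mono[of "Suc t" a] t by (simp add: mult.commute)
  then have pt: "p * (?N ^ t * ?N) \<le> 1" using nu by (simp add: field_simps)
  have G: "p * card ?C \<le> 1"
  proof -
    have "p * card ?C \<le> p * (real s * K * ?N ^ t)" using cU p_bounds by (intro mult_left_mono) auto
    also have "\<dots> \<le> p * (?N * ?N ^ t)"
      using p_bounds L by (intro mult_left_mono mult_right_mono) auto
    finally show ?thesis using pt by (simp add: mult.commute)
  qed
  have e2: "1 / 9 \<le> exp (- 2 * 1 :: real)"
  proof -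
    have "exp (1::real) * exp 1 \<le> 3 * 3" by (intro mult_mono exp_le) auto
    then have "exp (2::real) \<le> 9" by (simp flip: exp_add)
    then show ?thesis by (simp add: exp_minus field_simps)
  qed
  have w: "(p * ?N ^ t / K) * (1 / 9) \<le> one_each_weight p ?C ?CC"
  proof -
    have "(p * ?N ^ t / K) * (1 / 9) \<le> (p * ?N ^ t / K) * exp (- 2 * 1)"
      using L p_bounds by (intro mult_left_mono e2) auto
    also have "\<dots> \<le> one_each_weight p ?C ?CC"
      using spread_weight(1)[OF sp X(1), of "{x}" 1] x L(2) G by simp
    finally show ?thesis .
  qed
  have nw: "?N ^ (t + (b - a)) / (9 * K) \<le> n * one_each_weight p ?C ?CC"
  proof -
    have "?N ^ (t + (b - a)) / (9 * K) = (n * p) * ?N ^ t / (9 * K)"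
      unfolding np by (simp add: power_add)
    also have "\<dots> = n * ((p * ?N ^ t / K) * (1 / 9))" by simp
    also have "\<dots> \<le> n * one_each_weight p ?C ?CC" by (intro mult_left_mono w) auto
    finally show ?thesis .
  qed
  have "n * one_each_weight p ?C ?CC / 8 \<le> card {u \<in> V - ?C. one_each E ?C ?CC u}"
  proof (rule many_one_each)
    show "?C \<subseteq> V" using sp by (auto simp: spread_def)
    show "?CC \<subseteq> Pow ?C" using x priv_subset[of X A x] by auto
    show "disjoint ?CC" by (auto simp: disjoint_def)
    have "2 * real (card ?C) \<le> ?N * ?N ^ t"
      using cU L mult_right_mono[of "2 * (real s * K)" ?N "?N ^ t"] by (simp add: mult.assoc)
    also have "\<dots> \<le> real n"
      using power_nu_mono[of "Suc t" b] t ab by simp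
    finally show "2 * card ?C \<le> n" by (simp flip: of_nat_mult of_nat_power)
    have one: "1 \<le> real s * K * ?N ^ t"
    proof -
      have "1 * 1 * 1 \<le> real s * K * ?N ^ t" using L nu by (intro mult_mono) auto
      then show ?thesis by simp
    qed
    have "100 * (1 + 2) * (real (card ?C) + 1) * ln n \<le> 100 * (1 + 2) * (2 * (real s * K * ?N ^ t)) * ln n"
      using cU one ln_n by (intro mult_right_mono mult_left_mono) auto
    also have "\<dots> = (5400 * real s * K ^ 2 * ln n) * ?N ^ t / (9 * K)"
      using L by (simp add: power2_eq_square)
    also have "\<dots> \<le> ?N * ?N ^ t / (9 * K)"
    proof (intro divide_right_mono mult_right_mono)
      have "5400 * real s * K ^ 2 * ln n \<le> 10000 * real s * K ^ 2 * ln n"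
        using L ln_n by (intro mult_right_mono) auto
      then show "5400 * real s * K ^ 2 * ln n \<le> ?N" using L by linarith
    qed (use L in auto)
    also have "\<dots> \<le> ?N ^ (t + (b - a)) / (9 * K)"
      using power_nu_mono[of "Suc t" "t + (b - a)"] ab L by (intro divide_right_mono) auto
    also note nw
    finally show "100 * (card ?CC + 2) * (card ?C + 1) * ln n \<le> n * one_each_weight p ?C ?CC"
      by (simp add: algebra_simps)
  qed
  moreover have "card {u \<in> V - ?C. one_each E ?C ?CC u} \<le> card (priv X (\<lambda>x. nbrs V E (A x)) x)"
  proof (rule card_mono)
    show "finite (priv X (\<lambda>x. nbrs V E (A x)) x)"
      by (rule finite_subset[OF priv_subset]) (auto simp: nbrs_def)
    show "{u \<in> V - ?C. one_each E ?C ?CC u} \<subseteq> priv X (\<lambda>x. nbrs V E (A x)) x"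
    proof safe
      fix u assume u: "u \<in> V" "one_each E ?C ?CC u"
      have "(\<exists>v\<in>A y. {v, u} \<in> E) \<longleftrightarrow> y \<in> {x}" if "y \<in> X" for y
        by (rule one_each_hits[OF u(2)]) (use x that in auto)
      then show "u \<in> priv X (\<lambda>x. nbrs V E (A x)) x"
        using u(1) x by (auto simp: priv_def nbrs_def insert_commute)
    qed
  qed
  ultimately have "n * one_each_weight p ?C ?CC / 8 \<le> card (priv X (\<lambda>x. nbrs V E (A x)) x)" by linarith
  \<comment> \<open>72 = 9 * 8, from the bound 1/9 for exp (- 2) and the 8 of
    \<open>many_one_each\<close>, is covered by the 100 in the new constant.\<close>
  moreover have "?N ^ (t + (b - a)) / (100 * real s * K) \<le> ?N ^ (t + (b - a)) / (9 * K) / 8"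
    using L mult_right_mono[of "72" "100 * real s" K] by (simp add: divide_left_mono)
  ultimately show "?N ^ (t + (b - a)) / (100 * real s * K) \<le> card (priv X (\<lambda>x. nbrs V E (A x)) x)"
    using divide_right_mono[OF nw, of 8] by (meson order_trans zero_le_numeral)
qed

end

section \<open>Coding subsets and symmetric relations by vertices\<close>

text \<open>By \<open>rot_last\<close>, b - 1 steps from one vertex end at exponent a. Intersecting
  with V keeps the set inside V even for assignments with values elsewhere.\<close>

definition vset :: "nat \<Rightarrow> nat \<Rightarrow> 'v set \<Rightarrow> 'v set set \<Rightarrow> (nat \<Rightarrow> 'v) \<Rightarrow> 'v \<Rightarrow> 'v set" where
  "vset a b V E e x = run a b V E e ({x} \<inter> V) 0 (b - 1)"

text \<open>The vertices adjacent to both vertex sets have exponent b; the selection by e b gives b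
  - a, the value of \<open>rot\<close> at 1, and b - 2 further steps end at a. The sets for single
  vertices read e below b - 1, the later steps read it from b to 2 * b - 2, and index 2 * b is left
  for the coding vertex.\<close>

definition pset :: "nat \<Rightarrow> nat \<Rightarrow> 'v set \<Rightarrow> 'v set set \<Rightarrow> (nat \<Rightarrow> 'v) \<Rightarrow> 'v \<Rightarrow> 'v \<Rightarrow> 'v set" where
  "pset a b V E e x y = run a b V E (\<lambda>i. e (b + i))
     {u \<in> {u \<in> V. u \<in> nbrs V E (vset a b V E e x) \<and> u \<in> nbrs V E (vset a b V E e y)}. {u, e b} \<in> E} 1 (b - 2)"

definition coded1 :: "nat \<Rightarrow> nat \<Rightarrow> 'v set \<Rightarrow> 'v set set \<Rightarrow> (nat \<Rightarrow> 'v) \<Rightarrow> 'v \<Rightarrow> bool" where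
  "coded1 a b V E e x \<longleftrightarrow> (\<exists>u\<in>V. u \<in> vset a b V E e x \<and> {u, e (2 * b)} \<in> E)"

definition coded2 :: "nat \<Rightarrow> nat \<Rightarrow> 'v set \<Rightarrow> 'v set set \<Rightarrow> (nat \<Rightarrow> 'v) \<Rightarrow> 'v \<Rightarrow> 'v \<Rightarrow> bool" where
  "coded2 a b V E e x y \<longleftrightarrow> (\<exists>u\<in>V. u \<in> pset a b V E e x y \<and> {u, e (2 * b)} \<in> E)"

text \<open>A coding vertex controls membership only for the elements of a given small set, not for
  other vertices. A definable ambient set is therefore needed first; it is cut out of the set
  attached to the single vertex e b.\<close>

definition coded_dom :: "nat \<Rightarrow> nat \<Rightarrow> 'v set \<Rightarrow> 'v set set \<Rightarrow> (nat \<Rightarrow> 'v) \<Rightarrow> 'v set" where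
  "coded_dom a b V E e = {u \<in> V. u \<in> vset a b V E e (e b) \<and> {u, e (2 * b)} \<in> E}"

lemma vset_cong: "(\<And>j. j < b - 1 \<Longrightarrow> e j = e' j) \<Longrightarrow> vset a b V E e x = vset a b V E e' x"
  unfolding vset_def by (rule run_cong) simp

text \<open>Number the elements and class them by their numbers modulo m.\<close>

lemma balanced_partition:
  assumes "finite L" "0 < m"
  obtains c :: "'v \<Rightarrow> nat" where "c ` L \<subseteq> {..<m}" "\<And>i. i < m \<Longrightarrow> card L div m \<le> card {u\<in>L. c u = i}"
proof -
  obtain g where g: "bij_betw g L {0..<card L}" using ex_bij_betw_finite_nat[OF assms(1)] by auto
  let ?c = "\<lambda>u. g u mod m"
  have "card L div m \<le> card {u\<in>L. ?c u = i}" if i: "i < m" for i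
  proof -
    let ?h = "\<lambda>t. the_inv_into L g (i + m * t)"
    have mem: "i + m * t \<in> g ` L" if "t < card L div m" for t
    proof -
      have "Suc t \<le> card L div m" using that by simp
      then have "m * Suc t \<le> m * (card L div m)" by (rule mult_le_mono2)
      also have "\<dots> \<le> card L" by simp
      finally have "i + m * t < card L" using i by simp
      then show ?thesis using g by (auto simp: bij_betw_def)
    qed
    have inj: "inj_on g L" using g by (auto simp: bij_betw_def)
    have gh: "g (?h t) = i + m * t" "?h t \<in> L" if "t < card L div m" for t
      using f_the_inv_into_f[OF inj mem[OF that]] the_inv_into_into[OF inj mem[OF that] order_refl] by auto
    have "inj_on ?h {..<card L div m}"
    proof (rule inj_onI)
      fix t t' assume "t \<in> {..<card L div m}" "t' \<in> {..<card L div m}" "?h t = ?h t'"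
      then have "i + m * t = i + m * t'" using gh by (metis lessThan_iff)
      then show "t = t'" using assms(2) by simp
    qed
    moreover have "?h ` {..<card L div m} \<subseteq> {u\<in>L. ?c u = i}"
      using gh i by auto
    ultimately have "card {..<card L div m} \<le> card {u\<in>L. ?c u = i}"
      using assms(1) by (metis (no_types, lifting) card_inj_on_le finite_subset mem_Collect_eq subsetI)
    then show ?thesis by simp
  qed
  then show ?thesis using assms(2) by (intro that[of ?c]) auto
qed

section \<open>Selection steps, whole runs and the existence of codes\<close>

context pseudo_random_graph
begin

lemma large_mono:
  fixes K K' :: real
  assumes "large s' K'" "1 \<le> s" "s \<le> s'" "1 \<le> K" "K \<le> K'"
  shows "large s K"
proof -
  have "K ^ (s + 2) \<le> K' ^ (s + 2)" using assms by (intro power_mono) auto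
  also have "\<dots> \<le> K' ^ (s' + 2)" using assms by (intro power_increasing) auto
  finally have 1: "K ^ (s + 2) \<le> K' ^ (s' + 2)" .
  have "real s * K \<le> real s' * K'" using assms by (intro mult_mono) auto
  then have 2: "exp (2 * real s * K) \<le> exp (2 * real s' * K')" by simp
  have "real s ^ 2 \<le> real s' ^ 2" using assms by (intro power_mono) auto
  then have "10000 * real s ^ 2 * K ^ (s + 2) * exp (2 * real s * K) * ln n \<le>
      10000 * real s' ^ 2 * K' ^ (s' + 2) * exp (2 * real s' * K') * ln n"
    using 1 2 ln_n assms by (intro mult_mono) auto
  then show ?thesis using assms by (auto simp: large_def)
qed

lemma spread_mono:
  fixes K K' :: real
  assumes "spread K t X A" "1 \<le> K" "K \<le> K'"
  shows "spread K' t X A"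
proof -
  have 1: "K * real \<nu> ^ t \<le> K' * real \<nu> ^ t" using assms by (intro mult_right_mono) auto
  have 2: "real \<nu> ^ t / K' \<le> real \<nu> ^ t / K" using assms by (intro divide_left_mono) auto
  show ?thesis unfolding spread_def
  proof (intro ballI conjI)
    fix x assume "x \<in> X"
    then have "A x \<subseteq> V" "card (A x) \<le> K * real \<nu> ^ t" "real \<nu> ^ t / K \<le> card (priv X A x)"
      using assms(1) by (auto simp: spread_def)
    then show "A x \<subseteq> V" "card (A x) \<le> K' * real \<nu> ^ t" "real \<nu> ^ t / K' \<le> card (priv X A x)"
      using 1 2 by linarith+
  qed
qed

lemma spread_subset: "spread K t X A \<Longrightarrow> x \<in> X \<Longrightarrow> A x \<subseteq> V"
  unfolding spread_def by blast

text \<open>\<open>many_edges\<close> requires disjoint sets, whereas a bad q may lie in P itself.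
  So P is cut into two halves and each q is tested against a half that does not contain it.\<close>

lemma few_low:
  assumes P: "P \<subseteq> V" "4 \<le> card P"
  shows "card {q\<in>V. card (nbr E q \<inter> P) < card P * p / 16} * (card P * p) \<le> 800 * real n"
proof -
  let ?Z = "{q\<in>V. card (nbr E q \<inter> P) < card P * p / 16}"
  have finP: "finite P" using P by (auto intro: finite_subset)
  \<comment> \<open>A half has at least card P / 4 elements and \<open>many_edges\<close> loses
    another factor 4; this is the origin of 16 and of 400 = 4 * 100.\<close>
  have half: "card Z' * (card P * p) \<le> 400 * real n"
    if "P' \<subseteq> P" "card P / 4 \<le> card P'" "Z' \<subseteq> ?Z" "P' \<inter> Z' = {}" for P' Z'
  proof (rule ccontr)
    assume neg: "\<not> ?thesis"
    then have "card Z' \<noteq> 0" by (intro notI) simp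
    then have Z': "finite Z'" "Z' \<noteq> {}" by (auto dest: card_ge_0_finite intro: ccontr)
    have le: "card Z' * (card P * p) / 4 \<le> card P' * card Z' * p"
    proof -
      have "(card P / 4) * (card Z' * p) \<le> card P' * (card Z' * p)"
        using p_bounds that(2) by (intro mult_right_mono) auto
      then show ?thesis by (simp add: mult_ac)
    qed
    have "card P' * card Z' * p / 4 \<le> (\<Sum>z\<in>Z'. card (nbr E z \<inter> P'))"
    proof (rule many_edges)
      show "100 * n \<le> card P' * card Z' * p" using neg le by (simp add: algebra_simps)
    qed (use that P in auto)
    also have "\<dots> = (\<Sum>z\<in>Z'. real (card (nbr E z \<inter> P')))" by simp
    also have "\<dots> < (\<Sum>z\<in>Z'. card P * p / 16)"
    proof (rule sum_strict_mono[OF Z'])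
      fix z assume "z \<in> Z'"
      then have "card (nbr E z \<inter> P) < card P * p / 16" using that(3) by auto
      moreover have "card (nbr E z \<inter> P') \<le> card (nbr E z \<inter> P)"
        using that(1) finP by (intro card_mono) auto
      ultimately show "card (nbr E z \<inter> P') < card P * p / 16" by linarith
    qed
    also have "\<dots> = card Z' * (card P * p) / 4 / 4" by simp
    finally show False using divide_right_mono[OF le, of 4] by (simp add: not_less[symmetric])
  qed
  obtain P1 where P1: "P1 \<subseteq> P" "card P1 = card P div 2"
    by (meson div_le_dividend obtain_subset_with_card_n)
  have finZ: "finite ?Z" by simp
  have "card (P - P1) = card P - card P div 2"
    using P1 finP by (simp add: card_Diff_subset finite_subset)
  then have c2: "card P / 4 \<le> card (P - P1)" by linarith
  have c1: "card P / 4 \<le> card P1" using P1(2) P(2) by linarith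
  have "card (?Z - P1) * (card P * p) \<le> 400 * real n"
    using P1 c1 by (intro half[of P1]) auto
  moreover have "card (?Z \<inter> P1) * (card P * p) \<le> 400 * real n"
    using P1 c2 by (intro half[of "P - P1"]) auto
  moreover have "card ?Z = card (?Z - P1) + card (?Z \<inter> P1)"
    using card_Int_Diff[OF finZ, of P1] by simp
  ultimately show ?thesis by (simp add: algebra_simps)
qed

text \<open>Markov's inequality over the vertices q, with the edges between V and A counted from the
  side of A by the degree bound.\<close>

lemma few_high:
  fixes T :: real
  assumes "A \<subseteq> V"
  shows "card {q\<in>V. T < card (nbr E q \<inter> A)} * T \<le> card A * (4 * real \<nu> ^ (b - a))"
proof -
  have fin: "finite A" using assms by (auto intro: finite_subset)
  let ?H = "{q\<in>V. T < card (nbr E q \<inter> A)}"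
  have "card ?H * T = (\<Sum>q\<in>?H. T)" by simp
  also have "\<dots> \<le> (\<Sum>q\<in>?H. real (card (nbr E q \<inter> A)))" by (intro sum_mono) auto
  also have "\<dots> \<le> (\<Sum>q\<in>V. real (card (nbr E q \<inter> A)))" by (intro sum_mono2) auto
  also have "\<dots> = (\<Sum>q\<in>V. \<Sum>v\<in>A. of_bool (v \<in> nbr E q))"
    using fin by (simp add: Int_def conj_commute)
  also have "\<dots> = (\<Sum>v\<in>A. \<Sum>q\<in>V. of_bool (v \<in> nbr E q))" by (rule sum.swap)
  also have "\<dots> = (\<Sum>v\<in>A. real (card (nbr E v)))"
  proof (intro sum.cong refl)
    fix v
    have "V \<inter> {q. v \<in> nbr E q} = nbr E v" using nbr_subset[of v] nbr_sym by blast
    then show "(\<Sum>q\<in>V. of_bool (v \<in> nbr E q)) = real (card (nbr E v))" by simp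
  qed
  also have "\<dots> \<le> (\<Sum>v\<in>A. 4 * real \<nu> ^ (b - a))"
    using assms by (intro sum_mono degree) (auto simp del: atLeastAtMost_iff)
  finally show ?thesis by simp
qed

text \<open>For each of at most s members, at most n / (8 s) vertices have too few neighbours in the
  private part and at most n / (8 s) have too many in the whole set. At most n / 4 vertices are
  excluded, so one q serves all members at once.\<close>

lemma spread_select:
  fixes K :: real
  assumes sp: "spread K t X A" and X: "finite X" "card X \<le> s" and t: "a < t" "t \<le> b" and l: "large s K"
  obtains q where "q \<in> V" "spread (100 * real s * K) (t - a) X (\<lambda>x. {u \<in> A x. {u, q} \<in> E})"
proof -
  note L = largeD[OF l]
  let ?N = "real \<nu>"
  \<comment> \<open>The factor 32 s K turns the bound of \<open>few_high\<close> into n / (8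
    s).\<close>
  let ?T = "32 * real s * K * (p * ?N ^ t)"
  let ?Lo = "\<lambda>x. {q\<in>V. card (nbr E q \<inter> priv X A x) < card (priv X A x) * p / 16}"
    and ?Hi = "\<lambda>x. {q\<in>V. ?T < card (nbr E q \<inter> A x)}"
  have N: "?N \<le> ?N ^ (t - a)" using power_nu_mono[of 1 "t - a"] t by simp
  have pt: "p * ?N ^ t = ?N ^ (t - a)" using nu t by (simp add: power_diff)
  have Nt: "?N \<le> ?N ^ t" using power_nu_mono[of 1 t] t by simp
  have n0: "0 < real n" using nu by simp
  have nb: "real n * p = ?N ^ (b - a)" by (rule np)
  have Lo: "card (?Lo x) \<le> n / (8 * real s)" if x: "x \<in> X" for x
  proof -
    let ?P = "priv X A x"
    have P: "?N ^ t / K \<le> card ?P" "?P \<subseteq> V" using sp x priv_subset[of X A x] by (auto simp: spread_def)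
    have "4 * K \<le> ?N"
    proof -
      have "4 * K \<le> (10000 * real s) * K" using L by (intro mult_right_mono) auto
      also have "\<dots> \<le> ?N" using L(4) by (simp only: mult_ac)
      finally show ?thesis .
    qed
    then have "4 * K \<le> ?N ^ t" using Nt by linarith
    then have "4 \<le> ?N ^ t / K" using L by (simp add: field_simps)
    then have "4 \<le> card ?P" using P by linarith
    from few_low[OF P(2) this] have 1: "card (?Lo x) * (card ?P * p) \<le> 800 * real n" .
    have "?N / K \<le> ?N ^ (t - a) / K" using N L by (intro divide_right_mono) auto
    also have "\<dots> = (p * ?N ^ t) / K" unfolding pt ..
    also have "\<dots> = (?N ^ t / K) * p" by simp
    also have "\<dots> \<le> card ?P * p" using P p_bounds by (intro mult_right_mono) auto
    finally have "card (?Lo x) * (?N / K) \<le> card (?Lo x) * (card ?P * p)" by (intro mult_left_mono) auto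
    then have "card (?Lo x) * (?N / K) \<le> 800 * real n" using 1 by linarith
    then have 2: "card (?Lo x) * ?N \<le> 800 * real n * K" using L by (simp add: field_simps)
    have "card (?Lo x) * (10000 * real s * K) \<le> card (?Lo x) * ?N"
      using L by (intro mult_left_mono) auto
    also note 2
    finally have "(card (?Lo x) * (10000 * real s)) * K \<le> (800 * real n) * K" by (simp add: mult_ac)
    then have "card (?Lo x) * (10000 * real s) \<le> 800 * real n"
      using L by (subst (asm) mult_le_cancel_right_pos) auto
    then have "real (card (?Lo x)) * real s * 10000 \<le> 800 * real n" by (simp only: mult_ac)
    then have "real (card (?Lo x)) * real s * 8 \<le> real n" using n0 by linarith
    then show ?thesis using L by (simp add: pos_le_divide_eq mult_ac)
  qed
  have Hi: "card (?Hi x) \<le> n / (8 * real s)" if x: "x \<in> X" for x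
  proof -
    have A: "A x \<subseteq> V" "card (A x) \<le> K * ?N ^ t" using sp x by (auto simp: spread_def simp del: atLeastAtMost_iff)
    have "card (?Hi x) * ?T \<le> card (A x) * (4 * ?N ^ (b - a))" by (rule few_high[OF A(1)])
    also have "\<dots> \<le> (K * ?N ^ t) * (4 * ?N ^ (b - a))" using A by (intro mult_right_mono) auto
    also have "\<dots> = (4 * real n) * (K * (p * ?N ^ t))" by (simp flip: nb)
    finally have "(card (?Hi x) * (32 * real s)) * (K * (p * ?N ^ t)) \<le> (4 * real n) * (K * (p * ?N ^ t))"
      by (simp add: mult_ac)
    moreover have "0 < K * (p * ?N ^ t)" using L p_bounds nu by (intro mult_pos_pos) auto
    ultimately have "card (?Hi x) * (32 * real s) \<le> 4 * real n"
      using mult_le_cancel_right_pos by blast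
    then show ?thesis using L by (simp add: field_simps)
  qed
  have "card (\<Union>x\<in>X. ?Lo x \<union> ?Hi x) < card V"
  proof -
    have "card (\<Union>x\<in>X. ?Lo x \<union> ?Hi x) \<le> (\<Sum>x\<in>X. card (?Lo x \<union> ?Hi x))"
      by (rule card_UN_le[OF X(1)])
    also have "\<dots> \<le> (\<Sum>x\<in>X. card (?Lo x) + card (?Hi x))"
      by (intro sum_mono card_Un_le)
    finally have "real (card (\<Union>x\<in>X. ?Lo x \<union> ?Hi x)) \<le> real (\<Sum>x\<in>X. card (?Lo x) + card (?Hi x))"
      by linarith
    also have "\<dots> = (\<Sum>x\<in>X. real (card (?Lo x)) + real (card (?Hi x)))" by simp
    also have "\<dots> \<le> (\<Sum>x\<in>X. n / (8 * real s) + n / (8 * real s))"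
      by (intro sum_mono add_mono Lo Hi)
    also have "\<dots> = card X * (n / (4 * real s))" by simp
    also have "\<dots> \<le> real s * (n / (4 * real s))"
      using X by (intro mult_right_mono) auto
    also have "\<dots> = real n / 4" using L by simp
    also have "\<dots> < real n" using n0 by simp
    finally show ?thesis by simp
  qed
  then have "\<not> V \<subseteq> (\<Union>x\<in>X. ?Lo x \<union> ?Hi x)"
    using card_mono[of "\<Union>x\<in>X. ?Lo x \<union> ?Hi x" V] X(1) by auto
  then obtain q where q: "q \<in> V" "\<And>x. x \<in> X \<Longrightarrow> q \<notin> ?Lo x \<and> q \<notin> ?Hi x" by blast
  have sel: "{u \<in> A x. {u, q} \<in> E} = nbr E q \<inter> A x" for x by (auto simp: nbr_def)
  have "spread (100 * real s * K) (t - a) X (\<lambda>x. {u \<in> A x. {u, q} \<in> E})"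
    unfolding spread_def
  proof (intro ballI conjI)
    fix x assume x: "x \<in> X"
    show "{u \<in> A x. {u, q} \<in> E} \<subseteq> V" using sp x by (auto simp: spread_def simp del: atLeastAtMost_iff)
    have "card {u \<in> A x. {u, q} \<in> E} \<le> ?T" using q(2)[OF x] q(1) unfolding sel by (simp add: not_less)
    also have "\<dots> \<le> 100 * real s * K * ?N ^ (t - a)"
      unfolding pt using L by (intro mult_right_mono) auto
    finally show "card {u \<in> A x. {u, q} \<in> E} \<le> 100 * real s * K * ?N ^ (t - a)" .
    have "?N ^ (t - a) / (100 * real s * K) \<le> ?N ^ (t - a) / (16 * K)"
      using L mult_right_mono[of "16" "100 * real s" K] by (simp add: divide_left_mono)
    also have "\<dots> = (?N ^ t / K) * p / 16" unfolding pt[symmetric] by simp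
    also have "\<dots> \<le> card (priv X A x) * p / 16"
      using sp x p_bounds by (intro divide_right_mono mult_right_mono) (auto simp: spread_def)
    also have "\<dots> \<le> card (nbr E q \<inter> priv X A x)" using q(2)[OF x] q(1) by (simp add: not_less)
    also have "card (nbr E q \<inter> priv X A x) \<le> card (priv X (\<lambda>x. {u \<in> A x. {u, q} \<in> E}) x)"
    proof (rule card_mono)
      show "finite (priv X (\<lambda>x. {u \<in> A x. {u, q} \<in> E}) x)"
        by (rule finite_subset[OF priv_subset]) (simp add: sel)
    qed (auto simp: priv_def nbr_def)
    finally show "?N ^ (t - a) / (100 * real s * K) \<le> card (priv X (\<lambda>x. {u \<in> A x. {u, q} \<in> E}) x)" by simp
  qed
  with q(1) show ?thesis by (rule that)
qed

text \<open>Each step multiplies the constant by 100 s. By \<open>rot_neq\<close> the exponent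
  differs from a before the end, so one of the two step lemmas always applies.\<close>

lemma run_spread:
  fixes K :: real
  assumes "i + m \<le> b - 1" "spread K (rot a b i) X A" "finite X" "card X \<le> s" "1 \<le> K"
    "large s ((100 * real s) ^ m * K)"
  shows "\<exists>Q. (\<forall>j. Q j \<in> V) \<and> spread ((100 * real s) ^ m * K) (rot a b (i + m)) X (\<lambda>x. run a b V E Q (A x) i m)"
  using assms
proof (induction m)
  case 0
  then show ?case using nu by (intro exI[of _ "\<lambda>_. 1"]) auto
next
  case (Suc m)
  let ?G = "(100 * real s) ^ m * K" and ?k = "i + m"
  have s: "1 \<le> s" using Suc.prems(6) by (auto simp: large_def)
  have G1: "1 \<le> ?G"
  proof -
    have "1 * 1 \<le> ?G"
      using s Suc.prems(5) by (intro mult_mono one_le_power) auto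
    then show ?thesis by (simp only: mult_1)
  qed
  have Suc_eq: "(100 * real s) ^ Suc m * K = 100 * real s * ?G" by simp
  have "?G \<le> (100 * real s) ^ Suc m * K"
    unfolding Suc_eq using s G1 mult_right_mono[of 1 "100 * real s" ?G] by simp
  then have l: "large s ?G" using Suc.prems(6) s G1 by (auto intro: large_mono[of s])
  obtain Q where Q: "\<forall>j. Q j \<in> V" "spread ?G (rot a b ?k) X (\<lambda>x. run a b V E Q (A x) i m)"
    using Suc.IH Suc.prems l by auto
  have k: "?k < b - 1" using Suc.prems(1) by simp
  have rS: "rot a b (i + Suc m) = (if rot a b ?k < a then rot a b ?k + (b - a) else rot a b ?k - a)"
    using rot_Suc[OF ab(1,2), of ?k] by simp
  show ?case
  proof (cases "rot a b ?k < a")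
    case True
    have "spread (100 * real s * ?G) (rot a b ?k + (b - a)) X (\<lambda>x. nbrs V E (run a b V E Q (A x) i m))"
      by (rule spread_nbrs[OF Q(2) Suc.prems(3,4) True l])
    moreover have "run a b V E Q (A x) i (Suc m) = nbrs V E (run a b V E Q (A x) i m)" for x
      using True by (simp add: step_def)
    ultimately show ?thesis using Q(1) True
      by (intro exI[of _ Q]) (simp only: Suc_eq rS if_True simp_thms)
  next
    case False
    then have gt: "a < rot a b ?k" using rot_neq[OF ab k] by simp
    obtain q where q: "q \<in> V"
      "spread (100 * real s * ?G) (rot a b ?k - a) X (\<lambda>x. {u \<in> run a b V E Q (A x) i m. {u, q} \<in> E})"
      using spread_select[OF Q(2) Suc.prems(3,4) gt _ l] rot_less[of b a ?k] ab by auto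
    \<comment> \<open>The steps made so far read Q only below this index, so the update leaves them
      unchanged.\<close>
    let ?Q = "Q(?k := q)"
    have "run a b V E ?Q (A x) i m = run a b V E Q (A x) i m" for x
      by (rule run_cong) simp
    then have "run a b V E ?Q (A x) i (Suc m) = {u \<in> run a b V E Q (A x) i m. {u, q} \<in> E}" for x
      using False by (simp add: step_def)
    moreover have "\<forall>j. ?Q j \<in> V" using Q(1) q(1) by simp
    ultimately show ?thesis using q(2) False
      by (intro exI[of _ ?Q]) (simp only: Suc_eq rS if_False simp_thms)
  qed
qed

text \<open>At exponent a the expected number of neighbours in the union is bounded, so every
  pattern of hits and misses has probability bounded below in terms of s and K. The count yields the
  starting sets for pairs, the existence statement the coding vertices.\<close>

lemma ex_pattern:
  fixes K :: real
  assumes sp: "spread K a X A" and X: "finite X" "card X \<le> s" and I: "I \<subseteq> X" and l: "large s K"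
  shows "n / (8 * (K ^ s * exp (2 * (real s * K)))) \<le>
    real (card {u \<in> V - \<Union>(A ` X). one_each E (\<Union>(A ` X)) (priv X A ` I) u})" (is "?c \<le> real (card ?U)")
    and "\<exists>w\<in>V. one_each E (\<Union>(A ` X)) (priv X A ` I) w"
proof -
  note L = largeD[OF l]
  let ?N = "real \<nu>" and ?C = "\<Union>(A ` X)" and ?CC = "priv X A ` I"
  let ?l = "1 / K ^ s * exp (- 2 * (real s * K))"
  have cI: "card I \<le> s" using card_mono[OF X(1) I] X(2) by simp
  have cU: "card ?C \<le> real s * K * ?N ^ a" using spread_card_Union[OF sp X] L by simp
  have G: "p * card ?C \<le> real s * K"
  proof -
    have "p * card ?C \<le> p * (real s * K * ?N ^ a)" using cU p_bounds by (intro mult_left_mono) auto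
    then show ?thesis using nu by simp
  qed
  have w: "?l \<le> one_each_weight p ?C ?CC"
  proof -
    have "(1 / K) ^ s \<le> (1 / K) ^ card I" using L cI by (intro power_decreasing) auto
    then have "?l \<le> (1 / K) ^ card I * exp (- 2 * (real s * K))"
      by (intro mult_right_mono) (auto simp: power_one_over)
    also have "\<dots> = (p * ?N ^ a / K) ^ card I * exp (- 2 * (real s * K))" using nu by simp
    also have "\<dots> \<le> one_each_weight p ?C ?CC"
      by (rule spread_weight(1)[OF sp X(1) I L(2) G])
    finally show ?thesis .
  qed
  have nw: "n * ?l \<le> n * one_each_weight p ?C ?CC" by (intro mult_left_mono w) auto
  have A: "n * one_each_weight p ?C ?CC / 8 \<le> real (card ?U)"
  proof (rule many_one_each)
    show "?C \<subseteq> V" using sp by (auto simp: spread_def)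
    show "?CC \<subseteq> Pow ?C" using I priv_subset[of X A] by blast
    show "disjoint ?CC"
      using I priv_disjoint[of _ X _ A] priv_subset[of X A] by (fastforce simp: disjoint_def)
    have "2 * real (card ?C) \<le> ?N * ?N ^ a"
      using cU L mult_right_mono[of "2 * (real s * K)" ?N "?N ^ a"] by (simp add: mult.assoc)
    also have "\<dots> \<le> real n"
      using power_nu_mono[of "Suc a" b] ab by simp
    finally show "2 * card ?C \<le> n" by (simp flip: of_nat_mult of_nat_power)
    have one: "1 \<le> real s * K * ?N ^ a"
    proof -
      have "1 * 1 * 1 \<le> real s * K * ?N ^ a" using L nu by (intro mult_mono) auto
      then show ?thesis by simp
    qed
    have "100 * (real (card ?CC) + 2) * (real (card ?C) + 1) * ln n \<le>
        100 * (3 * real s) * (2 * (real s * K * ?N ^ a)) * ln n"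
      using cU one ln_n L cI spread_weight(2)[OF sp X(1) I L(2) G]
      by (intro mult_right_mono mult_mono) auto
    also have "\<dots> = (600 * (real s ^ 2 * K * ln n)) * ?N ^ a"
      by (simp add: power2_eq_square)
    also have "\<dots> \<le> (?N * ?l) * ?N ^ a"
    proof (rule mult_right_mono)
      have "600 * (real s ^ 2 * K * ln n) \<le> 10000 * (real s ^ 2 * K * ln n)"
        using L ln_n by (intro mult_right_mono) auto
      then show "600 * (real s ^ 2 * K * ln n) \<le> ?N * ?l" using L(5) by (simp add: mult_ac)
    qed simp
    also have "\<dots> = (?N * ?N ^ a) * ?l" by simp
    also have "\<dots> \<le> n * ?l"
      using power_nu_mono[of "Suc a" b] ab L by (intro mult_right_mono) auto
    also note nw
    finally show "100 * (card ?CC + 2) * (card ?C + 1) * ln n \<le> n * one_each_weight p ?C ?CC"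
      by (simp add: algebra_simps)
  qed
  have c: "?c = n * ?l / 8"
  proof -
    have eq: "exp (- 2 * (real s * K)) = inverse (exp (2 * (real s * K)))"
      by (simp flip: exp_minus)
    have *: "x / (8 * (g * e)) = x * (1 / g * inverse e) / 8" for x g e :: real
      unfolding divide_inverse inverse_mult_distrib by (simp only: mult_1_left mult_ac)
    show ?thesis unfolding eq by (rule *)
  qed
  show pos: "?c \<le> real (card ?U)"
    unfolding c by (rule order_trans[OF divide_right_mono[OF nw] A]) simp
  have "0 < ?c" using nu L by simp
  then have "0 < real (card ?U)" using pos by (rule less_le_trans)
  then have "?U \<noteq> {}" by (intro notI) (simp only: card.empty of_nat_0 less_irrefl)
  then show "\<exists>w\<in>V. one_each E ?C ?CC w" by blast
qed


text \<open>The constants at the three stages of coding a relation: after the runs for single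
  vertices, after passing to common neighbourhoods (the loss in \<open>ex_pattern\<close>), and
  after the runs for at most s^2 pairs.\<close>

definition "bound1 s = (100 * real s) ^ b"
definition "bound2 s = 8 * (bound1 s ^ s * exp (2 * (real s * bound1 s)))"
definition "bound3 s = (100 * real (s ^ 2)) ^ b * bound2 s"

lemma bounds:
  assumes "1 \<le> s"
  shows "1 \<le> bound1 s" "1 \<le> bound2 s" "bound1 s \<le> bound2 s" "2 * real s * bound1 s \<le> bound3 s" "bound2 s \<le> bound3 s"
proof -
  show b1: "1 \<le> bound1 s" unfolding bound1_def by (rule one_le_power) (use assms in simp)
  have e: "1 \<le> exp (2 * (real s * bound1 s))" using b1 assms by simp
  have "bound1 s ^ 1 \<le> bound1 s ^ s" using b1 assms by (intro power_increasing) auto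
  then have "1 * (bound1 s * 1) \<le> 8 * (bound1 s ^ s * exp (2 * (real s * bound1 s)))"
    using e b1 by (intro mult_mono) auto
  then show b12: "bound1 s \<le> bound2 s" by (simp add: bound2_def)
  then show b2: "1 \<le> bound2 s" using b1 by simp
  have sb: "100 * real s \<le> (100 * real (s ^ 2)) ^ b"
  proof -
    have "1 \<le> s ^ 2" using assms by simp
    then have "1 \<le> real (s ^ 2)" by linarith
    have "100 * real s \<le> 100 * real (s ^ 2)"
      using assms by (simp add: power2_eq_square)
    also have "\<dots> = (100 * real (s ^ 2)) ^ 1" by simp
    also have "\<dots> \<le> (100 * real (s ^ 2)) ^ b"
      using \<open>1 \<le> real (s ^ 2)\<close> ab by (intro power_increasing) linarith+
    finally show ?thesis .
  qed
  have "2 * real s * bound1 s \<le> (100 * real (s ^ 2)) ^ b * bound2 s"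
    using sb b12 b1 assms by (intro mult_mono) auto
  then show "2 * real s * bound1 s \<le> bound3 s" by (simp add: bound3_def)
  have "1 * bound2 s \<le> (100 * real (s ^ 2)) ^ b * bound2 s"
    using sb b2 assms by (intro mult_right_mono) auto
  then show "bound2 s \<le> bound3 s" by (simp add: bound3_def)
qed

lemma large_bounds:
  assumes "large (s ^ 2) (bound3 s)"
  shows "1 \<le> s" "large s (bound1 s)" "large s (2 * real s * bound1 s)" "large (s ^ 2) (bound3 s)"
proof -
  show s: "1 \<le> s" using assms by (auto simp: large_def Suc_le_eq)
  note B = bounds[OF s]
  have ss: "s \<le> s ^ 2" using s by (simp add: power2_eq_square)
  show "large s (bound1 s)" using B by (intro large_mono[OF assms s ss]) auto
  have "1 * 1 * 1 \<le> 2 * real s * bound1 s" using s B by (intro mult_mono) auto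
  then show "large s (2 * real s * bound1 s)" using B by (intro large_mono[OF assms s ss]) auto
qed (rule assms)

text \<open>Distinct singletons are their own private parts, so the run starts at exponent 0 with
  constant 1.\<close>

lemma vset_spread:
  assumes l: "large (s ^ 2) (bound3 s)" and S: "S \<subseteq> V" "card S \<le> s"
  shows "\<exists>Q. (\<forall>j. Q j \<in> V) \<and> spread (bound1 s) a S (vset a b V E Q)"
proof -
  note s = large_bounds(1)[OF l] and B = bounds[OF large_bounds(1)[OF l]]
  have finS: "finite S" using S(1) by (rule finite_subset) simp
  have le: "(100 * real s) ^ (b - 1) * 1 \<le> bound1 s"
    unfolding bound1_def by (subst mult_1_right, rule power_increasing) (use s in auto)
  have ge: "1 \<le> (100 * real s) ^ (b - 1) * 1" by (subst mult_1_right, rule one_le_power) (use s in auto)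
  have "spread 1 (rot a b 0) S (\<lambda>x. {x} \<inter> V)"
  proof -
    have "priv S (\<lambda>x. {x} \<inter> V) x = {x}" "{x} \<inter> V = {x}" if "x \<in> S" for x
      using S(1) that by (auto simp: priv_def)
    then show ?thesis using S by (auto simp: spread_def)
  qed
  then obtain Q where "\<forall>j. Q j \<in> V"
      "spread ((100 * real s) ^ (b - 1) * 1) (rot a b (0 + (b - 1))) S (\<lambda>x. run a b V E Q ({x} \<inter> V) 0 (b - 1))"
    using run_spread[of 0 "b - 1" 1 S "\<lambda>x. {x} \<inter> V" s] large_mono[OF large_bounds(2)[OF l] s order_refl ge le] S(2) finS
    by auto
  then show ?thesis using spread_mono[OF _ ge le] rot_last[OF ab(1,2)]
    by (intro exI[of _ Q]) (auto simp: vset_def[abs_def])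
qed

lemma ex_coded1:
  assumes l: "large (s ^ 2) (bound3 s)" and S: "S \<subseteq> V" "card S \<le> s" and "T \<subseteq> S"
  shows "\<exists>e. (\<forall>j. e j \<in> V) \<and> (\<forall>x\<in>S. coded1 a b V E e x \<longleftrightarrow> x \<in> T)"
proof -
  obtain Q where Q: "\<forall>j. Q j \<in> V" "spread (bound1 s) a S (vset a b V E Q)"
    using vset_spread[OF l S] by auto
  have finS: "finite S" using S(1) by (rule finite_subset) simp
  let ?A = "vset a b V E Q"
  obtain w where w: "w \<in> V" "one_each E (\<Union>(?A ` S)) (priv S ?A ` T) w"
    using ex_pattern(2)[OF Q(2) finS S(2) assms(4) large_bounds(2)[OF l]] by auto
  let ?e = "Q(2 * b := w)"
  have eq: "vset a b V E ?e x = ?A x" for x by (rule vset_cong) auto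
  have "coded1 a b V E ?e x \<longleftrightarrow> x \<in> T" if "x \<in> S" for x
  proof -
    have "?A x \<subseteq> V" using Q(2) that by (auto simp: spread_def simp del: atLeastAtMost_iff)
    then have "coded1 a b V E ?e x \<longleftrightarrow> (\<exists>u\<in>?A x. {u, w} \<in> E)" unfolding coded1_def eq by auto
    also have "\<dots> \<longleftrightarrow> x \<in> T" by (rule one_each_hits[OF w(2) assms(4) that])
    finally show ?thesis .
  qed
  then show ?thesis using Q(1) w(1) by (intro exI[of _ ?e]) auto
qed

text \<open>The sets attached to all pairs x < y are treated as one family. A vertex whose pattern
  on the sets of the single elements is exactly {x, y} is a common neighbour for this pair and for
  no other, so the family has large private parts from the start. R must be symmetric because
  \<open>pset\<close> is.\<close>

lemma ex_coded2:
  assumes l: "large (s ^ 2) (bound3 s)" and S: "S \<subseteq> V" "card S \<le> s"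
    and R: "\<And>x y. R x y \<longleftrightarrow> R y x"
  shows "\<exists>e. (\<forall>j. e j \<in> V) \<and> (\<forall>x\<in>S. \<forall>y\<in>S. x \<noteq> y \<longrightarrow> (coded2 a b V E e x y \<longleftrightarrow> R x y))"
proof -
  note s = large_bounds(1)[OF l] and B = bounds[OF large_bounds(1)[OF l]]
  have s2: "1 \<le> s ^ 2" using s by simp
  have finS: "finite S" using S(1) by (rule finite_subset) simp
  obtain Q where Q: "\<forall>j. Q j \<in> V" "spread (bound1 s) a S (vset a b V E Q)"
    using vset_spread[OF l S] by auto
  let ?A = "vset a b V E Q"
  let ?X = "{(x, y). x \<in> S \<and> y \<in> S \<and> x < y}"
  let ?M = "\<lambda>(x, y). {u \<in> V. u \<in> nbrs V E (?A x) \<and> u \<in> nbrs V E (?A y)}"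
  have X: "?X \<subseteq> S \<times> S" by auto
  then have finX: "finite ?X" using finS by (auto intro: finite_subset)
  have "card ?X \<le> card (S \<times> S)" using X finS by (intro card_mono) auto
  also have "\<dots> \<le> s ^ 2" using S(2) by (simp add: card_cartesian_product power2_eq_square mult_le_mono)
  finally have cX: "card ?X \<le> s ^ 2" .
  have M: "spread (bound2 s) b ?X ?M"
    unfolding spread_def
  proof (intro ballI conjI)
    fix z assume z: "z \<in> ?X"
    obtain x y where xy: "z = (x, y)" "x \<in> S" "y \<in> S" "x < y" using z by auto
    show "?M z \<subseteq> V" by (auto simp: xy)
    then have "card (?M z) \<le> card V" by (intro card_mono) auto
    also have "real (card V) \<le> bound2 s * real \<nu> ^ b"
      using B(2) mult_right_mono[of 1 "bound2 s" "real \<nu> ^ b"] by simp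
    finally show "real (card (?M z)) \<le> bound2 s * real \<nu> ^ b" by simp
    have I: "{x, y} \<subseteq> S" using xy by auto
    let ?U = "{u \<in> V - \<Union>(?A ` S). one_each E (\<Union>(?A ` S)) (priv S ?A ` {x, y}) u}"
    have "real \<nu> ^ b / bound2 s \<le> card ?U"
      using ex_pattern(1)[OF Q(2) finS S(2) I large_bounds(2)[OF l]] by (simp add: bound2_def)
    also have "card ?U \<le> card (priv ?X ?M z)"
    proof (rule card_mono)
      show "finite (priv ?X ?M z)" by (rule finite_subset[OF priv_subset]) (auto simp: xy)
      show "?U \<subseteq> priv ?X ?M z"
      proof
        fix u assume u: "u \<in> ?U"
        have nb: "u \<in> nbrs V E (?A w) \<longleftrightarrow> w \<in> {x, y}" if "w \<in> S" for w
        proof -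
          have "u \<in> nbrs V E (?A w) \<longleftrightarrow> (\<exists>v\<in>?A w. {v, u} \<in> E)"
            using u by (auto simp: nbrs_def insert_commute)
          also have "\<dots> \<longleftrightarrow> w \<in> {x, y}" by (rule one_each_hits[OF _ I that]) (use u in auto)
          finally show ?thesis .
        qed
        have "u \<in> ?M z" using nb xy u by auto
        moreover have "u \<notin> ?M z'" if "z' \<in> ?X" "z' \<noteq> z" for z'
          using that nb xy by auto
        ultimately show "u \<in> priv ?X ?M z" by (auto simp: priv_def)
      qed
    qed
    finally show "real \<nu> ^ b / bound2 s \<le> card (priv ?X ?M z)" by simp
  qed
  let ?c = "100 * real (s ^ 2)"
  have "1 \<le> real (s ^ 2)" using s2 by linarith
  then have c1: "1 \<le> ?c" by linarith
  have l2: "large (s ^ 2) K" if "1 \<le> K" "K \<le> bound3 s" for K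
    using large_mono[OF l s2 order_refl] that by auto
  have g1: "1 \<le> ?c * bound2 s" using mult_mono[of 1 ?c 1 "bound2 s"] c1 B by auto
  have g2: "?c ^ (b - 2) * (?c * bound2 s) \<le> bound3 s"
  proof -
    have "?c ^ (b - 2) * (?c * bound2 s) = ?c ^ (b - 1) * bound2 s"
    proof -
      have "b - 1 = Suc (b - 2)" using ab by simp
      then show ?thesis by (simp only: power_Suc mult_ac)
    qed
    also have "\<dots> \<le> bound3 s"
      unfolding bound3_def using c1 B by (intro mult_right_mono power_increasing) auto
    finally show ?thesis .
  qed
  have g3: "1 \<le> ?c ^ (b - 2) * (?c * bound2 s)"
    using mult_mono[of 1 "?c ^ (b - 2)" 1 "?c * bound2 s"] g1 one_le_power[OF c1] by auto
  \<comment> \<open>Exponent b is outside the range of \<open>rot\<close>; one selection brings it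
    to b - a, from where a run can continue.\<close>
  obtain q where q: "q \<in> V" "spread (?c * bound2 s) (b - a) ?X (\<lambda>z. {u \<in> ?M z. {u, q} \<in> E})"
    using spread_select[OF M finX cX ab(2) order_refl l2] B by auto
  have r1: "rot a b 1 = b - a" using ab by (simp add: rot_def)
  have sp1: "spread (?c * bound2 s) (rot a b 1) ?X (\<lambda>z. {u \<in> ?M z. {u, q} \<in> E})"
    unfolding r1 by (rule q(2))
  have "1 + (b - 2) \<le> b - 1" using ab by simp
  from run_spread[OF this sp1 finX cX g1 l2[OF g3 g2]]
  obtain Q' where Q': "\<forall>j. Q' j \<in> V"
      "spread (?c ^ (b - 2) * (?c * bound2 s)) (rot a b (1 + (b - 2))) ?X (\<lambda>z. run a b V E Q' {u \<in> ?M z. {u, q} \<in> E} 1 (b - 2))"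
    by blast
  have r2: "rot a b (1 + (b - 2)) = a"
  proof -
    have "1 + (b - 2) = b - 1" using ab by simp
    then show ?thesis using rot_last[OF ab(1,2)] by (simp only:)
  qed
  let ?B = "\<lambda>z. run a b V E Q' {u \<in> ?M z. {u, q} \<in> E} 1 (b - 2)"
  have Bs: "spread (bound3 s) a ?X ?B" using spread_mono[OF Q'(2) g3 g2] r2 by simp
  let ?I = "{z \<in> ?X. R (fst z) (snd z)}"
  have "?I \<subseteq> ?X" by blast
  from ex_pattern(2)[OF Bs finX cX this l]
  obtain w where w: "w \<in> V" "one_each E (\<Union>(?B ` ?X)) (priv ?X ?B ` ?I) w"
    by blast
  \<comment> \<open>The run for pairs reads e at b + j with 1 <= j < b - 1 and so avoids the entries
    b and 2 * b.\<close>
  let ?e = "\<lambda>j. if j < b then Q j else if j = b then q else if j = 2 * b then w else Q' (j - b)"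
  have L1e: "vset a b V E ?e x = ?A x" for x by (rule vset_cong) auto
  have L2e: "pset a b V E ?e x y = ?B (x, y)" for x y
  proof -
    have "?e (b + j) = Q' j" if "1 \<le> j" "j < 1 + (b - 2)" for j
      using that ab by auto
    then have "run a b V E (\<lambda>i. ?e (b + i)) A 1 (b - 2) = run a b V E Q' A 1 (b - 2)" for A
      by (rule run_cong)
    then show ?thesis unfolding pset_def L1e by simp
  qed
  have L2s: "pset a b V E ?e x y = pset a b V E ?e y x" for x y
    unfolding pset_def by (simp add: conj_commute)
  have ew: "?e (2 * b) = w" using ab by simp
  have less: "coded2 a b V E ?e x y \<longleftrightarrow> R x y" if "x \<in> S" "y \<in> S" "x < y" for x y
  proof -
    have z: "(x, y) \<in> ?X" using that by simp
    have "?B (x, y) \<subseteq> V" by (rule spread_subset[OF Bs z])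
    then have "coded2 a b V E ?e x y \<longleftrightarrow> (\<exists>u\<in>?B (x, y). {u, w} \<in> E)"
      unfolding coded2_def L2e ew by auto
    also have "\<dots> \<longleftrightarrow> (x, y) \<in> ?I" by (rule one_each_hits[OF w(2) _ z]) auto
    finally show ?thesis using z by simp
  qed
  have sym: "coded2 a b V E ?e x y \<longleftrightarrow> coded2 a b V E ?e y x" for x y
    unfolding coded2_def L2s[of x y] ..
  have "coded2 a b V E ?e x y \<longleftrightarrow> R x y" if "x \<in> S" "y \<in> S" "x \<noteq> y" for x y
    using that less[of x y] less[of y x] sym[of x y] R[of x y] by (cases "x < y") auto
  then show ?thesis using Q(1) Q'(1) q(1) w(1) by (intro exI[of _ ?e]) auto
qed

text \<open>The set attached to vertex 1 is cut into m classes of nearly equal size; a vertex with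
  exactly one neighbour in each class picks out exactly m elements.\<close>

lemma ex_coded_dom:
  assumes l: "large (s ^ 2) (bound3 s)" and m: "1 \<le> m" "m \<le> s"
  shows "\<exists>e. (\<forall>j. e j \<in> V) \<and> card (coded_dom a b V E e) = m"
proof -
  note s = large_bounds(1)[OF l] and B = bounds[OF large_bounds(1)[OF l]]
  let ?N = "real \<nu>"
  have k: "{1} \<subseteq> V" "card {1::nat} \<le> s" using n_ge nu s by auto
  obtain Q where Q: "\<forall>j. Q j \<in> V" "spread (bound1 s) a {1} (vset a b V E Q)"
    using vset_spread[OF l k] by auto
  let ?L = "vset a b V E Q 1"
  have L: "?L \<subseteq> V" "card ?L \<le> bound1 s * ?N ^ a" "?N ^ a / bound1 s \<le> card ?L"
    using Q(2) by (auto simp: spread_def priv_def simp del: atLeastAtMost_iff)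
  have finL: "finite ?L" using L(1) by (rule finite_subset) simp
  obtain c where c: "c ` ?L \<subseteq> {..<m}" "\<And>i. i < m \<Longrightarrow> card ?L div m \<le> card {u\<in>?L. c u = i}"
    using balanced_partition[OF finL, of m] m by auto
  let ?C = "\<lambda>i. {u\<in>?L. c u = i}"
  let ?G = "2 * real s * bound1 s"
  note lG = largeD[OF large_bounds(3)[OF l]]
  have "real s \<le> ?N ^ a / bound1 s"
  proof -
    have "real s * bound1 s \<le> 10000 * (real s * (2 * real s * bound1 s))"
      using s B mult_mono[of 1 "20000 * real s" "real s * bound1 s" "real s * bound1 s"] by (simp add: mult_ac)
    also have "\<dots> \<le> ?N" using lG(4) by (simp add: mult_ac)
    also have "\<dots> \<le> ?N ^ a" using power_nu_mono[of 1 a] ab by simp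
    finally show ?thesis using B by (simp add: field_simps)
  qed
  then have cL: "m \<le> card ?L" using L(3) m by linarith
  have priv: "priv {..<m} ?C i = ?C i" if "i < m" for i by (auto simp: priv_def)
  have C: "spread ?G a {..<m} ?C"
    unfolding spread_def
  proof (intro ballI conjI)
    fix i assume i: "i \<in> {..<m}"
    show "?C i \<subseteq> V" using L(1) by auto
    have "card (?C i) \<le> card ?L" using finL by (intro card_mono) auto
    also have "\<dots> \<le> bound1 s * ?N ^ a" by (rule L(2))
    also have "\<dots> \<le> ?G * ?N ^ a"
      using s B mult_right_mono[of 1 "2 * real s" "bound1 s"] by (intro mult_right_mono) auto
    finally show "card (?C i) \<le> ?G * ?N ^ a" by simp
    have "?N ^ a / ?G \<le> (?N ^ a / bound1 s) / (2 * real m)"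
      using m B s by (simp add: divide_left_mono mult_mono)
    also have "\<dots> \<le> card ?L / (2 * real m)" using L(3) by (intro divide_right_mono) auto
    \<comment> \<open>Rounding down loses at most a factor 2 because m <= card ?L; this explains the
      2 in ?G.\<close>
    also have "\<dots> \<le> card ?L div m"
    proof -
      have "card ?L < m * (card ?L div m) + m" using m
        by (metis add_less_cancel_left mod_less_divisor mult_div_mod_eq less_le_trans zero_less_one)
      moreover have "m \<le> m * (card ?L div m)" using cL m by (simp add: div_greater_zero_iff Suc_le_eq)
      ultimately have "card ?L \<le> 2 * (m * (card ?L div m))" by linarith
      then have "real (card ?L) \<le> real (2 * (m * (card ?L div m)))" by (simp only: of_nat_le_iff)
      then show ?thesis using m by (simp add: field_simps)
    qed
    also have "\<dots> \<le> card (?C i)" using c(2)[of i] i by simp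
    finally show "?N ^ a / ?G \<le> card (priv {..<m} ?C i)" using priv i by simp
  qed
  obtain w where w: "w \<in> V" "one_each E (\<Union>(?C ` {..<m})) (priv {..<m} ?C ` {..<m}) w"
    using ex_pattern(2)[OF C _ _ order_refl large_bounds(3)[OF l]] m by auto
  let ?e = "Q(b := 1, 2 * b := w)"
  have eq: "vset a b V E ?e x = vset a b V E Q x" for x by (rule vset_cong) auto
  have "coded_dom a b V E ?e = {u\<in>?L. {u, w} \<in> E}"
    unfolding coded_dom_def eq using L(1) ab by auto
  also have "\<dots> = (\<Union>i\<in>{..<m}. nbr E w \<inter> ?C i)" using c(1) by (auto simp: nbr_def)
  finally have "card (coded_dom a b V E ?e) = card (\<Union>i\<in>{..<m}. nbr E w \<inter> ?C i)" by (rule arg_cong)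
  also have "\<dots> = (\<Sum>i\<in>{..<m}. card (nbr E w \<inter> ?C i))"
    by (rule card_UN_disjoint) auto
  also have "\<dots> = (\<Sum>i\<in>{..<m}. 1)"
    using w(2) priv by (intro sum.cong refl) (auto simp: one_each_def)
  finally have "card (coded_dom a b V E ?e) = m" by simp
  moreover have "?e j \<in> V" for j using Q(1) w(1) k by auto
  ultimately show ?thesis by blast
qed

end

section \<open>First-order definability\<close>

text \<open>Formulas are never written out; closure properties of this predicate take their place.
  It speaks of all V and all assignments, and the rules for bounded quantifiers need sets that lie
  inside V for every one of them.\<close>

definition definable :: "(nat set \<Rightarrow> nat set set \<Rightarrow> (nat \<Rightarrow> nat) \<Rightarrow> bool) \<Rightarrow> bool" where
  "definable P \<longleftrightarrow> (\<exists>\<phi>. \<forall>V E s. sat V E s \<phi> \<longleftrightarrow> P V E s)"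

lemma finite_free_vars: "finite (free_vars \<phi>)"
  by (induction \<phi>) auto

text \<open>\<pi> need not be injective. Capture is avoided by first moving the bound variable to a
  name outside the image of the free variables.\<close>

lemma ex_renaming:
  "\<exists>\<phi>'. free_vars \<phi>' \<subseteq> \<pi> ` free_vars \<phi> \<and> (\<forall>V E s. sat (V :: nat set) E s \<phi>' \<longleftrightarrow> sat V E (\<lambda>i. s (\<pi> i)) \<phi>)"
proof (induction \<phi> arbitrary: \<pi>)
  case (Eq x y)
  show ?case by (intro exI[of _ "Eq (\<pi> x) (\<pi> y)"]) simp
next
  case (Adj x y)
  show ?case by (intro exI[of _ "Adj (\<pi> x) (\<pi> y)"]) simp
next
  case (Neg \<phi>)
  from Neg.IH[of \<pi>] obtain \<phi>' where
    "free_vars \<phi>' \<subseteq> \<pi> ` free_vars \<phi>" "\<forall>V E s. sat (V :: nat set) E s \<phi>' \<longleftrightarrow> sat V E (\<lambda>i. s (\<pi> i)) \<phi>" by blast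
  then show ?case by (intro exI[of _ "Neg \<phi>'"]) simp
next
  case (Conj \<phi> \<psi>)
  from Conj.IH(1)[of \<pi>] obtain \<phi>' where
    "free_vars \<phi>' \<subseteq> \<pi> ` free_vars \<phi>" "\<forall>V E s. sat (V :: nat set) E s \<phi>' \<longleftrightarrow> sat V E (\<lambda>i. s (\<pi> i)) \<phi>" by blast
  moreover from Conj.IH(2)[of \<pi>] obtain \<psi>' where
    "free_vars \<psi>' \<subseteq> \<pi> ` free_vars \<psi>" "\<forall>V E s. sat (V :: nat set) E s \<psi>' \<longleftrightarrow> sat V E (\<lambda>i. s (\<pi> i)) \<psi>" by blast
  ultimately show ?case by (intro exI[of _ "Conj \<phi>' \<psi>'"]) auto
next
  case (Ex x \<phi>)
  have "finite (\<pi> ` free_vars \<phi>)" by (simp add: finite_free_vars)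
  then obtain y where y: "y \<notin> \<pi> ` free_vars \<phi>" by (meson ex_new_if_finite infinite_UNIV_nat)
  from Ex.IH[of "\<pi>(x := y)"] obtain \<phi>' where \<phi>': "free_vars \<phi>' \<subseteq> \<pi>(x := y) ` free_vars \<phi>"
    "\<forall>V E s. sat (V :: nat set) E s \<phi>' \<longleftrightarrow> sat V E (\<lambda>i. s ((\<pi>(x := y)) i)) \<phi>" by blast
  have "sat V E (\<lambda>i. (s(y := v)) ((\<pi>(x := y)) i)) \<phi> \<longleftrightarrow> sat V E ((\<lambda>i. s (\<pi> i))(x := v)) \<phi>" for V :: "nat set" and E s v
    by (rule sat_cong) (use y in auto)
  then show ?case using \<phi>' by (intro exI[of _ "Ex y \<phi>'"]) (simp, blast)
qed

lemma definable_rename: "definable P \<Longrightarrow> definable (\<lambda>V E s. P V E (\<lambda>i. s (\<pi> i)))"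
  unfolding definable_def
proof -
  assume "\<exists>\<phi>. \<forall>V E s. sat V E s \<phi> \<longleftrightarrow> P V E s"
  then obtain \<phi> where \<phi>: "\<forall>V E s. sat V E s \<phi> \<longleftrightarrow> P V E s" by blast
  from ex_renaming[of \<pi> \<phi>] obtain \<phi>' where "\<forall>V E s. sat (V :: nat set) E s \<phi>' \<longleftrightarrow> sat V E (\<lambda>i. s (\<pi> i)) \<phi>"
    by blast
  with \<phi> show "\<exists>\<phi>. \<forall>V E s. sat V E s \<phi> \<longleftrightarrow> P V E (\<lambda>i. s (\<pi> i))" by (intro exI[of _ \<phi>']) simp
qed

lemma definable_eq: "definable (\<lambda>V E s. s i = s j)"
  unfolding definable_def by (intro exI[of _ "Eq i j"]) simp

lemma definable_adj: "definable (\<lambda>V E s. {s i, s j} \<in> E)"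
  unfolding definable_def by (intro exI[of _ "Adj i j"]) simp

lemma definable_not: "definable P \<Longrightarrow> definable (\<lambda>V E s. \<not> P V E s)"
proof -
  assume "definable P"
  then obtain \<phi> where "\<forall>V E s. sat V E s \<phi> \<longleftrightarrow> P V E s" by (auto simp: definable_def)
  then show ?thesis unfolding definable_def by (intro exI[of _ "Neg \<phi>"]) simp
qed

lemma definable_conj: "definable P \<Longrightarrow> definable R \<Longrightarrow> definable (\<lambda>V E s. P V E s \<and> R V E s)"
proof -
  assume "definable P" "definable R"
  then obtain \<phi> \<psi> where "\<forall>V E s. sat V E s \<phi> \<longleftrightarrow> P V E s" "\<forall>V E s. sat V E s \<psi> \<longleftrightarrow> R V E s"
    unfolding definable_def by blast
  then show ?thesis unfolding definable_def by (intro exI[of _ "Conj \<phi> \<psi>"]) simp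
qed

lemma definable_disj:
  assumes "definable P" "definable R" shows "definable (\<lambda>V E s. P V E s \<or> R V E s)"
proof -
  have "definable (\<lambda>V E s. \<not> (\<not> P V E s \<and> \<not> R V E s))"
    using assms by (intro definable_not definable_conj)
  then show ?thesis by simp
qed

lemma definable_imp: "definable P \<Longrightarrow> definable R \<Longrightarrow> definable (\<lambda>V E s. P V E s \<longrightarrow> R V E s)"
  unfolding imp_conv_disj by (intro definable_disj definable_not)

lemma definable_iff: "definable P \<Longrightarrow> definable R \<Longrightarrow> definable (\<lambda>V E s. P V E s \<longleftrightarrow> R V E s)"
  unfolding iff_conv_conj_imp by (intro definable_conj definable_imp)

lemma definable_False: "definable (\<lambda>V E s. False)"
  using definable_not[OF definable_eq[of 0 0]] by simp

text \<open>In the hypothesis the quantified value sits at index 0 and everything else is shifted up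
  by one, as with de Bruijn indices; nested quantifiers then need no choice of names.\<close>

lemma definable_ex:
  assumes "definable (\<lambda>V E s. P V E (s 0) (\<lambda>i. s (Suc i)))"
  shows "definable (\<lambda>V E s. \<exists>v\<in>V. P V E v s)"
proof -
  from assms obtain \<phi> where \<phi>: "\<And>V E s. sat V E s \<phi> \<longleftrightarrow> P V E (s 0) (\<lambda>i. s (Suc i))"
    by (auto simp: definable_def)
  have "finite ((\<lambda>i. i - 1) ` free_vars \<phi>)" by (simp add: finite_free_vars)
  then obtain y where y: "y \<notin> (\<lambda>i. i - 1) ` free_vars \<phi>" by (meson ex_new_if_finite infinite_UNIV_nat)
  from ex_renaming[of "case_nat y id" \<phi>] obtain \<phi>' where
    \<phi>': "\<forall>V E s. sat (V :: nat set) E s \<phi>' \<longleftrightarrow> sat V E (\<lambda>i. s (case_nat y id i)) \<phi>" by blast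
  have "sat V E s (Ex y \<phi>') \<longleftrightarrow> (\<exists>v\<in>V. P V E v s)" for V E s
  proof -
    have "sat V E (\<lambda>i. (s(y := v)) (case_nat y id i)) \<phi> \<longleftrightarrow> sat V E (case_nat v s) \<phi>" for v
    proof (rule sat_cong)
      fix x assume "x \<in> free_vars \<phi>"
      then have "x - 1 \<noteq> y" using y by blast
      then show "(s(y := v)) (case_nat y id x) = case_nat v s x" by (cases x) auto
    qed
    then have "(\<exists>v\<in>V. sat V E (\<lambda>i. (s(y := v)) (case_nat y id i)) \<phi>) \<longleftrightarrow> (\<exists>v\<in>V. sat V E (case_nat v s) \<phi>)"
      by (simp only:)
    moreover have "sat V E s (Ex y \<phi>') \<longleftrightarrow> (\<exists>v\<in>V. sat V E (\<lambda>i. (s(y := v)) (case_nat y id i)) \<phi>)"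
      using \<phi>' by (simp only: sat.simps)
    ultimately show ?thesis by (simp add: \<phi>)
  qed
  then show ?thesis unfolding definable_def by blast
qed

lemma definable_Bex:
  assumes "\<And>V E s. A V E s \<subseteq> V" "definable (\<lambda>V E s. s 0 \<in> A V E (\<lambda>i. s (Suc i)))"
    "definable (\<lambda>V E s. P V E (s 0) (\<lambda>i. s (Suc i)))"
  shows "definable (\<lambda>V E s. \<exists>v\<in>A V E s. P V E v s)"
proof -
  have "definable (\<lambda>V E s. \<exists>v\<in>V. v \<in> A V E s \<and> P V E v s)"
    using assms by (intro definable_ex definable_conj)
  moreover have "(\<exists>v\<in>V. v \<in> A V E s \<and> P V E v s) \<longleftrightarrow> (\<exists>v\<in>A V E s. P V E v s)" for V E s
    using assms(1) by blast
  ultimately show ?thesis by simp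
qed

lemma definable_Ball:
  assumes "\<And>V E s. A V E s \<subseteq> V" "definable (\<lambda>V E s. s 0 \<in> A V E (\<lambda>i. s (Suc i)))"
    "definable (\<lambda>V E s. P V E (s 0) (\<lambda>i. s (Suc i)))"
  shows "definable (\<lambda>V E s. \<forall>v\<in>A V E s. P V E v s)"
proof -
  have "definable (\<lambda>V E s. \<not> (\<exists>v\<in>A V E s. \<not> P V E v s))"
    by (intro definable_not definable_Bex assms)
  then show ?thesis by simp
qed

lemma definable_ex_less:
  "(\<And>c. c < k \<Longrightarrow> definable (P c)) \<Longrightarrow> definable (\<lambda>V E s. \<exists>c<k. P c V E s)" for k :: nat
proof (induction k)
  case 0
  then show ?case using definable_False by simp
next
  case (Suc k)
  have "definable (\<lambda>V E s. (\<exists>c<k. P c V E s) \<or> P k V E s)"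
    using Suc by (intro definable_disj) auto
  then show ?case by (simp add: less_Suc_eq conj_disj_distribR ex_disj_distrib)
qed

lemma definable_all_less:
  fixes k :: nat assumes "\<And>c. c < k \<Longrightarrow> definable (P c)"
  shows "definable (\<lambda>V E s. \<forall>c<k. P c V E s)"
proof -
  have "definable (\<lambda>V E s. \<not> (\<exists>c<k. \<not> P c V E s))"
    by (intro definable_not definable_ex_less assms)
  then show ?thesis by simp
qed

text \<open>Quantification over a whole code is a block of l vertex quantifiers pushed in front of
  the assignment.\<close>

lemma definable_ex_block:
  assumes "definable P"
  shows "definable (\<lambda>V E s. \<exists>t. (\<forall>i<l. t i \<in> V) \<and> P V E (\<lambda>i. if i < l then t i else s (i - l)))"
proof (induction l)
  case 0
  then show ?case using assms by simp
next
  case (Suc l)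
  define Q where "Q = (\<lambda>V E s. \<exists>t. (\<forall>i<l. t i \<in> V) \<and> P V E (\<lambda>i. if i < l then t i else s (i - l)))"
  have "case_nat (s 0) (\<lambda>i. s (Suc i)) = s" for s :: "nat \<Rightarrow> nat"
    by (auto simp: fun_eq_iff split: nat.splits)
  then have "definable (\<lambda>V E s. Q V E (case_nat (s 0) (\<lambda>i. s (Suc i))))"
    using Suc by (simp add: Q_def)
  then have "definable (\<lambda>V E s. \<exists>v\<in>V. Q V E (case_nat v s))"
    by (rule definable_ex)
  moreover have "(\<exists>v\<in>V. Q V E (case_nat v s)) \<longleftrightarrow>
    (\<exists>t. (\<forall>i<Suc l. t i \<in> V) \<and> P V E (\<lambda>i. if i < Suc l then t i else s (i - Suc l)))" for V E s
  proof
    assume "\<exists>v\<in>V. Q V E (case_nat v s)"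
    then obtain v t where vt: "v \<in> V" "\<forall>i<l. t i \<in> V" "P V E (\<lambda>i. if i < l then t i else case_nat v s (i - l))"
      by (auto simp: Q_def)
    have "(\<lambda>i. if i < l then t i else case_nat v s (i - l)) =
        (\<lambda>i. if i < Suc l then (t(l := v)) i else s (i - Suc l))"
    proof
      fix i
      show "(if i < l then t i else case_nat v s (i - l)) = (if i < Suc l then (t(l := v)) i else s (i - Suc l))"
        by (cases "i < l"; cases "i = l") (auto split: nat.split simp: diff_Suc)
    qed
    then show "\<exists>t. (\<forall>i<Suc l. t i \<in> V) \<and> P V E (\<lambda>i. if i < Suc l then t i else s (i - Suc l))"
      using vt by (intro exI[of _ "t(l := v)"]) (auto simp: less_Suc_eq)
  next
    assume "\<exists>t. (\<forall>i<Suc l. t i \<in> V) \<and> P V E (\<lambda>i. if i < Suc l then t i else s (i - Suc l))"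
    then obtain t where t: "\<forall>i<Suc l. t i \<in> V" "P V E (\<lambda>i. if i < Suc l then t i else s (i - Suc l))" by blast
    have "(\<lambda>i. if i < Suc l then t i else s (i - Suc l)) =
      (\<lambda>i. if i < l then t i else case_nat (t l) s (i - l))"
    proof
      fix i
      show "(if i < Suc l then t i else s (i - Suc l)) = (if i < l then t i else case_nat (t l) s (i - l))"
        by (cases "i < l"; cases "i = l") (auto split: nat.split simp: diff_Suc)
    qed
    then have "Q V E (case_nat (t l) s)" using t unfolding Q_def by (intro exI[of _ t]) auto
    then show "\<exists>v\<in>V. Q V E (case_nat v s)" using t(1) by blast
  qed
  ultimately show ?case by simp
qed

text \<open>The defining formula may still have free variables. All are renamed to 0 and bound; on a
  nonempty V this changes nothing because P ignores the assignment.\<close>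

lemma definable_sentence:
  assumes "definable (\<lambda>V E s. P V E)"
  shows "\<exists>\<phi>. sentence \<phi> \<and> (\<forall>V E. V \<noteq> {} \<longrightarrow> (models V E \<phi> \<longleftrightarrow> P V E))"
proof -
  from assms obtain \<phi> where \<phi>: "\<And>V E s. sat V E s \<phi> \<longleftrightarrow> P V E" by (auto simp: definable_def)
  from ex_renaming[of "\<lambda>_. 0" \<phi>] obtain \<phi>' where \<phi>': "free_vars \<phi>' \<subseteq> {0}"
    "\<forall>V E s. sat (V :: nat set) E s \<phi>' \<longleftrightarrow> sat V E (\<lambda>i. s 0) \<phi>" by blast
  have "sentence (Ex 0 \<phi>')" using \<phi>'(1) by (auto simp: sentence_def)
  moreover have "models V E (Ex 0 \<phi>') \<longleftrightarrow> P V E" if "V \<noteq> {}" for V E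
    using that \<phi> \<phi>'(2) by (auto simp: models_def)
  ultimately show ?thesis by blast
qed

section \<open>Definability of the codes\<close>

lemma definable_mem: "definable (\<lambda>V E s. s i \<in> V)"
proof -
  have "definable (\<lambda>V E s. \<exists>v\<in>V. v = s i)" by (intro definable_ex definable_eq)
  then show ?thesis by simp
qed

lemma step_subset: "A \<subseteq> V \<Longrightarrow> step a b V E j q A \<subseteq> V"
  by (auto simp: step_def nbrs_def)

lemma run_subset: "A \<subseteq> V \<Longrightarrow> run a b V E Q A i m \<subseteq> V"
  by (induction m) (auto dest: step_subset)

text \<open>Parameters and starting set carry separate, arbitrary renamings so that the induction
  hypothesis still applies under a quantifier, where all indices are shifted.\<close>

lemma definable_run:
  assumes sub: "\<And>V E s. A V E s \<subseteq> V" and def: "\<And>u \<pi>. definable (\<lambda>V E s. s u \<in> A V E (\<lambda>i. s (\<pi> i)))"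
  shows "definable (\<lambda>V E s. s u \<in> run a b V E (\<lambda>i. s (\<rho> i)) (A V E (\<lambda>i. s (\<pi> i))) k m)"
proof (induction m arbitrary: u \<rho> \<pi>)
  case 0
  then show ?case by (simp add: def)
next
  case (Suc m)
  show ?case
  proof (cases "rot a b (k + m) < a")
    case True
    have "definable (\<lambda>V E s. s u \<in> V \<and>
        (\<exists>v\<in>run a b V E (\<lambda>i. s (\<rho> i)) (A V E (\<lambda>i. s (\<pi> i))) k m. {s u, v} \<in> E))"
      by (intro definable_conj definable_mem definable_Bex definable_adj run_subset sub) (rule Suc.IH)
    then show ?thesis using True by (simp add: step_def nbrs_def)
  next
    case False
    have "definable (\<lambda>V E s. s u \<in> run a b V E (\<lambda>i. s (\<rho> i)) (A V E (\<lambda>i. s (\<pi> i))) k m \<and> {s u, s (\<rho> (k + m))} \<in> E)"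
      by (intro definable_conj definable_adj) (rule Suc.IH)
    then show ?thesis using False by (simp add: step_def)
  qed
qed

lemma vset_subset: "vset a b V E e x \<subseteq> V"
  unfolding vset_def by (rule run_subset) auto

lemma definable_vset: "definable (\<lambda>V E s. s u \<in> vset a b V E (\<lambda>i. s (\<pi> i)) (s x))"
proof -
  have "definable (\<lambda>V E s. s u \<in> run a b V E (\<lambda>i. s (\<rho> i)) ({(\<lambda>i. s (\<sigma> i)) 0} \<inter> V) 0 (b - 1))" for u \<rho> \<sigma>
    by (rule definable_run[where A = "\<lambda>V E s. {s 0} \<inter> V"])
      (auto intro!: definable_conj definable_eq definable_mem)
  from this[of u \<pi> "\<lambda>_. x"] show ?thesis by (simp add: vset_def)
qed

lemma definable_pset: "definable (\<lambda>V E s. s u \<in> pset a b V E (\<lambda>i. s (\<pi> i)) (s x) (s y))"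
proof -
  \<comment> \<open>x, y and the code share one assignment: x and y sit at indices 0 and 1, the code
    starts at 2.\<close>
  let ?A = "\<lambda>V E s. {u \<in> {u \<in> V. u \<in> nbrs V E (vset a b V E (\<lambda>i. s (i + 2)) (s 0)) \<and>
    u \<in> nbrs V E (vset a b V E (\<lambda>i. s (i + 2)) (s 1))}. {u, s (b + 2)} \<in> E}"
  have "definable (\<lambda>V E s. s u \<in> run a b V E (\<lambda>i. s (\<rho> i)) (?A V E (\<lambda>i. s (\<sigma> i))) 1 (b - 2))" for u \<rho> \<sigma>
  proof (rule definable_run)
    show "definable (\<lambda>V E s. s u \<in> ?A V E (\<lambda>i. s (\<pi> i)))" for u \<pi>
      unfolding nbrs_def mem_Collect_eq
      by (intro definable_conj definable_mem definable_Bex definable_adj vset_subset definable_vset)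
  qed auto
  from this[of u "\<lambda>i. \<pi> (b + i)" "\<lambda>i. if i = 0 then x else if i = 1 then y else \<pi> (i - 2)"]
  show ?thesis by (simp add: pset_def)
qed

lemma definable_coded1: "definable (\<lambda>V E s. coded1 a b V E (\<lambda>i. s (\<pi> i)) (s x))"
  unfolding coded1_def by (intro definable_ex definable_conj definable_vset definable_adj)

lemma definable_coded2: "definable (\<lambda>V E s. coded2 a b V E (\<lambda>i. s (\<pi> i)) (s x) (s y))"
  unfolding coded2_def by (intro definable_ex definable_conj definable_pset definable_adj)

lemma definable_coded_dom: "definable (\<lambda>V E s. s u \<in> coded_dom a b V E (\<lambda>i. s (\<pi> i)))"
  unfolding coded_dom_def mem_Collect_eq by (intro definable_conj definable_mem definable_vset definable_adj)

section \<open>Certificates for tower numbers\<close>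

text \<open>These are the sizes 0, 1, 2, 4, 16, ... of the finite levels of the cumulative hierarchy
  of sets; each level is the power set of the previous one.\<close>

primrec tow :: "nat \<Rightarrow> nat" where
  "tow 0 = 0"
| "tow (Suc k) = 2 ^ tow k"

lemma strict_mono_tow: "strict_mono tow"
  by (rule strict_mono_Suc_iff[THEN iffD2]) simp

lemma tow_less_iff [simp]: "tow i < tow j \<longleftrightarrow> i < j"
  by (rule strict_mono_less[OF strict_mono_tow])

text \<open>With R read as membership, y is a subset of m.\<close>

definition below :: "'s set \<Rightarrow> ('s \<Rightarrow> 's \<Rightarrow> bool) \<Rightarrow> 's \<Rightarrow> 's \<Rightarrow> bool" where
  "below S R y m \<longleftrightarrow> (\<forall>z\<in>S. R z y \<longrightarrow> R z m)"

text \<open>Marked elements are recognised by carrying some label, so no further predicate has to be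
  coded for them.\<close>

definition mark :: "nat \<Rightarrow> (nat \<Rightarrow> 's \<Rightarrow> bool) \<Rightarrow> 's \<Rightarrow> bool" where
  "mark q lab m \<longleftrightarrow> (\<exists>c<q. lab c m)"

text \<open>A finite axiomatisation of a level of the cumulative hierarchy, with R as membership and
  the marks as the earlier levels. In order: extensionality; the marks are strictly linearly ordered
  by R; a mark contains exactly the subsets of earlier marks; every element is a subset of a mark;
  the empty set exists; elements of a mark can be adjoined to its subsets. The remaining clauses
  make the labels count the marks modulo q from 1 on and end with r.\<close>

definition tower_struct :: "nat \<Rightarrow> nat \<Rightarrow> 's set \<Rightarrow> ('s \<Rightarrow> 's \<Rightarrow> bool) \<Rightarrow> (nat \<Rightarrow> 's \<Rightarrow> bool) \<Rightarrow> bool" where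
  "tower_struct q r S R lab \<longleftrightarrow>
    (\<forall>x\<in>S. \<forall>y\<in>S. (\<forall>z\<in>S. R z x \<longleftrightarrow> R z y) \<longrightarrow> x = y) \<and>
    (\<forall>m\<in>S. mark q lab m \<longrightarrow> \<not> R m m) \<and>
    (\<forall>m\<in>S. \<forall>m'\<in>S. \<forall>m''\<in>S. mark q lab m \<and> mark q lab m' \<and> mark q lab m'' \<and> R m m' \<and> R m' m'' \<longrightarrow> R m m'') \<and>
    (\<forall>m\<in>S. \<forall>m'\<in>S. mark q lab m \<and> mark q lab m' \<longrightarrow> m = m' \<or> R m m' \<or> R m' m) \<and>
    (\<forall>m\<in>S. \<forall>y\<in>S. mark q lab m \<longrightarrow> (R y m \<longleftrightarrow> (\<exists>m'\<in>S. mark q lab m' \<and> R m' m \<and> below S R y m'))) \<and>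
    (\<forall>y\<in>S. \<exists>m\<in>S. mark q lab m \<and> below S R y m) \<and>
    (\<exists>y\<in>S. \<forall>z\<in>S. \<not> R z y) \<and>
    (\<forall>m\<in>S. \<forall>y\<in>S. \<forall>x\<in>S. mark q lab m \<and> below S R y m \<and> R x m \<longrightarrow> (\<exists>y'\<in>S. \<forall>z\<in>S. R z y' \<longleftrightarrow> R z y \<or> z = x)) \<and>
    (\<forall>m\<in>S. \<forall>c<q. \<forall>c'<q. lab c m \<and> lab c' m \<longrightarrow> c = c') \<and>
    (\<forall>m\<in>S. mark q lab m \<and> (\<forall>m'\<in>S. mark q lab m' \<longrightarrow> \<not> R m' m) \<longrightarrow> lab (1 mod q) m) \<and>
    (\<forall>m\<in>S. \<forall>m'\<in>S. mark q lab m \<and> mark q lab m' \<and> R m m' \<and>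
        \<not> (\<exists>m''\<in>S. mark q lab m'' \<and> R m m'' \<and> R m'' m') \<longrightarrow> (\<forall>c<q. lab c m \<longrightarrow> lab (Suc c mod q) m')) \<and>
    (\<exists>m\<in>S. mark q lab m \<and> (\<forall>m'\<in>S. mark q lab m' \<longrightarrow> \<not> R m m') \<and> lab r m)"

text \<open>Adjunction to the empty set produces all subsets of a mark, since S is finite, and
  extensionality keeps them distinct. The next mark consists of exactly these subsets, so the sizes
  of the marks run through the values of \<open>tow\<close>, and S is the power set of the last
  mark.\<close>

lemma tower_struct_sound:
  assumes T: "tower_struct q r S R lab" and fin: "finite S" and q: "0 < q" and r: "r < q"
  shows "\<exists>k. card S = tow k \<and> k mod q = r"
proof -
  define M where "M = {m\<in>S. mark q lab m}"
  define ext where "ext y = {z\<in>S. R z y}" for y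
  define rank where "rank m = card {m'\<in>M. R m' m}" for m
  note D = T[unfolded tower_struct_def]
  have extS: "x = y" if "x \<in> S" "y \<in> S" "ext x = ext y" for x y
    using D[THEN conjunct1] that unfolding ext_def by blast
  note D1 = D[THEN conjunct2]
  have irr: "\<not> R m m" if "m \<in> M" for m
    using D1[THEN conjunct1] that unfolding M_def by blast
  note D2 = D1[THEN conjunct2]
  have trans: "R m m''" if "m \<in> M" "m' \<in> M" "m'' \<in> M" "R m m'" "R m' m''" for m m' m''
    using D2[THEN conjunct1] that unfolding M_def by blast
  note D3 = D2[THEN conjunct2]
  have tot: "m = m' \<or> R m m' \<or> R m' m" if "m \<in> M" "m' \<in> M" for m m'
    using D3[THEN conjunct1] that unfolding M_def by blast
  note D4 = D3[THEN conjunct2]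
  have below: "below S R y m \<longleftrightarrow> ext y \<subseteq> ext m" for y m
    unfolding below_def ext_def by blast
  have down: "R y m \<longleftrightarrow> (\<exists>m'\<in>M. R m' m \<and> ext y \<subseteq> ext m')" if "m \<in> M" "y \<in> S" for m y
    using D4[THEN conjunct1] that unfolding M_def below by blast
  note D5 = D4[THEN conjunct2]
  have all: "\<exists>m\<in>M. ext y \<subseteq> ext m" if "y \<in> S" for y
    using D5[THEN conjunct1] that unfolding M_def below by blast
  note D6 = D5[THEN conjunct2]
  have emp: "\<exists>y\<in>S. ext y = {}"
    using D6[THEN conjunct1] unfolding ext_def by blast
  note D7 = D6[THEN conjunct2]
  have adj: "\<exists>y'\<in>S. ext y' = insert x (ext y)" if "m \<in> M" "y \<in> S" "ext y \<subseteq> ext m" "x \<in> ext m" for m y x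
  proof -
    note hyps = that
    have "x \<in> S" "R x m" using that unfolding ext_def by auto
    then obtain y' where "y' \<in> S" "\<forall>z\<in>S. R z y' \<longleftrightarrow> R z y \<or> z = x"
      using D7[THEN conjunct1, rule_format, of m y x] hyps \<open>x \<in> S\<close> \<open>R x m\<close> by (auto simp: M_def below)
    then show ?thesis using \<open>x \<in> S\<close> unfolding ext_def by blast
  qed
  note D8 = D7[THEN conjunct2]
  have lab_unique: "c = c'" if "m \<in> S" "c < q" "c' < q" "lab c m" "lab c' m" for m c c'
    using D8[THEN conjunct1] that by blast
  note D9 = D8[THEN conjunct2]
  have lab0: "lab (1 mod q) m" if "m \<in> M" "\<And>m'. m' \<in> M \<Longrightarrow> \<not> R m' m" for m
    using D9[THEN conjunct1] that unfolding M_def by blast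
  note D10 = D9[THEN conjunct2]
  have labS: "lab (Suc c mod q) m'"
    if "m \<in> M" "m' \<in> M" "R m m'" "\<And>m''. m'' \<in> M \<Longrightarrow> R m m'' \<Longrightarrow> \<not> R m'' m'" "c < q" "lab c m" for m m' c
    using D10[THEN conjunct1] that unfolding M_def by blast
  have top: "\<exists>m\<in>M. (\<forall>m'\<in>M. \<not> R m m') \<and> lab r m"
    using D10[THEN conjunct2] unfolding M_def by blast
  have MS: "M \<subseteq> S" unfolding M_def by blast
  have finM: "finite M" using fin MS finite_subset by blast
  have ext_mono: "ext m \<subseteq> ext m'" if "m \<in> M" "m' \<in> M" "R m m'" for m m'
  proof
    note hyps = that
    fix z assume z: "z \<in> ext m"
    then have "z \<in> S" by (simp add: ext_def)
    then obtain m'' where "m'' \<in> M" "R m'' m" "ext z \<subseteq> ext m''"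
      using z down[OF hyps(1)] by (auto simp: ext_def)
    then have "R z m'" using down[OF that(2) \<open>z \<in> S\<close>] trans that by blast
    then show "z \<in> ext m'" using \<open>z \<in> S\<close> by (simp add: ext_def)
  qed
  have pow: "card {y\<in>S. ext y \<subseteq> ext m} = 2 ^ card (ext m)" if m: "m \<in> M" for m
  proof -
    have fe: "finite (ext m)" using fin by (simp add: ext_def)
    have "\<exists>y\<in>S. ext y = A" if "A \<subseteq> ext m" for A
    proof -
      have "finite A" using that fe by (rule finite_subset)
      then show ?thesis using that
      proof (induction A rule: finite_induct)
        case empty
        then show ?case using emp by simp
      next
        case (insert x A)
        then obtain y where "y \<in> S" "ext y = A" by auto
        then show ?case using adj[OF m, of y x] insert.prems by auto
      qed
    qed
    then have "ext ` {y\<in>S. ext y \<subseteq> ext m} = Pow (ext m)" by blast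
    moreover have "inj_on ext {y\<in>S. ext y \<subseteq> ext m}"
      using extS by (auto intro: inj_onI)
    ultimately show ?thesis using card_image card_Pow[OF fe] by metis
  qed
  have main: "\<forall>m\<in>M. rank m = k \<longrightarrow> card (ext m) = tow k \<and> (\<forall>c<q. lab c m \<longrightarrow> c = Suc k mod q)" for k
  proof (induction k)
    case 0
    show ?case
    proof (intro ballI impI)
      fix m assume m: "m \<in> M" "rank m = 0"
      then have no: "\<not> R m' m" if "m' \<in> M" for m'
        using that finM by (auto simp: rank_def)
      have "ext m = {}" using no down[OF m(1)] by (auto simp: ext_def)
      moreover have "lab (1 mod q) m" by (rule lab0[OF m(1) no])
      then have "\<forall>c<q. lab c m \<longrightarrow> c = Suc 0 mod q"
        using lab_unique[of m _ "1 mod q"] m(1) MS q by auto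
      ultimately show "card (ext m) = tow 0 \<and> (\<forall>c<q. lab c m \<longrightarrow> c = Suc 0 mod q)" by simp
    qed
  next
    case (Suc k)
    show ?case
    proof (intro ballI impI)
      fix m assume m: "m \<in> M" "rank m = Suc k"
      let ?A = "{m'\<in>M. R m' m}"
      have "finite ?A" using finM by simp
      moreover have "?A \<noteq> {}" using m(2) unfolding rank_def by (metis card.empty nat.distinct(1))
      ultimately have "Max (rank ` ?A) \<in> rank ` ?A" by (intro Max_in) auto
      then obtain m1 where m1': "m1 \<in> ?A" "rank m1 = Max (rank ` ?A)" by auto
      have m1: "m1 \<in> M" "R m1 m" using m1'(1) by auto
      have max: "\<not> rank m1 < rank m'" if "m' \<in> M" "R m' m" for m'
        unfolding m1'(2) not_less using that \<open>finite ?A\<close> by (intro Max_ge) auto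
      have nobetween: "\<not> R m1 m'" if "m' \<in> M" "R m' m" for m'
      proof
        assume R: "R m1 m'"
        have "{x\<in>M. R x m1} \<subset> {x\<in>M. R x m'}"
          using R trans[OF _ m1(1) that(1)] irr[OF m1(1)] m1(1) by blast
        then have "rank m1 < rank m'" unfolding rank_def using finM by (intro psubset_card_mono) auto
        then show False using max that by blast
      qed
      have "?A = insert m1 {m'\<in>M. R m' m1}"
        using nobetween tot m1 trans m(1) by blast
      then have "rank m = Suc (rank m1)"
        unfolding rank_def using finM irr[OF m1(1)] by simp
      then have r1: "rank m1 = k" using m(2) by simp
      \<comment> \<open>Elements of m are subsets of earlier marks, and m1 is the largest of
        these.\<close>
      have em: "ext m = {y\<in>S. ext y \<subseteq> ext m1}"
      proof (intro set_eqI iffI)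
        fix y assume y: "y \<in> ext m"
        then have "y \<in> S" by (simp add: ext_def)
        then obtain m' where m': "m' \<in> M" "R m' m" "ext y \<subseteq> ext m'"
          using y down[OF m(1) \<open>y \<in> S\<close>] by (auto simp: ext_def)
        then have "m' = m1 \<or> R m' m1" using nobetween tot[OF m'(1) m1(1)] by blast
        then have "ext m' \<subseteq> ext m1" using ext_mono m'(1) m1(1) by blast
        then show "y \<in> {y\<in>S. ext y \<subseteq> ext m1}" using m'(3) \<open>y \<in> S\<close> by blast
      next
        fix y assume "y \<in> {y\<in>S. ext y \<subseteq> ext m1}"
        then show "y \<in> ext m" using down[OF m(1)] m1 by (auto simp: ext_def)
      qed
      have IH: "card (ext m1) = tow k" "\<And>c. c < q \<Longrightarrow> lab c m1 \<Longrightarrow> c = Suc k mod q"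
        using Suc.IH m1(1) r1 by auto
      obtain c1 where c1: "c1 < q" "lab c1 m1" using m1(1) by (auto simp: M_def mark_def)
      have "lab (Suc c1 mod q) m"
        by (rule labS[OF m1(1) m(1) m1(2) _ c1]) (use nobetween in blast)
      moreover have "Suc c1 mod q = Suc (Suc k) mod q"
        using IH(2)[OF c1] by (simp add: mod_Suc_eq)
      ultimately have "\<forall>c<q. lab c m \<longrightarrow> c = Suc (Suc k) mod q"
        using lab_unique[of m _ "Suc c1 mod q"] m(1) MS q by auto
      then show "card (ext m) = tow (Suc k) \<and> (\<forall>c<q. lab c m \<longrightarrow> c = Suc (Suc k) mod q)"
        using IH(1) pow[OF m1(1)] em by simp
    qed
  qed
  obtain m where m: "m \<in> M" "\<And>m'. m' \<in> M \<Longrightarrow> \<not> R m m'" "lab r m" using top by blast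
  have "ext y \<subseteq> ext m" if y: "y \<in> S" for y
  proof -
    obtain m' where "m' \<in> M" "ext y \<subseteq> ext m'" using all[OF y] by blast
    moreover have "m' = m \<or> R m' m" using tot[OF \<open>m' \<in> M\<close> m(1)] m(2)[OF \<open>m' \<in> M\<close>] by blast
    ultimately show ?thesis using ext_mono m(1) by blast
  qed
  then have "S = {y\<in>S. ext y \<subseteq> ext m}" by blast
  then have "card S = 2 ^ card (ext m)" using pow[OF m(1)] by simp
  then have "card S = tow (Suc (rank m))" using main m(1) by simp
  moreover have "Suc (rank m) mod q = r" using main m r by blast
  ultimately show ?thesis by blast
qed

section \<open>Natural numbers as hereditarily finite sets\<close>

lemma bit_nat_less: "bit y x \<Longrightarrow> x < k" if "y < 2 ^ k" for x y k :: nat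
proof (rule ccontr)
  assume b: "bit y x" and "\<not> x < k"
  then have "(2::nat) ^ k \<le> 2 ^ x" by (simp add: power_increasing)
  then have "y < 2 ^ x" using that by linarith
  then have "y div 2 ^ x = 0" by simp
  then show False using b by (simp add: bit_iff_odd)
qed

lemma less_power_iff_bit: "y < 2 ^ k \<longleftrightarrow> (\<forall>x. bit y x \<longrightarrow> x < k)" for y k :: nat
proof
  assume "\<forall>x. bit y x \<longrightarrow> x < k"
  then have "take_bit k y = y" by (intro bit_eqI) (auto simp: bit_take_bit_iff)
  then show "y < 2 ^ k" by (simp add: take_bit_nat_eq_self_iff)
qed (auto intro: bit_nat_less)

lemma bit_mask_nat: "bit (2 ^ k - 1 :: nat) x \<longleftrightarrow> x < k"
  using bit_mask_iff[of k x, where ?'a = nat] by (simp add: mask_eq_exp_minus_1)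

text \<open>Ackermann's coding: x is an element of y if bit x of y is set. The numbers below tow h
  then form level h of the hierarchy, and 2 ^ tow j - 1 codes the set of all numbers below tow j,
  that is, level j as an element. Its label refers to Suc j, the level formed by its
  subsets.\<close>

lemma tower_struct_bit:
  assumes h: "0 < h" and q: "0 < q"
  shows "tower_struct q (h mod q) {..<tow h} (\<lambda>x y. bit y x)
    (\<lambda>c m. \<exists>j<h. m = 2 ^ tow j - 1 \<and> c = Suc j mod q)"
proof -
  define mk where "mk j = (2 ^ tow j - 1 :: nat)" for j
  define lab where "lab = (\<lambda>c m. \<exists>j<h. m = mk j \<and> c = Suc j mod q)"
  have bmk: "bit (mk j) x \<longleftrightarrow> x < tow j" for j x
    unfolding mk_def by (rule bit_mask_nat)
  have mk_less: "mk i < tow j \<longleftrightarrow> i < j" for i j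
  proof -
    have "mk i < tow j \<longleftrightarrow> tow (Suc i) \<le> tow j"
    proof -
      have "(0::nat) < 2 ^ tow i" by simp
      then show ?thesis unfolding mk_def tow.simps by linarith
    qed
    also have "\<dots> \<longleftrightarrow> i < j" using tow_less_iff[of j "Suc i"] by (auto simp: not_less[symmetric] simp del: tow.simps)
    finally show ?thesis .
  qed
  have mk_inj: "mk i = mk j \<longleftrightarrow> i = j" for i j
    using mk_less[of i j] mk_less[of i "Suc j"] mk_less[of j i] mk_less[of j "Suc i"] mk_less[of i i] mk_less[of j j]
    by (metis less_Suc_eq linorder_neq_iff)
  have mark: "mark q lab m \<longleftrightarrow> (\<exists>j<h. m = mk j)" for m
    unfolding mark_def lab_def using mod_less_divisor[OF q] by blast
  have small: "x < tow h" if "bit y x" "y < tow h" for x y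
  proof -
    have "y < 2 ^ y" by simp
    then have "x < y" using that(1) bit_nat_less by blast
    then show ?thesis using that(2) by simp
  qed
  have below: "below {..<tow h} (\<lambda>x y. bit y x) y (mk j) \<longleftrightarrow> y < tow (Suc j)" if "y \<in> {..<tow h}" for y j
    using small[of y] that unfolding below_def bmk tow.simps less_power_iff_bit Ball_def lessThan_iff by blast
  have step: "y < tow j \<longleftrightarrow> (\<exists>i<j. y < tow (Suc i))" for y j
  proof
    assume y: "y < tow j"
    then obtain i where "j = Suc i" by (cases j) auto
    then show "\<exists>i<j. y < tow (Suc i)" using y by blast
  next
    assume "\<exists>i<j. y < tow (Suc i)"
    then obtain i where "i < j" "y < tow (Suc i)" by blast
    moreover have "tow (Suc i) \<le> tow j"
      using \<open>i < j\<close> tow_less_iff[of j "Suc i"] by (simp add: not_less[symmetric] del: tow.simps)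
    ultimately show "y < tow j" by linarith
  qed
  have mkS: "mk j \<in> {..<tow h} \<longleftrightarrow> j < h" for j by (simp add: mk_less)
  let ?S = "{..<tow h}" and ?R = "\<lambda>x y :: nat. bit y x"
  have "tower_struct q (h mod q) ?S ?R lab"
    unfolding tower_struct_def mark
  proof (intro conjI)
    show "\<forall>x\<in>?S. \<forall>y\<in>?S. (\<forall>z\<in>?S. bit x z = bit y z) \<longrightarrow> x = y"
      using small by (auto intro!: bit_eqI)
    show "\<forall>m\<in>?S. (\<exists>j<h. m = mk j) \<longrightarrow> \<not> bit m m"
      by (auto simp: bmk mk_less)
    show "\<forall>m\<in>?S. \<forall>m'\<in>?S. \<forall>m''\<in>?S.
        (\<exists>j<h. m = mk j) \<and> (\<exists>j<h. m' = mk j) \<and> (\<exists>j<h. m'' = mk j) \<and> bit m' m \<and> bit m'' m' \<longrightarrow> bit m'' m"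
      by (auto simp: bmk mk_less)
    show "\<forall>m\<in>?S. \<forall>m'\<in>?S. (\<exists>j<h. m = mk j) \<and> (\<exists>j<h. m' = mk j) \<longrightarrow> m = m' \<or> bit m' m \<or> bit m m'"
      by (auto simp: bmk mk_less mk_inj)
    show "\<forall>m\<in>?S. \<forall>y\<in>?S. (\<exists>j<h. m = mk j) \<longrightarrow>
        bit m y = (\<exists>m'\<in>?S. (\<exists>j<h. m' = mk j) \<and> bit m m' \<and> below ?S ?R y m')"
    proof (intro ballI impI)
      fix m y assume y: "y \<in> ?S" and "\<exists>j<h. m = mk j"
      then obtain j where j: "j < h" "m = mk j" by blast
      have "(\<exists>m'\<in>?S. (\<exists>j<h. m' = mk j) \<and> bit m m' \<and> below ?S ?R y m')
          \<longleftrightarrow> (\<exists>i<j. y < tow (Suc i))"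
      proof
        assume "\<exists>m'\<in>?S. (\<exists>j<h. m' = mk j) \<and> bit m m' \<and> below ?S ?R y m'"
        then obtain i where i: "bit m (mk i)" "below ?S ?R y (mk i)" by blast
        have "i < j" using i(1) j by (simp add: bmk mk_less)
        moreover have "y < tow (Suc i)" using i(2) below[of y i] y by blast
        ultimately show "\<exists>i<j. y < tow (Suc i)" by blast
      next
        assume "\<exists>i<j. y < tow (Suc i)"
        then obtain i where i: "i < j" "y < tow (Suc i)" by blast
        then have "bit m (mk i)" "mk i \<in> ?S" "i < h" using j mkS[of i] by (simp_all add: bmk mk_less)
        moreover have "below ?S ?R y (mk i)" using i(2) below[of y i] y by blast
        ultimately show "\<exists>m'\<in>?S. (\<exists>j<h. m' = mk j) \<and> bit m m' \<and> below ?S ?R y m'"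
          by (intro bexI[of _ "mk i"] conjI exI[of _ i]) simp_all
      qed
      also have "\<dots> \<longleftrightarrow> bit m y" unfolding j(2) bmk by (rule step[of y j, symmetric])
      finally show "bit m y = (\<exists>m'\<in>?S. (\<exists>j<h. m' = mk j) \<and> bit m m' \<and> below ?S ?R y m')" by simp
    qed
    obtain h' where h': "h = Suc h'" using h by (cases h) auto
    show "\<forall>y\<in>?S. \<exists>m\<in>?S. (\<exists>j<h. m = mk j) \<and> below ?S ?R y m"
    proof
      fix y assume "y \<in> ?S"
      then show "\<exists>m\<in>?S. (\<exists>j<h. m = mk j) \<and> below ?S ?R y m"
        using h' below[of y h'] mkS[of h'] by (intro bexI[of _ "mk h'"]) (auto simp del: tow.simps)
    qed
    show "\<exists>y\<in>?S. \<forall>z\<in>?S. \<not> bit y z"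
      using h' by (intro bexI[of _ 0]) auto
    show "\<forall>m\<in>?S. \<forall>y\<in>?S. \<forall>x\<in>?S. (\<exists>j<h. m = mk j) \<and> below ?S ?R y m \<and> bit m x \<longrightarrow>
        (\<exists>y'\<in>?S. \<forall>z\<in>?S. bit y' z = (bit y z \<or> z = x))"
    proof (intro ballI impI, elim conjE)
      fix m y x assume y: "y \<in> ?S" and x: "x \<in> ?S" and m: "\<exists>j<h. m = mk j"
        and b: "below ?S ?R y m" "bit m x"
      obtain j where j: "j < h" "m = mk j" using m by blast
      have y2: "y < 2 ^ tow j" using b(1) below[of y j] y j by simp
      have x2: "x < tow j" using b(2) j by (simp add: bmk)
      \<comment> \<open>Setting a bit is adjunction of an element.\<close>
      let ?y = "set_bit x y"
      have bity: "bit ?y z \<longleftrightarrow> bit y z \<or> z = x" for z by (auto simp: bit_set_bit_iff)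
      have "?y < 2 ^ tow j" using y2 x2 by (auto simp: less_power_iff_bit bity)
      then have "?y < tow (Suc j)" by simp
      also have "tow (Suc j) \<le> tow h"
        using j tow_less_iff[of h "Suc j"] by (simp add: not_less[symmetric] del: tow.simps)
      finally show "\<exists>y'\<in>?S. \<forall>z\<in>?S. bit y' z = (bit y z \<or> z = x)"
        using bity by (intro bexI[of _ ?y]) auto
    qed
    show "\<forall>m\<in>?S. \<forall>c<q. \<forall>c'<q. lab c m \<and> lab c' m \<longrightarrow> c = c'"
      by (auto simp: lab_def mk_inj)
    show "\<forall>m\<in>?S. (\<exists>j<h. m = mk j) \<and> (\<forall>m'\<in>?S. (\<exists>j<h. m' = mk j) \<longrightarrow> \<not> bit m m') \<longrightarrow> lab (1 mod q) m"
    proof (intro ballI impI, elim conjE)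
      fix m assume "\<exists>j<h. m = mk j" and no: "\<forall>m'\<in>?S. (\<exists>j<h. m' = mk j) \<longrightarrow> \<not> bit m m'"
      then obtain j where j: "j < h" "m = mk j" by blast
      have "\<not> bit m (mk 0)" using no mkS[of 0] h by blast
      then have "j = 0" using j by (simp add: bmk mk_less)
      then show "lab (1 mod q) m" using j by (auto simp: lab_def)
    qed
    show "\<forall>m\<in>?S. \<forall>m'\<in>?S. (\<exists>j<h. m = mk j) \<and> (\<exists>j<h. m' = mk j) \<and> bit m' m \<and>
        \<not> (\<exists>m''\<in>?S. (\<exists>j<h. m'' = mk j) \<and> bit m'' m \<and> bit m' m'') \<longrightarrow> (\<forall>c<q. lab c m \<longrightarrow> lab (Suc c mod q) m')"
    proof (intro ballI impI allI, elim conjE)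
      fix m m' c assume "\<exists>j<h. m = mk j" "\<exists>j<h. m' = mk j" and b: "bit m' m"
        and no: "\<not> (\<exists>m''\<in>?S. (\<exists>j<h. m'' = mk j) \<and> bit m'' m \<and> bit m' m'')" and c: "lab c m"
      then obtain i j where ij: "i < h" "j < h" "m = mk i" "m' = mk j" by blast
      have "i < j" using b ij by (simp add: bmk mk_less)
      have "\<not> (bit (mk (Suc i)) m \<and> bit m' (mk (Suc i)))" if "Suc i < h" using no mkS[of "Suc i"] that by blast
      then have "j = Suc i" using \<open>i < j\<close> ij by (auto simp: bmk mk_less simp del: tow.simps)
      moreover have "c = Suc i mod q" using c ij by (auto simp: lab_def mk_inj)
      ultimately show "lab (Suc c mod q) m'" using ij by (auto simp: lab_def mod_Suc_eq)
    qed
    show "\<exists>m\<in>?S. (\<exists>j<h. m = mk j) \<and> (\<forall>m'\<in>?S. (\<exists>j<h. m' = mk j) \<longrightarrow> \<not> bit m' m) \<and> lab (h mod q) m"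
      using h' mkS[of h'] by (intro bexI[of _ "mk h'"]) (auto simp: bmk mk_less lab_def simp del: tow.simps)
  qed
  then show ?thesis unfolding lab_def mk_def .
qed

lemma tower_struct_image:
  assumes "inj_on f A"
  shows "tower_struct q r (f ` A) R lab \<longleftrightarrow> tower_struct q r A (\<lambda>x y. R (f x) (f y)) (\<lambda>c x. lab c (f x))"
proof -
  have eq: "f x = f y \<longleftrightarrow> x = y" if "x \<in> A" "y \<in> A" for x y using assms that by (auto dest: inj_onD)
  have mark: "mark q lab (f x) \<longleftrightarrow> mark q (\<lambda>c x. lab c (f x)) x" for x
    by (simp add: mark_def)
  have below: "below (f ` A) R (f y) (f m) \<longleftrightarrow> below A (\<lambda>x y. R (f x) (f y)) y m" for y m
    by (simp add: below_def)
  show ?thesis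
    unfolding tower_struct_def Set.bex_simps(7) Set.ball_simps(9) mark below
    by (simp only: eq cong: ball_cong)
qed

lemma tower_struct_cong:
  assumes R: "\<And>x y. x \<in> A \<Longrightarrow> y \<in> A \<Longrightarrow> R x y \<longleftrightarrow> R' x y"
    and lab: "\<And>c x. c < q \<Longrightarrow> x \<in> A \<Longrightarrow> lab c x \<longleftrightarrow> lab' c x" and q: "0 < q" "r < q"
  shows "tower_struct q r A R lab \<longleftrightarrow> tower_struct q r A R' lab'"
proof -
  have mark: "mark q lab x \<longleftrightarrow> mark q lab' x" if "x \<in> A" for x
    using lab that by (auto simp: mark_def)
  have below: "below A R y m \<longleftrightarrow> below A R' y m" if "y \<in> A" "m \<in> A" for y m
    using R that by (auto simp: below_def)
  have lab1: "lab (1 mod q) x \<longleftrightarrow> lab' (1 mod q) x" "lab r x \<longleftrightarrow> lab' r x" if "x \<in> A" for x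
    using lab[of "1 mod q" x] lab[of r x] q that by simp_all
  have lab2: "lab (Suc c mod q) x \<longleftrightarrow> lab' (Suc c mod q) x" if "x \<in> A" for x c
    using lab[of "Suc c mod q" x] q that by simp
  show ?thesis
    unfolding tower_struct_def
    by (simp only: R mark below lab lab1 lab2 cong: ball_cong bex_cong imp_cong)
qed

section \<open>A first-order clock\<close>

text \<open>A code occupies entries 0 to 2 * b, so several codes are laid out one after the other.
  In a certificate blocks 0 and 1 give the vertex set, 2 and 3 the relation, and 4 + c the label
  c.\<close>

definition block :: "nat \<Rightarrow> (nat \<Rightarrow> 'v) \<Rightarrow> nat \<Rightarrow> nat \<Rightarrow> 'v" where
  "block b e i = (\<lambda>j. e (i * (2 * b + 1) + j))"

definition coded_set :: "nat \<Rightarrow> nat \<Rightarrow> 'v set \<Rightarrow> 'v set set \<Rightarrow> (nat \<Rightarrow> 'v) \<Rightarrow> 'v set" where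
  "coded_set a b V E e = {x \<in> V. x \<in> coded_dom a b V E (block b e 0) \<and> coded1 a b V E (block b e 1) x}"

text \<open>\<open>coded2\<close> provides only symmetric relations between distinct vertices, but
  membership has a direction. Here z acts as a partner of y: block 2 joins y to its partner, and
  block 3 joins x to the partners of the elements that x is related to.\<close>

definition coded_rel :: "nat \<Rightarrow> nat \<Rightarrow> 'v set \<Rightarrow> 'v set set \<Rightarrow> (nat \<Rightarrow> 'v) \<Rightarrow> 'v \<Rightarrow> 'v \<Rightarrow> bool" where
  "coded_rel a b V E e x y \<longleftrightarrow> (\<exists>z\<in>V. z \<in> coded_dom a b V E (block b e 0) \<and> z \<noteq> y \<and> z \<noteq> x \<and>
     coded2 a b V E (block b e 2) y z \<and> coded2 a b V E (block b e 3) x z)"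

definition coded_label :: "nat \<Rightarrow> nat \<Rightarrow> 'v set \<Rightarrow> 'v set set \<Rightarrow> (nat \<Rightarrow> 'v) \<Rightarrow> nat \<Rightarrow> 'v \<Rightarrow> bool" where
  "coded_label a b V E e c x \<longleftrightarrow> coded1 a b V E (block b e (4 + c)) x"

definition cert :: "nat \<Rightarrow> nat \<Rightarrow> nat \<Rightarrow> nat \<Rightarrow> 'v set \<Rightarrow> 'v set set \<Rightarrow> (nat \<Rightarrow> 'v) \<Rightarrow> bool" where
  "cert a b q r V E e \<longleftrightarrow> tower_struct q r (coded_set a b V E e) (coded_rel a b V E e) (coded_label a b V E e)"

text \<open>\<open>coded2\<close> is controlled only on distinct vertices. Adding equality lets the
  two compared sets overlap, common elements being matched with themselves.\<close>

definition joined :: "nat \<Rightarrow> nat \<Rightarrow> 'v set \<Rightarrow> 'v set set \<Rightarrow> (nat \<Rightarrow> 'v) \<Rightarrow> 'v \<Rightarrow> 'v \<Rightarrow> bool" where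
  "joined a b V E d x y \<longleftrightarrow> x = y \<or> coded2 a b V E d x y"

text \<open>The code d witnesses a comparison of sizes: it yields an injection of S into S' that
  misses an element.\<close>

definition smaller :: "nat \<Rightarrow> nat \<Rightarrow> 'v set \<Rightarrow> 'v set set \<Rightarrow> (nat \<Rightarrow> 'v) \<Rightarrow> 'v set \<Rightarrow> 'v set \<Rightarrow> bool" where
  "smaller a b V E d S S' \<longleftrightarrow>
    (\<forall>x\<in>S. \<exists>y\<in>S'. joined a b V E d x y) \<and>
    (\<forall>y\<in>S'. \<forall>x\<in>S. \<forall>x'\<in>S. joined a b V E d x y \<and> joined a b V E d x' y \<longrightarrow> x = x') \<and>
    (\<exists>y\<in>S'. \<forall>x\<in>S. \<not> joined a b V E d x y)"

abbreviation cert_length :: "nat \<Rightarrow> nat \<Rightarrow> nat" where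
  "cert_length b q \<equiv> (4 + q) * (2 * b + 1)"

abbreviation pair_length :: "nat \<Rightarrow> nat \<Rightarrow> nat" where
  "pair_length b q \<equiv> (5 + q) * (2 * b + 1)"

text \<open>w holds the challenging certificate, then one block for the comparison, and from
  \<open>pair_length b q\<close> on the certificate that loses.\<close>

definition beaten :: "nat \<Rightarrow> nat \<Rightarrow> nat \<Rightarrow> 'v set \<Rightarrow> 'v set set \<Rightarrow> (nat \<Rightarrow> 'v) \<Rightarrow> bool" where
  "beaten a b q V E w \<longleftrightarrow> (\<exists>r<q. cert a b q r V E w) \<and>
    smaller a b V E (\<lambda>i. w (cert_length b q + i)) (coded_set a b V E (\<lambda>i. w (pair_length b q + i))) (coded_set a b V E w)"

text \<open>If C divides both h and q, the residues modulo q of the heights from h to h + C - 1 are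
  all below C or all at least C. The test r < C therefore gives the same answer for every height in
  this window.\<close>

definition maximal :: "nat \<Rightarrow> nat \<Rightarrow> nat \<Rightarrow> nat \<Rightarrow> 'v set \<Rightarrow> 'v set set \<Rightarrow> (nat \<Rightarrow> 'v) \<Rightarrow> bool" where
  "maximal a b q C V E s \<longleftrightarrow> (\<exists>r<C. cert a b q r V E s) \<and>
    \<not> (\<exists>t. (\<forall>i<pair_length b q. t i \<in> V) \<and>
        beaten a b q V E (\<lambda>i. if i < pair_length b q then t i else s (i - pair_length b q)))"

text \<open>The certificate is determined by the first \<open>cert_length b q\<close> entries; v
  merely fills the tail of the assignment.\<close>

definition clock :: "nat \<Rightarrow> nat \<Rightarrow> nat \<Rightarrow> nat \<Rightarrow> 'v set \<Rightarrow> 'v set set \<Rightarrow> bool" where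
  "clock a b q C V E \<longleftrightarrow> (\<exists>v\<in>V. \<exists>t. (\<forall>i<cert_length b q. t i \<in> V) \<and>
    maximal a b q C V E (\<lambda>i. if i < cert_length b q then t i else v))"

section \<open>Definability of the clock\<close>

lemma coded_set_subset: "coded_set a b V E e \<subseteq> V"
  by (auto simp: coded_set_def)

lemma definable_coded_set: "definable (\<lambda>V E s. s u \<in> coded_set a b V E (\<lambda>i. s (\<pi> i)))"
  unfolding coded_set_def block_def mem_Collect_eq
  by (intro definable_conj definable_mem definable_coded_dom definable_coded1)

lemma definable_coded_rel: "definable (\<lambda>V E s. coded_rel a b V E (\<lambda>i. s (\<pi> i)) (s x) (s y))"
  unfolding coded_rel_def block_def
  by (intro definable_ex definable_conj definable_coded_dom definable_not definable_eq definable_coded2)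

lemma definable_coded_label: "definable (\<lambda>V E s. coded_label a b V E (\<lambda>i. s (\<pi> i)) c (s x))"
  unfolding coded_label_def block_def by (rule definable_coded1)

lemma definable_joined: "definable (\<lambda>V E s. joined a b V E (\<lambda>i. s (\<pi> i)) (s x) (s y))"
  unfolding joined_def by (intro definable_disj definable_eq definable_coded2)

lemma definable_const: "definable (\<lambda>V E s. P)"
  using definable_False definable_not[OF definable_False] by (cases P) simp_all

lemma definable_cert: "definable (\<lambda>V E s. cert a b q r V E (\<lambda>i. s (\<pi> i)))"
  unfolding cert_def tower_struct_def mark_def below_def
  by (intro definable_conj definable_Ball definable_Bex definable_all_less definable_ex_less definable_imp definable_iff
      definable_not definable_disj definable_eq definable_const definable_coded_set definable_coded_rel definable_coded_label coded_set_subset)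

lemma definable_smaller:
  "definable (\<lambda>V E s. smaller a b V E (\<lambda>i. s (\<pi> i)) (coded_set a b V E (\<lambda>i. s (\<rho> i))) (coded_set a b V E (\<lambda>i. s (\<sigma> i))))"
  unfolding smaller_def
  by (intro definable_conj definable_Ball definable_Bex definable_imp definable_not definable_eq
      definable_coded_set definable_joined coded_set_subset)

lemma definable_beaten: "definable (\<lambda>V E s. beaten a b q V E s)"
  unfolding beaten_def using definable_cert[of a b q _ "\<lambda>i. i"] definable_smaller[of a b _ _ "\<lambda>i. i"]
  by (intro definable_conj definable_ex_less) auto

lemma definable_maximal: "definable (\<lambda>V E s. maximal a b q C V E s)"
  unfolding maximal_def using definable_cert[of a b q _ "\<lambda>i. i"]
  by (intro definable_conj definable_ex_less definable_not definable_ex_block definable_beaten) auto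

lemma clock_sentence:
  "\<exists>\<phi>. sentence \<phi> \<and> (\<forall>V E. V \<noteq> {} \<longrightarrow> (models V E \<phi> \<longleftrightarrow> clock a b q C (V :: nat set) E))"
proof (rule definable_sentence)
  have "definable (\<lambda>V E s. \<exists>t. (\<forall>i<cert_length b q. t i \<in> V) \<and>
    maximal a b q C V E (\<lambda>i. if i < cert_length b q then t i else s (i - cert_length b q)))"
    by (intro definable_ex_block definable_maximal)
  \<comment> \<open>Sending every index to 0 makes the tail constant, and the outer quantifier
    supplies its value.\<close>
  from definable_rename[OF this, of "\<lambda>_. 0"]
  show "definable (\<lambda>V E s. clock a b q C V E)"
    unfolding clock_def by (intro definable_ex) simp
qed

section \<open>Dependence on finitely many entries of an assignment\<close>

lemma pset_cong: "(\<And>j. j < 2 * b \<Longrightarrow> e j = e' j) \<Longrightarrow> 0 < b \<Longrightarrow> pset a b V E e x y = pset a b V E e' x y"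
proof -
  assume e: "\<And>j. j < 2 * b \<Longrightarrow> e j = e' j" and b: "0 < b"
  have "vset a b V E e x = vset a b V E e' x" for x by (rule vset_cong) (use e in auto)
  moreover have "run a b V E (\<lambda>i. e (b + i)) A 1 (b - 2) = run a b V E (\<lambda>i. e' (b + i)) A 1 (b - 2)" for A
    by (rule run_cong) (use e in auto)
  ultimately show ?thesis using e b by (simp add: pset_def)
qed

lemma code_cong:
  assumes "\<And>j. j < 2 * b + 1 \<Longrightarrow> e j = e' j" "0 < b"
  shows "coded1 a b V E e x = coded1 a b V E e' x" "coded2 a b V E e x y = coded2 a b V E e' x y"
    "coded_dom a b V E e = coded_dom a b V E e'"
proof -
  have "vset a b V E e x = vset a b V E e' x" for x by (rule vset_cong) (use assms in auto)
  moreover have "pset a b V E e x y = pset a b V E e' x y" by (rule pset_cong) (use assms in auto)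
  ultimately show "coded1 a b V E e x = coded1 a b V E e' x" "coded2 a b V E e x y = coded2 a b V E e' x y"
    "coded_dom a b V E e = coded_dom a b V E e'"
    using assms(1)[of "2 * b"] assms(1)[of b] by (simp_all add: coded1_def coded2_def coded_dom_def)
qed

lemma block_cong:
  assumes "\<And>j. j < cert_length b q \<Longrightarrow> e j = e' j" "i < 4 + q" "j < 2 * b + 1"
  shows "block b e i j = block b e' i j"
proof -
  have "i * (2 * b + 1) + j < Suc i * (2 * b + 1)" using assms(3) by simp
  also have "\<dots> \<le> cert_length b q" using assms(2) by (intro mult_le_mono1) simp
  finally show ?thesis using assms(1) by (simp add: block_def)
qed

lemma coded_set_cong:
  assumes "\<And>j. j < cert_length b q \<Longrightarrow> e j = e' j" "0 < b"
  shows "coded_set a b V E e = coded_set a b V E e'"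
  using code_cong[of b "block b e 0" "block b e' 0"] code_cong[of b "block b e 1" "block b e' 1"]
    block_cong[OF assms(1)] assms(2) by (simp add: coded_set_def)

lemma cert_cong:
  assumes e: "\<And>j. j < cert_length b q \<Longrightarrow> e j = e' j" and "0 < b" "r < q"
  shows "cert a b q r V E e \<longleftrightarrow> cert a b q r V E e'"
proof -
  have S: "coded_set a b V E e = coded_set a b V E e'"
    using e assms(2) by (rule coded_set_cong)
  have "coded_rel a b V E e x y \<longleftrightarrow> coded_rel a b V E e' x y" for x y
    unfolding coded_rel_def using code_cong[of b "block b e 0" "block b e' 0"]
      code_cong[of b "block b e 2" "block b e' 2"] code_cong[of b "block b e 3" "block b e' 3"]
      block_cong[OF e] assms(2) by simp
  moreover have "coded_label a b V E e c x \<longleftrightarrow> coded_label a b V E e' c x" if "c < q" for c x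
    unfolding coded_label_def using code_cong[of b "block b e (4 + c)" "block b e' (4 + c)"]
      block_cong[OF e] assms(2) that by simp
  moreover have "0 < q" using assms(3) by simp
  ultimately show ?thesis
    unfolding cert_def S using assms(3) by (intro tower_struct_cong)
qed

lemma smaller_cong:
  assumes "\<And>j. j < 2 * b + 1 \<Longrightarrow> d j = d' j" "0 < b"
  shows "smaller a b V E d S S' \<longleftrightarrow> smaller a b V E d' S S'"
  using code_cong(2)[OF assms] by (simp add: smaller_def joined_def)

text \<open>Choosing a partner for each element of S gives an injection into S' that avoids y. This
  holds for every d, so no certificate can be beaten unduly.\<close>

lemma smaller_card:
  assumes "smaller a b V E d S S'" "finite S'"
  shows "card S < card S'"
proof -
  note sm = assms(1)[unfolded smaller_def]
  have "\<forall>x\<in>S. \<exists>y. y \<in> S' \<and> joined a b V E d x y"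
    using sm[THEN conjunct1] by (simp only: Bex_def)
  from bchoice[OF this] obtain f where f: "\<And>x. x \<in> S \<Longrightarrow> f x \<in> S' \<and> joined a b V E d x (f x)"
    by blast
  from sm[THEN conjunct2, THEN conjunct2] obtain y where y: "y \<in> S'" "\<And>x. x \<in> S \<Longrightarrow> \<not> joined a b V E d x y"
    by blast
  have "inj_on f S"
  proof (rule inj_onI)
    fix x y assume *: "x \<in> S" "y \<in> S" "f x = f y"
    then have "joined a b V E d x (f x)" "joined a b V E d y (f x)" "f x \<in> S'" using f[of x] f[of y] by auto
    then show "x = y" using sm[THEN conjunct2, THEN conjunct1] *(1,2) by blast
  qed
  moreover have "f ` S \<subseteq> S' - {y}" using f y by blast
  ultimately have "card S \<le> card (S' - {y})" using assms(2) by (intro card_inj_on_le) auto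
  also have "\<dots> < card S'" using y(1) assms(2) by (intro psubset_card_mono) auto
  finally show ?thesis .
qed

section \<open>Existence of certificates and the value of the clock\<close>

context pseudo_random_graph
begin

text \<open>Common elements match themselves, so only an injection f of S - S' into S' - S is coded.
  Its edges run between two disjoint sets, hence the symmetric relation still determines f.\<close>

lemma ex_smaller:
  assumes l: "large (s ^ 2) (bound3 s)" and S: "S \<subseteq> V" "S' \<subseteq> V" "card S + card S' \<le> s" "card S < card S'"
  shows "\<exists>d. (\<forall>j. d j \<in> V) \<and> smaller a b V E d S S'"
proof -
  have fin: "finite S" "finite S'" using S finite_subset by auto
  have "card (S - S') < card (S' - S)"
    using S(4) fin card_Int_Diff[of S S'] card_Int_Diff[of S' S] by (simp add: Int_commute)
  moreover from this obtain f where f: "f ` (S - S') \<subseteq> S' - S" "inj_on f (S - S')"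
    using card_le_inj[of "S - S'" "S' - S"] fin by auto
  moreover have "card (f ` (S - S')) = card (S - S')" using f(2) by (rule card_image)
  ultimately have "f ` (S - S') \<noteq> S' - S" by auto
  then obtain y0 where y0: "y0 \<in> S'" "y0 \<notin> S" "y0 \<notin> f ` (S - S')" using f(1) by blast
  let ?R = "\<lambda>x y. \<exists>u\<in>S - S'. {x, y} = {u, f u}"
  have "?R x y \<longleftrightarrow> ?R y x" for x y by (simp only: insert_commute[of x y])
  moreover have "card (S \<union> S') \<le> s" using card_Un_le[of S S'] S(3) by linarith
  ultimately obtain d where d: "\<forall>j. d j \<in> V"
      "\<forall>x\<in>S \<union> S'. \<forall>y\<in>S \<union> S'. x \<noteq> y \<longrightarrow> (coded2 a b V E d x y \<longleftrightarrow> ?R x y)"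
    using ex_coded2[OF l, of "S \<union> S'" ?R] S(1,2) by auto
  have J: "joined a b V E d x y \<longleftrightarrow> x = y \<or> (x \<in> S - S' \<and> y = f x)" if "x \<in> S" "y \<in> S'" for x y
  proof (cases "x = y")
    case False
    have "?R x y \<longleftrightarrow> x \<in> S - S' \<and> y = f x"
      using that f(1) False by (auto simp: doubleton_eq_iff)
    then show ?thesis using d(2) that False by (auto simp: joined_def)
  qed (simp add: joined_def)
  have "smaller a b V E d S S'"
    unfolding smaller_def
  proof (intro conjI)
    show "\<forall>x\<in>S. \<exists>y\<in>S'. joined a b V E d x y"
    proof
      fix x assume x: "x \<in> S"
      show "\<exists>y\<in>S'. joined a b V E d x y"
      proof (cases "x \<in> S'")
        case True
        then show ?thesis using J x by blast
      next
        case False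
        then show ?thesis using J[OF x, of "f x"] x f(1) by blast
      qed
    qed
    show "\<forall>y\<in>S'. \<forall>x\<in>S. \<forall>x'\<in>S. joined a b V E d x y \<and> joined a b V E d x' y \<longrightarrow> x = x'"
      using J f by (auto dest: inj_onD)
    show "\<exists>y\<in>S'. \<forall>x\<in>S. \<not> joined a b V E d x y"
      using J y0 by (intro bexI[of _ y0]) auto
  qed
  then show ?thesis using d(1) by blast
qed

text \<open>The ambient set has 2 * tow h vertices: the first half carries the numbers below tow h
  with their bit relation, the second half a partner for each of them.\<close>

lemma ex_cert:
  assumes l: "large (s ^ 2) (bound3 s)" and h: "0 < h" "2 * tow h \<le> s" and q: "0 < q"
  shows "\<exists>e. (\<forall>j. e j \<in> V) \<and> cert a b q (h mod q) V E e \<and> card (coded_set a b V E e) = tow h"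
proof -
  let ?H = "tow h"
  have "0 < ?H" using h(1) by (cases h) auto
  then obtain e0 where e0: "\<forall>j. e0 j \<in> V" "card (coded_dom a b V E e0) = 2 * ?H"
    using ex_coded_dom[OF l, of "2 * ?H"] h(2) by auto
  let ?D = "coded_dom a b V E e0"
  have D: "?D \<subseteq> V" "card ?D \<le> s" using e0(2) h(2) by (auto simp: coded_dom_def)
  have "finite ?D" using D(1) finite_subset by blast
  then obtain \<beta> where "bij_betw \<beta> {0..<2 * ?H} ?D"
    using ex_bij_betw_nat_finite e0(2) by metis
  then have \<beta>: "inj_on \<beta> {0..<2 * ?H}" "\<beta> ` {0..<2 * ?H} = ?D" by (auto simp: bij_betw_def)
  have \<beta>eq: "\<beta> i = \<beta> j \<longleftrightarrow> i = j" if "i < 2 * ?H" "j < 2 * ?H" for i j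
    using \<beta>(1) that by (auto dest: inj_onD)
  have \<beta>D: "\<beta> i \<in> ?D" if "i < 2 * ?H" for i using \<beta>(2) that by auto
  let ?S = "\<beta> ` {..<?H}"
  \<comment> \<open>R0 joins each element to its partner, and R1 joins \<beta> i to the partner of
    \<beta> j if i is an element of j.\<close>
  define R0 where "R0 x y \<longleftrightarrow> (\<exists>i<?H. {x, y} = {\<beta> i, \<beta> (?H + i)})" for x y
  define R1 where "R1 x y \<longleftrightarrow> (\<exists>i<?H. \<exists>j<?H. bit j i \<and> {x, y} = {\<beta> i, \<beta> (?H + j)})" for x y
  have sym: "R0 x y \<longleftrightarrow> R0 y x" "R1 x y \<longleftrightarrow> R1 y x" for x y
    unfolding R0_def R1_def by (simp_all only: insert_commute[of x y])
  let ?lab = "\<lambda>c m. \<exists>j<h. m = 2 ^ tow j - 1 \<and> c = Suc j mod q"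
  have "?S \<subseteq> ?D" using \<beta>D by auto
  then obtain e1 where e1: "\<forall>j. e1 j \<in> V" "\<forall>x\<in>?D. coded1 a b V E e1 x \<longleftrightarrow> x \<in> ?S"
    using ex_coded1[OF l D] by blast
  obtain e2 where e2: "\<forall>j. e2 j \<in> V" "\<forall>x\<in>?D. \<forall>y\<in>?D. x \<noteq> y \<longrightarrow> (coded2 a b V E e2 x y \<longleftrightarrow> R0 x y)"
    using ex_coded2[where R = R0, OF l D sym(1)] by blast
  obtain e3 where e3: "\<forall>j. e3 j \<in> V" "\<forall>x\<in>?D. \<forall>y\<in>?D. x \<noteq> y \<longrightarrow> (coded2 a b V E e3 x y \<longleftrightarrow> R1 x y)"
    using ex_coded2[where R = R1, OF l D sym(2)] by blast
  have "\<exists>e. (\<forall>j. e j \<in> V) \<and> (\<forall>x\<in>?D. coded1 a b V E e x \<longleftrightarrow> x \<in> \<beta> ` {m. m < ?H \<and> ?lab c m})" for c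
    by (rule ex_coded1[OF l D]) (use \<beta>D in auto)
  then have "\<exists>e4. \<forall>c. (\<forall>j. e4 c j \<in> V) \<and> (\<forall>x\<in>?D. coded1 a b V E (e4 c) x \<longleftrightarrow> x \<in> \<beta> ` {m. m < ?H \<and> ?lab c m})"
    by (intro choice allI)
  then obtain e4 where e4: "\<And>c j. e4 c j \<in> V"
      "\<And>c x. x \<in> ?D \<Longrightarrow> coded1 a b V E (e4 c) x \<longleftrightarrow> x \<in> \<beta> ` {m. m < ?H \<and> ?lab c m}"
    by blast
  define F where "F i = (if i = 0 then e0 else if i = 1 then e1 else if i = 2 then e2 else if i = 3 then e3 else e4 (i - 4))" for i :: nat
  define e where "e i = F (i div (2 * b + 1)) (i mod (2 * b + 1))" for i
  have eV: "e j \<in> V" for j using e0(1) e1(1) e2(1) e3(1) e4(1) by (simp add: e_def F_def)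
  have blk: "block b e i j = F i j" if "j < 2 * b + 1" for i j
  proof -
    have "(i * (2 * b + 1) + j) div (2 * b + 1) = i" "(i * (2 * b + 1) + j) mod (2 * b + 1) = j"
      using that by (auto simp: div_mult_self3 simp del: mult_Suc_right)
    then show ?thesis by (simp only: block_def e_def)
  qed
  have b: "0 < b" using ab by simp
  have cc: "coded1 a b V E (block b e i) x = coded1 a b V E (F i) x"
    "coded2 a b V E (block b e i) x y = coded2 a b V E (F i) x y"
    "coded_dom a b V E (block b e i) = coded_dom a b V E (F i)" for i x y
    using code_cong[of b "block b e i" "F i", OF blk b] by blast+
  have S: "coded_set a b V E e = ?S"
  proof -
    have "F 0 = e0" "F 1 = e1" by (simp_all add: F_def)
    then show ?thesis
      using e1(2) \<open>?S \<subseteq> ?D\<close> D(1) unfolding coded_set_def cc by (auto simp del: atLeastAtMost_iff)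
  qed
  have R: "coded_rel a b V E e (\<beta> i) (\<beta> j) \<longleftrightarrow> bit j i" if ij: "i < ?H" "j < ?H" for i j
  proof -
    have mem: "\<beta> i \<in> ?D" "\<beta> j \<in> ?D" "\<beta> (?H + j) \<in> ?D" using \<beta>D[of i] \<beta>D[of j] \<beta>D[of "?H + j"] ij by simp_all
    have neq: "\<beta> (?H + j) \<noteq> \<beta> i" "\<beta> (?H + j) \<noteq> \<beta> j" using ij by (auto simp: \<beta>eq)
    have R0: "R0 (\<beta> j) z \<longleftrightarrow> z = \<beta> (?H + j)" for z
    proof
      assume "R0 (\<beta> j) z"
      then obtain k where k: "k < ?H" "{\<beta> j, z} = {\<beta> k, \<beta> (?H + k)}" unfolding R0_def by blast
      have "\<beta> j \<noteq> \<beta> (?H + k)" using ij k(1) by (simp add: \<beta>eq)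
      then have "\<beta> j = \<beta> k" "z = \<beta> (?H + k)" using k(2) by (auto simp: doubleton_eq_iff)
      then show "z = \<beta> (?H + j)" using ij k(1) by (simp add: \<beta>eq)
    qed (use ij in \<open>auto simp: R0_def\<close>)
    have R1: "R1 (\<beta> i) (\<beta> (?H + j)) \<longleftrightarrow> bit j i"
    proof
      assume "R1 (\<beta> i) (\<beta> (?H + j))"
      then obtain i' j' where k: "i' < ?H" "j' < ?H" "bit j' i'" "{\<beta> i, \<beta> (?H + j)} = {\<beta> i', \<beta> (?H + j')}"
        unfolding R1_def by blast
      have "\<beta> i \<noteq> \<beta> (?H + j')" using ij k by (simp add: \<beta>eq)
      then have "\<beta> i = \<beta> i'" "\<beta> (?H + j) = \<beta> (?H + j')" using k(4) by (auto simp: doubleton_eq_iff)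
      then have "i = i'" "j = j'" using ij k by (simp_all add: \<beta>eq)
      then show "bit j i" using k(3) by simp
    qed (use ij in \<open>auto simp: R1_def\<close>)
    have "coded_rel a b V E e (\<beta> i) (\<beta> j) \<longleftrightarrow>
        (\<exists>z\<in>?D. z \<noteq> \<beta> j \<and> z \<noteq> \<beta> i \<and> coded2 a b V E e2 (\<beta> j) z \<and> coded2 a b V E e3 (\<beta> i) z)"
    proof -
      have "F 0 = e0" "F 2 = e2" "F 3 = e3" by (simp_all add: F_def)
      then show ?thesis using D(1) unfolding coded_rel_def cc by (auto simp del: atLeastAtMost_iff)
    qed
    also have "\<dots> \<longleftrightarrow> (\<exists>z\<in>?D. z \<noteq> \<beta> j \<and> z \<noteq> \<beta> i \<and> R0 (\<beta> j) z \<and> R1 (\<beta> i) z)"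
    proof (intro bex_cong refl conj_cong)
      fix z assume z: "z \<in> ?D" "z \<noteq> \<beta> j" "z \<noteq> \<beta> i"
      show "coded2 a b V E e2 (\<beta> j) z \<longleftrightarrow> R0 (\<beta> j) z" using e2(2) mem z by auto
      show "coded2 a b V E e3 (\<beta> i) z \<longleftrightarrow> R1 (\<beta> i) z" using e3(2) mem z by auto
    qed
    also have "\<dots> \<longleftrightarrow> bit j i"
      unfolding R0 using mem neq R1 by blast
    finally show ?thesis .
  qed
  have L: "coded_label a b V E e c (\<beta> m) \<longleftrightarrow> ?lab c m" if "m < ?H" for c m
  proof -
    have "coded_label a b V E e c (\<beta> m) \<longleftrightarrow> \<beta> m \<in> \<beta> ` {m. m < ?H \<and> ?lab c m}"
      unfolding coded_label_def cc using e4(2)[of "\<beta> m" c] \<beta>D[of m] that by (simp add: F_def)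
    also have "\<dots> \<longleftrightarrow> ?lab c m" using that by (auto simp: \<beta>eq)
    finally show ?thesis .
  qed
  have inj: "inj_on \<beta> {..<?H}" using \<beta>(1) by (rule inj_on_subset) auto
  have "cert a b q (h mod q) V E e"
    unfolding cert_def S tower_struct_image[OF inj]
    by (rule tower_struct_cong[THEN iffD2, OF _ _ _ _ tower_struct_bit[OF h(1) q]])
      (use R L q in auto)
  moreover have "card (coded_set a b V E e) = ?H" unfolding S using card_image[OF inj] by simp
  ultimately show ?thesis using eV by blast
qed

text \<open>Soundness for arbitrary e: no assignment can certify a height that its coded set does
  not have.\<close>

lemma cert_card:
  assumes "cert a b q r V E e" "r < q"
  shows "\<exists>k. card (coded_set a b V E e) = tow k \<and> k mod q = r"
  by (rule tower_struct_sound[OF assms(1)[unfolded cert_def] _ _ assms(2)])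
    (use assms(2) finite_subset[OF coded_set_subset[of a b V E e]] in auto)

lemma coded_set_card: "card (coded_set a b V E e) \<le> n"
  using card_mono[OF _ coded_set_subset[of a b V E e]] by simp

lemma tow_inj: "tow i = tow j \<longleftrightarrow> i = j"
  using strict_mono_eq[OF strict_mono_tow] by simp

text \<open>The greatest certified height K satisfies h <= K < h + C: height h is certified by
  \<open>ex_cert\<close>, and a coded set has at most n elements. As q divides h, the residue of K
  is K - h < C. A certificate beating one of height K would certify a greater height.\<close>

lemma clock_true:
  assumes l: "large (s ^ 2) (bound3 s)" and h: "0 < h" "2 * tow h \<le> s" and n: "n < tow (h + C)"
    and q: "h mod q = 0" "C \<le> q" "0 < C"
  shows "clock a b q C V E"
proof -
  have b: "0 < b" and q0: "0 < q" using ab q by auto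
  let ?A = "{k. \<exists>e r. r < q \<and> (\<forall>i<cert_length b q. e i \<in> V) \<and> cert a b q r V E e \<and> card (coded_set a b V E e) = tow k}"
  have less: "k < h + C" if "k \<in> ?A" for k
  proof -
    from that obtain e where "card (coded_set a b V E e) = tow k" by blast
    then have "tow k < tow (h + C)" using coded_set_card[of e] n by linarith
    then show ?thesis by simp
  qed
  have hA: "h \<in> ?A"
  proof -
    obtain e where "\<forall>j. e j \<in> V" "cert a b q (h mod q) V E e" "card (coded_set a b V E e) = tow h"
      using ex_cert[OF l h q0] by blast
    then show ?thesis using q0 by (intro CollectI exI[of _ e] exI[of _ "h mod q"]) auto
  qed
  have finA: "finite ?A" using less by (intro finite_subset[of ?A "{..<h + C}"]) auto
  define K where "K = Max ?A"
  have KA: "K \<in> ?A" unfolding K_def using finA hA by (intro Max_in) auto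
  from KA obtain e r where e: "r < q" "\<forall>i<cert_length b q. e i \<in> V" "cert a b q r V E e" "card (coded_set a b V E e) = tow K"
    by blast
  have r: "K mod q = r" using cert_card[OF e(3,1)] e(4) tow_inj by auto
  have kh: "h \<le> K" "K < h + C" using Max_ge[OF finA hA] less[OF KA] unfolding K_def by auto
  have "K mod q = (K - h) mod q"
  proof -
    obtain u where "h = q * u" using q(1) by (auto simp: mod_eq_0_iff_dvd)
    then have "K = (K - h) + q * u" using kh by simp
    then have "K mod q = ((K - h) + q * u) mod q" by (rule arg_cong)
    also have "\<dots> = (K - h) mod q" by (rule mod_mult_self2)
    finally show ?thesis .
  qed
  also have "\<dots> < C" using kh q by simp
  finally have rC: "r < C" using r by simp
  have v: "1 \<in> V" using n_ge nu by simp
  let ?e = "\<lambda>i. if i < cert_length b q then e i else 1"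
  have "cert a b q r V E ?e \<longleftrightarrow> cert a b q r V E e" by (rule cert_cong) (use b e(1) in auto)
  then have c: "cert a b q r V E ?e" using e(3) by blast
  have S: "coded_set a b V E ?e = coded_set a b V E e" by (rule coded_set_cong[where q = q, OF _ b]) simp
  have "\<not> beaten a b q V E (\<lambda>i. if i < pair_length b q then t i else ?e (i - pair_length b q))"
    if t: "\<forall>i<pair_length b q. t i \<in> V" for t
  proof
    let ?w = "\<lambda>i. if i < pair_length b q then t i else ?e (i - pair_length b q)"
    assume "beaten a b q V E ?w"
    then obtain r' where r': "r' < q" "cert a b q r' V E ?w"
      and sm: "smaller a b V E (\<lambda>i. ?w (cert_length b q + i)) (coded_set a b V E (\<lambda>i. ?w (pair_length b q + i))) (coded_set a b V E ?w)"
      unfolding beaten_def by blast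
    have "(\<lambda>i. ?w (pair_length b q + i)) = ?e" by (simp add: fun_eq_iff)
    then have "card (coded_set a b V E e) < card (coded_set a b V E ?w)"
      using smaller_card[OF sm finite_subset[OF coded_set_subset]] S by simp
    moreover obtain k where k: "card (coded_set a b V E ?w) = tow k" using cert_card[OF r'(2,1)] by blast
    ultimately have "K < k" using e(4) by simp
    moreover have "\<forall>i<cert_length b q. ?w i \<in> V"
    proof (intro allI impI)
      fix i assume "i < cert_length b q"
      also have "\<dots> \<le> pair_length b q" by (intro mult_le_mono1) simp
      finally show "?w i \<in> V" using t by auto
    qed
    then have "k \<in> ?A" unfolding mem_Collect_eq using r' k by (intro exI[of _ ?w] exI[of _ r'] conjI)
    then have "k \<le> K" unfolding K_def by (intro Max_ge finA)
    ultimately show False by simp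
  qed
  then have "maximal a b q C V E ?e" unfolding maximal_def using c rC by blast
  then show ?thesis unfolding clock_def using v e(2) by blast
qed

text \<open>Since h mod q is a nonzero multiple of C, heights from h to h + C - 1 have residues at
  least C. A certificate with residue below C therefore has height k < h, and a certificate of
  height h beats it.\<close>

lemma clock_false:
  assumes l: "large (s ^ 2) (bound3 s)" and h: "0 < h" "2 * tow h \<le> s" and n: "n < tow (h + C)"
    and q: "h mod q \<noteq> 0" "C dvd q" "C dvd h" "0 < q" "0 < C"
  shows "\<not> clock a b q C V E"
proof
  assume "clock a b q C V E"
  have b: "0 < b" using ab by auto
  from \<open>clock a b q C V E\<close> obtain v t where t: "\<forall>i<cert_length b q. t i \<in> V"
    "maximal a b q C V E (\<lambda>i. if i < cert_length b q then t i else v)"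
    unfolding clock_def by blast
  let ?e = "\<lambda>i. if i < cert_length b q then t i else v"
  from t(2) obtain r where r: "r < C" "cert a b q r V E ?e"
    and nb: "\<And>t. (\<forall>i<pair_length b q. t i \<in> V) \<Longrightarrow>
      \<not> beaten a b q V E (\<lambda>i. if i < pair_length b q then t i else ?e (i - pair_length b q))"
    unfolding maximal_def by blast
  have "C \<le> q" using q by (auto dest: dvd_imp_le)
  then have rq: "r < q" using r(1) by simp
  obtain k where k: "card (coded_set a b V E ?e) = tow k" "k mod q = r"
    using cert_card[OF r(2) rq] by blast
  have "k < h"
  proof (rule ccontr)
    assume kh: "\<not> k < h"
    have "tow k < tow (h + C)" using k(1) coded_set_card[of ?e] n by linarith
    then have "k < h + C" by simp
    obtain u v where uv: "h = C * u" "q = C * v" using q(2,3) by (auto elim!: dvdE)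
    have "k = (k - h) + C * u" "k - h < C" using kh \<open>k < h + C\<close> uv by auto
    then have "k div C = u" using q(5) by (metis add.commute add.right_neutral div_less div_mult_self4 less_nat_zero_code)
    then have "k mod q = C * (u mod v) + k mod C" unfolding uv by (simp add: mod_mult2_eq)
    then have "C * (u mod v) < C * 1" using k(2) r(1) by linarith
    then have "u mod v = 0" using mult_less_cancel1[of C "u mod v" 1] by simp
    then have "h mod q = 0" unfolding uv by simp
    then show False using q(1) by simp
  qed
  obtain e0 where e0: "\<forall>j. e0 j \<in> V" "cert a b q (h mod q) V E e0" "card (coded_set a b V E e0) = tow h"
    using ex_cert[OF l h q(4)] by blast
  have lt: "card (coded_set a b V E ?e) < card (coded_set a b V E e0)" using k(1) e0(3) \<open>k < h\<close> by simp
  \<comment> \<open>Together the two sets have at most 2 * tow h elements, few enough for a coded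
    comparison.\<close>
  then have "card (coded_set a b V E ?e) + card (coded_set a b V E e0) \<le> s" using e0(3) h(2) by simp
  then obtain d where d: "\<forall>j. d j \<in> V" "smaller a b V E d (coded_set a b V E ?e) (coded_set a b V E e0)"
    using ex_smaller[OF l coded_set_subset coded_set_subset _ lt] by blast
  let ?t = "\<lambda>i. if i < cert_length b q then e0 i else d (i - cert_length b q)"
  let ?w = "\<lambda>i. if i < pair_length b q then ?t i else ?e (i - pair_length b q)"
  have len: "cert_length b q + (2 * b + 1) = pair_length b q" by (simp add: algebra_simps)
  have w0: "?w j = e0 j" if "j < cert_length b q" for j using that len by auto
  have wd: "?w (cert_length b q + j) = d j" if "j < 2 * b + 1" for j
    using that len by auto
  have we: "(\<lambda>i. ?w (pair_length b q + i)) = ?e" by (simp add: fun_eq_iff)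
  have c: "cert a b q (h mod q) V E ?w"
    using cert_cong[where b = b and q = q and e = ?w and e' = e0 and r = "h mod q", OF w0 b] e0(2) q(4) by simp
  have S: "coded_set a b V E ?w = coded_set a b V E e0"
    by (rule coded_set_cong[where b = b and q = q and e = ?w and e' = e0, OF w0 b])
  have sm: "smaller a b V E (\<lambda>i. ?w (cert_length b q + i)) (coded_set a b V E ?e) (coded_set a b V E e0)"
    by (rule iffD2[OF smaller_cong[where b = b and d = "\<lambda>i. ?w (cert_length b q + i)" and d' = d, OF wd b] d(2)])
  have hq: "h mod q < q" using q(4) by simp
  have ex: "\<exists>r<q. cert a b q r V E ?w"
    by (rule exI[where P = "\<lambda>r. r < q \<and> cert a b q r V E ?w" and x = "h mod q", OF conjI[OF hq c]])
  have beaten: "beaten a b q V E ?w" unfolding beaten_def we S by (rule conjI[OF ex sm])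
  have "\<forall>i<pair_length b q. ?t i \<in> V" using e0(1) d(1) by simp
  from nb[OF this] beaten show False by (rule notE)
qed

end

section \<open>Growth rates and the main theorem\<close>

text \<open>The value of \<nu> belonging to s. The constant \<open>bound3\<close> is doubly
  exponential in about s * ln s and \<open>large\<close> contains its exponential; a tower with four
  exponentials dominates this.\<close>

definition base :: "nat \<Rightarrow> nat" where
  "base s = 2 ^ (2 ^ (2 ^ (2 ^ s)))"

lemma real_two_power: "real (2 ^ k) = 2 powr real k"
  by (simp add: powr_realpow)

text \<open>The inequality in \<open>large\<close> for s^2 and \<open>bound3 s\<close>, with b
  replaced by s in the exponents and ln n by s * ln (base s). Both are upper bounds once b <= s, and
  the condition depends on s alone.\<close>

definition base_large :: "nat \<Rightarrow> bool" where
  "base_large s \<longleftrightarrow> 10000 * (real (s ^ 2)) ^ 2 *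
      ((100 * real (s ^ 2)) ^ s * (8 * (((100 * real s) ^ s) ^ s * exp (2 * (real s * (100 * real s) ^ s))))) ^ (s ^ 2 + 2) *
      exp (2 * real (s ^ 2) *
        ((100 * real (s ^ 2)) ^ s * (8 * (((100 * real s) ^ s) ^ s * exp (2 * (real s * (100 * real s) ^ s)))))) *
      (real s * ln (base s)) \<le> real (base s)"

text \<open>The stacked exponentials are separated by w = 2 powr (2 powr s). First the logarithm of
  the inner constant B is bounded by (ln 2 / 4) * w; then the logarithm of the whole left side is
  compared with ln 2 * 2 powr w, the logarithm of \<open>base s\<close>.\<close>

lemma eventually_base_large:
  "eventually base_large at_top"
proof -
  have c1: "eventually (\<lambda>x::real. x * ln (100 * x^2) + ln 8 + x * (x * ln (100 * x)) + 2 * x * exp (x * ln (100 * x))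
      \<le> ln 2 / 4 * (2 powr (2 powr x))) at_top"
    by real_asymp
  have c2: "eventually (\<lambda>w::real. ln (10000 * w^5) + (w^2 + 2) * (ln 2 / 4 * w) + 2 * w^2 * exp (ln 2 / 4 * w) + ln 2 * w
      \<le> ln 2 * 2 powr w) at_top"
    by real_asymp
  have lim: "filterlim (\<lambda>x::real. 2 powr (2 powr x)) at_top at_top" by real_asymp
  have c3: "eventually (\<lambda>x::real. 1 \<le> x \<and> x \<le> 2 powr (2 powr x)) at_top"
    by (intro eventually_conj eventually_ge_at_top) real_asymp
  have "eventually (\<lambda>x::real. (x * ln (100 * x^2) + ln 8 + x * (x * ln (100 * x)) + 2 * x * exp (x * ln (100 * x))
      \<le> ln 2 / 4 * (2 powr (2 powr x))) \<and>
      (let w = 2 powr (2 powr x) in ln (10000 * w^5) + (w^2 + 2) * (ln 2 / 4 * w) + 2 * w^2 * exp (ln 2 / 4 * w) + ln 2 * w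
      \<le> ln 2 * 2 powr w) \<and> 1 \<le> x \<and> x \<le> 2 powr (2 powr x)) at_top"
    using eventually_compose_filterlim[OF c2 lim] c1 c3 by (simp add: Let_def eventually_conj_iff)
  from eventually_compose_filterlim[OF this filterlim_real_sequentially] show ?thesis
  proof (rule eventually_mono)
    fix s :: nat
    let ?x = "real s" and ?w = "2 powr (2 powr real s)"
    assume A: "(?x * ln (100 * ?x^2) + ln 8 + ?x * (?x * ln (100 * ?x)) + 2 * ?x * exp (?x * ln (100 * ?x))
      \<le> ln 2 / 4 * ?w) \<and>
      (let w = ?w in ln (10000 * w^5) + (w^2 + 2) * (ln 2 / 4 * w) + 2 * w^2 * exp (ln 2 / 4 * w) + ln 2 * w
      \<le> ln 2 * 2 powr w) \<and> 1 \<le> ?x \<and> ?x \<le> ?w"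
    define B where "B = (100 * real (s ^ 2)) ^ s * (8 * (((100 * real s) ^ s) ^ s * exp (2 * (real s * (100 * real s) ^ s))))"
    define w where "w = ?w"
    have x1: "1 \<le> ?x" and xw: "?x \<le> w" using A by (auto simp: w_def)
    have w1: "1 \<le> w" using x1 xw by simp
    have B0: "0 < B" using x1 by (auto simp: B_def intro!: mult_pos_pos)
    have pe: "(100 * real s) ^ s = exp (?x * ln (100 * ?x))"
    proof -
      have "exp (real s * ln (100 * real s)) = exp (ln (100 * real s)) ^ s" by (rule exp_of_nat_mult)
      also have "exp (ln (100 * real s)) = 100 * real s" using x1 by simp
      finally show ?thesis by simp
    qed
    have "ln B = ?x * ln (100 * ?x^2) + ln 8 + ?x * (?x * ln (100 * ?x)) + 2 * ?x * exp (?x * ln (100 * ?x))"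
    proof -
      have "ln B = ln ((100 * real (s ^ 2)) ^ s) + (ln 8 + (ln (((100 * real s) ^ s) ^ s) + 2 * (real s * (100 * real s) ^ s)))"
        unfolding B_def using x1 by (simp add: ln_mult_pos)
      also have "ln ((100 * real (s ^ 2)) ^ s) = ?x * ln (100 * ?x^2)"
        using x1 by (subst ln_realpow) auto
      also have "ln (((100 * real s) ^ s) ^ s) = ?x * (?x * ln (100 * ?x))"
      proof -
        have "0 < 100 * real s" "0 < (100 * real s) ^ s" using x1 by (auto intro: zero_less_power)
        then show ?thesis by (simp only: ln_realpow)
      qed
      finally show ?thesis unfolding pe by simp
    qed
    then have lnB: "ln B \<le> ln 2 / 4 * w" using A by (simp add: w_def)
    then have Be: "B \<le> exp (ln 2 / 4 * w)" using B0 by (metis exp_le_cancel_iff exp_ln)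
    have nu: "real (base s) = exp (ln 2 * 2 powr w)"
    proof -
      have "real (base s) = 2 powr real (2 ^ (2 ^ (2 ^ s)))" unfolding base_def by (rule real_two_power)
      also have "real (2 ^ (2 ^ (2 ^ s))) = 2 powr real (2 ^ (2 ^ s))" by (rule real_two_power)
      also have "real (2 ^ (2 ^ s)) = w" unfolding w_def by (simp only: real_two_power)
      finally show ?thesis by (simp add: powr_def mult.commute)
    qed
    have e1: "10000 * (real (s ^ 2)) ^ 2 * ?x \<le> 10000 * w ^ 5"
    proof -
      have "(real (s ^ 2)) ^ 2 * ?x = ?x ^ 5" by (simp add: power_numeral_reduce)
      also have "\<dots> \<le> w ^ 5" using x1 xw by (intro power_mono) auto
      finally show ?thesis by simp
    qed
    have e2: "B ^ (s ^ 2 + 2) \<le> exp ((w ^ 2 + 2) * (ln 2 / 4 * w))"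
    proof -
      have "B ^ (s ^ 2 + 2) \<le> exp (ln 2 / 4 * w) ^ (s ^ 2 + 2)" using B0 Be by (intro power_mono) auto
      also have "\<dots> = exp (real (s ^ 2 + 2) * (ln 2 / 4 * w))" by (simp only: exp_of_nat_mult)
      also have "real (s ^ 2 + 2) * (ln 2 / 4 * w) \<le> (w ^ 2 + 2) * (ln 2 / 4 * w)"
        using x1 xw w1 by (intro mult_right_mono) (auto intro!: power_mono)
      finally show ?thesis by simp
    qed
    have e3: "exp (2 * real (s ^ 2) * B) \<le> exp (2 * w ^ 2 * exp (ln 2 / 4 * w))"
      using x1 xw B0 Be by (auto intro!: mult_mono power_mono)
    have e4: "ln (base s) \<le> exp (ln 2 * w)"
    proof -
      have "ln (base s) = ln 2 * 2 powr w" unfolding nu by simp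
      also have "\<dots> \<le> 1 * 2 powr w" using ln_le_minus_one[of "2::real"] by (intro mult_right_mono) auto
      finally show ?thesis by (simp add: powr_def mult.commute)
    qed
    have "10000 * (real (s ^ 2)) ^ 2 * B ^ (s ^ 2 + 2) * exp (2 * real (s ^ 2) * B) * (?x * ln (base s)) =
        (10000 * (real (s ^ 2)) ^ 2 * ?x) * B ^ (s ^ 2 + 2) * exp (2 * real (s ^ 2) * B) * ln (base s)"
      by (simp only: mult_ac)
    also have "\<dots> \<le> (10000 * w ^ 5) * exp ((w ^ 2 + 2) * (ln 2 / 4 * w)) * exp (2 * w ^ 2 * exp (ln 2 / 4 * w)) * exp (ln 2 * w)"
      using x1 B0 w1 by (intro mult_mono e1 e2 e3 e4) (auto simp: base_def)
    also have "\<dots> = exp (ln (10000 * w ^ 5) + (w^2 + 2) * (ln 2 / 4 * w) + 2 * w^2 * exp (ln 2 / 4 * w) + ln 2 * w)"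
      using w1 by (simp only: exp_add) simp
    also have "\<dots> \<le> exp (ln 2 * 2 powr w)" using A by (simp add: Let_def w_def)
    finally show "base_large s" unfolding base_large_def B_def[symmetric] nu[symmetric] .
  qed
qed

text \<open>Here base s ^ s stands for an upper bound on n = base s ^ b, and base s for a lower
  bound on both n and n * p.\<close>

lemma eventually_base_prob:
  "eventually (\<lambda>s::nat. real (base s) ^ s * exp (- real (base s)) + exp (- real (base s)) + 9 / base s \<le> 1 / 4) at_top"
proof -
  have c1: "eventually (\<lambda>y::real. exp (y^2 * ln 2 - 2 powr y) + exp (- (2 powr y)) + 9 / 2 powr y \<le> 1 / 4) at_top"
    by real_asymp
  have lim: "filterlim (\<lambda>x::real. 2 powr (2 powr (2 powr x))) at_top at_top" by real_asymp
  have c2: "eventually (\<lambda>x::real. x \<le> 2 powr (2 powr (2 powr x))) at_top" by real_asymp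
  have "eventually (\<lambda>x::real. (let y = 2 powr (2 powr (2 powr x)) in
      exp (y^2 * ln 2 - 2 powr y) + exp (- (2 powr y)) + 9 / 2 powr y \<le> 1 / 4) \<and> x \<le> 2 powr (2 powr (2 powr x))) at_top"
    using eventually_compose_filterlim[OF c1 lim] c2 by (simp add: Let_def eventually_conj_iff)
  from eventually_compose_filterlim[OF this filterlim_real_sequentially] show ?thesis
  proof (rule eventually_mono)
    fix s :: nat
    define y where "y = 2 powr (2 powr (2 powr real s))"
    assume A: "(let y = 2 powr (2 powr (2 powr real s)) in
      exp (y^2 * ln 2 - 2 powr y) + exp (- (2 powr y)) + 9 / 2 powr y \<le> 1 / 4) \<and> real s \<le> 2 powr (2 powr (2 powr real s))"
    have nu: "real (base s) = 2 powr y"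
    proof -
      have "real (base s) = 2 powr real (2 ^ (2 ^ (2 ^ s)))" unfolding base_def by (rule real_two_power)
      also have "real (2 ^ (2 ^ (2 ^ s))) = y" unfolding y_def by (simp only: real_two_power)
      finally show ?thesis .
    qed
    have "real (base s) ^ s = exp (real s * (y * ln 2))"
      unfolding nu by (simp add: powr_def flip: exp_of_nat_mult)
    also have "\<dots> \<le> exp (y^2 * ln 2)"
      using A by (simp add: y_def power2_eq_square mult_right_mono)
    finally have "real (base s) ^ s * exp (- real (base s)) \<le> exp (y^2 * ln 2 - 2 powr y)"
      unfolding nu exp_diff by (simp add: exp_minus divide_inverse mult_right_mono)
    then show "real (base s) ^ s * exp (- real (base s)) + exp (- real (base s)) + 9 / base s \<le> 1 / 4"
      using A unfolding nu y_def[symmetric] Let_def by linarith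
  qed
qed

lemma tow_mono: "i \<le> j \<Longrightarrow> tow i \<le> tow j"
  using strict_mono_less_eq[OF strict_mono_tow] by blast

text \<open>The origin of the window length 8. Rounding 2 * tow h up to tow (h + 1), the four
  exponentials of \<open>base\<close> and one more for the power b lead to tow (h + 6).\<close>

lemma base_power_less_tow:
  assumes h: "2 \<le> h" and b: "b \<le> 2 * tow h"
  shows "base (2 * tow h) ^ b < tow (h + 8)"
proof -
  define x where "x = tow h"
  define z where "z = (2::nat) ^ (2 ^ (2 * x))"
  have "2 \<le> x"
    using tow_mono[OF h] by (simp add: x_def numeral_2_eq_2)
  have two: "2 * k \<le> 2 ^ k" if "1 \<le> k" for k :: nat
    using that by (induction k rule: nat_induct_at_least) auto
  have x2: "2 * x \<le> tow (h + 1)" using two[of x] \<open>2 \<le> x\<close> by (simp add: x_def)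
  have bz: "b \<le> z"
  proof -
    have "b \<le> 2 * x" using b by (simp add: x_def)
    also have "2 * x < 2 ^ (2 * x)" by (rule less_exp)
    also have "(2::nat) ^ (2 * x) < z" unfolding z_def by (rule less_exp)
    finally show ?thesis by simp
  qed
  have "base (2 * x) ^ b = 2 ^ (2 ^ z * b)" by (simp add: base_def z_def power_mult)
  also have "\<dots> \<le> 2 ^ (2 ^ z * 2 ^ z)"
  proof -
    have "b \<le> 2 ^ z" using bz less_exp[of z] by linarith
    then show ?thesis by (intro power_increasing mult_le_mono2) auto
  qed
  also have "\<dots> = 2 ^ (2 ^ (2 * z))" by (simp add: mult_2 power_add)
  also have "\<dots> \<le> 2 ^ (2 ^ (2 ^ z))"
    using two[of z] by (intro power_increasing) (auto simp: z_def)
  also have "\<dots> \<le> 2 ^ (2 ^ (2 ^ (2 ^ (2 ^ tow (h + 1)))))"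
    unfolding z_def using x2 by (intro power_increasing) auto
  also have "\<dots> = tow (h + 6)" by (simp add: numeral_eq_Suc)
  also have "\<dots> < tow (h + 8)" by simp
  finally show ?thesis by (simp add: x_def)
qed

lemma (in pseudo_random_graph) large_bound3:
  assumes bs: "b \<le> s" "1 \<le> s" and "\<nu> = base s"
    and *: "base_large s"
  shows "large (s ^ 2) (bound3 s)"
proof -
  define B1 where "B1 = (100 * real s) ^ s"
  define B where "B = (100 * real (s ^ 2)) ^ s * (8 * (B1 ^ s * exp (2 * (real s * B1))))"
  note bd = bounds[OF bs(2)]
  have "1 \<le> real s" using bs by simp
  moreover have "1 \<le> s ^ 2" using bs by simp
  then have "1 \<le> real (s ^ 2)" by linarith
  ultimately have s1: "1 \<le> 100 * real s" "1 \<le> 100 * real (s ^ 2)" by linarith+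
  have b1: "bound1 s \<le> B1" unfolding bound1_def B1_def using s1 bs by (intro power_increasing)
  have "bound2 s \<le> 8 * (B1 ^ s * exp (2 * (real s * B1)))"
    unfolding bound2_def using b1 bd by (intro mult_mono power_mono) (auto intro!: mult_left_mono)
  then have b3: "bound3 s \<le> B" unfolding bound3_def B_def
    using s1 bs bd by (intro mult_mono power_increasing) auto
  have b31: "1 \<le> bound3 s" using bd by linarith
  have "ln (real n) = b * ln \<nu>" using nu by (simp add: ln_realpow)
  also have "\<dots> \<le> real s * ln (base s)" using bs nu assms(3) by (intro mult_mono) auto
  finally have l: "ln (real n) \<le> real s * ln (base s)" .
  have "10000 * real (s ^ 2) ^ 2 * bound3 s ^ (s ^ 2 + 2) * exp (2 * real (s ^ 2) * bound3 s) * ln (real n) \<le>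
      10000 * real (s ^ 2) ^ 2 * B ^ (s ^ 2 + 2) * exp (2 * real (s ^ 2) * B) * (real s * ln (base s))"
    using b3 b31 l ln_n by (intro mult_mono power_mono) (auto intro!: mult_left_mono)
  also have "\<dots> \<le> \<nu>" using * assms(3) unfolding base_large_def B_def B1_def by simp
  finally show ?thesis unfolding large_def using \<open>1 \<le> s ^ 2\<close> b31 by blast
qed

section \<open>Separation in the quotient norm\<close>

lemma limsup_ge:
  assumes "\<exists>\<^sub>F n in sequentially. c \<le> f n"
  shows "ereal c \<le> limsup (\<lambda>n. ereal (f n))"
proof (rule ccontr)
  assume "\<not> ?thesis"
  then have "limsup (\<lambda>n. ereal (f n)) < ereal c" by simp
  then have "\<forall>\<^sub>F n in sequentially. ereal (f n) < ereal c" by (rule Limsup_lessD)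
  then have "\<forall>\<^sub>F n in sequentially. \<not> c \<le> f n" by (rule eventually_mono) simp
  then show False using assms by (simp add: frequently_def)
qed

text \<open>The norm is a limsup, so a gap at infinitely many n suffices and a sparse sequence of
  sizes is enough.\<close>

lemma dist_c0_proj_ge:
  assumes "\<exists>\<^sub>F n in sequentially. c \<le> \<bar>apply_bcontfun x n - apply_bcontfun y n\<bar>"
  shows "c \<le> dist (c0_proj x) (c0_proj y)"
proof -
  have "ereal (dist (c0_proj x) (c0_proj y)) = ereal (norm (c0_proj (x - y)))"
    by (simp add: dist_linf_mod_c0_def minus_linf_mod_c0.abs_eq)
  also have "\<dots> = limsup (\<lambda>n. ereal \<bar>apply_bcontfun x n - apply_bcontfun y n\<bar>)"
    by (simp add: norm_c0_proj)
  finally have "ereal c \<le> ereal (dist (c0_proj x) (c0_proj y))" using limsup_ge[OF assms] by (simp only:)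
  then show ?thesis by simp
qed

text \<open>By the pigeonhole principle two of the points share a ball of radius c / 2 from a finite
  cover.\<close>

lemma not_totally_bounded_if_separated:
  fixes x :: "nat \<Rightarrow> 'a :: metric_space"
  assumes "\<And>i. x i \<in> A" "0 < c" "\<And>i j. i < j \<Longrightarrow> c \<le> dist (x i) (x j)"
  shows "\<not> totally_bounded A"
proof
  assume "totally_bounded A"
  then obtain K where K: "finite K" "A \<subseteq> (\<Union>k\<in>K. {y. dist k y < c / 2})"
    using assms(2) unfolding totally_bounded_metric by (meson half_gt_zero)
  then have "\<forall>i. \<exists>k. k \<in> K \<and> dist k (x i) < c / 2" using assms(1) by blast
  from choice[OF this] obtain f where f: "\<And>i. f i \<in> K" "\<And>i. dist (f i) (x i) < c / 2" by blast
  have "\<not> inj f" using K(1) f(1) by (meson finite_subset image_subsetI infinite_UNIV_nat range_inj_infinite)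
  then obtain i j where "i < j" "f i = f j" unfolding inj_def by (metis linorder_neqE_nat)
  then have "dist (x i) (x j) < c"
    using f(2)[of i] f(2)[of j] dist_triangle_half_r[of "f i" "x i" c "x j"] by simp
  then show False using assms(3)[OF \<open>i < j\<close>] by simp
qed

text \<open>The guaranteed height at index i is h = 8 * i, a multiple of the window length, and the
  argument of \<open>base\<close> is the s = 2 * tow h that \<open>ex_cert\<close> asks for.\<close>

definition size_at :: "nat \<Rightarrow> nat \<Rightarrow> nat" where
  "size_at b i = base (2 * tow (8 * i)) ^ b"

lemma tow_ge: "k \<le> tow k"
  by (rule strict_mono_imp_increasing[OF strict_mono_tow])

lemma size_at_ge: "0 < b \<Longrightarrow> i \<le> size_at b i"
proof -
  assume b: "0 < b"
  let ?s = "2 * tow (8 * i)"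
  have "i \<le> ?s" using tow_ge[of "8 * i"] by simp
  also have "?s \<le> base ?s"
    unfolding base_def using less_exp[of ?s] less_exp[of "2 ^ ?s"] less_exp[of "2 ^ (2 ^ ?s)"] less_exp[of "2 ^ (2 ^ (2 ^ ?s))"]
    by linarith
  also have "\<dots> \<le> base ?s ^ b" using b by (intro self_le_power) (auto simp: base_def)
  finally show ?thesis by (simp add: size_at_def)
qed

lemma eventually_pseudo_random:
  assumes ab: "0 < a" "a < b"
  shows "\<forall>\<^sub>F i in sequentially. 3 / 4 \<le> measure_pmf.prob (binomial_graph (size_at b i) (1 / real (base (2 * tow (8 * i))) ^ a))
    {E. pseudo_random (size_at b i) (1 / real (base (2 * tow (8 * i))) ^ a) E}"
proof -
  have lim: "filterlim (\<lambda>i. 2 * tow (8 * i)) sequentially sequentially"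
  proof (rule filterlim_at_top_mono[OF filterlim_ident always_eventually], rule allI)
    fix i show "i \<le> 2 * tow (8 * i)" using tow_ge[of "8 * i"] by simp
  qed
  have "\<forall>\<^sub>F s in sequentially. (real (base s) ^ s * exp (- real (base s)) + exp (- real (base s)) + 9 / base s \<le> 1 / 4) \<and> b \<le> s"
    by (intro eventually_conj eventually_base_prob eventually_ge_at_top)
  from eventually_compose_filterlim[OF this lim] show ?thesis
  proof (rule eventually_mono)
    fix i
    define s where "s = 2 * tow (8 * i)"
    define N where "N = real (base s)"
    let ?n = "size_at b i" and ?p = "1 / N ^ a"
    assume "(real (base (2 * tow (8 * i))) ^ (2 * tow (8 * i)) * exp (- real (base (2 * tow (8 * i)))) +
        exp (- real (base (2 * tow (8 * i)))) + 9 / real (base (2 * tow (8 * i))) \<le> 1 / 4) \<and> b \<le> 2 * tow (8 * i)"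
    then have A: "N ^ s * exp (- N) + exp (- N) + 9 / N \<le> 1 / 4" and bs: "b \<le> s"
      by (simp_all add: N_def s_def)
    have n: "real ?n = N ^ b" by (simp add: size_at_def N_def s_def)
    have N1: "2 \<le> N"
    proof -
      have "(2::nat) ^ 1 \<le> base s" unfolding base_def by (intro power_increasing) auto
      then show ?thesis by (simp add: N_def)
    qed
    have Nn: "N \<le> real ?n" unfolding n using ab N1 by (intro self_le_power) auto
    have p: "0 \<le> ?p" "?p \<le> 1" using N1 by (auto simp: one_le_power)
    have n2: "2 \<le> ?n" using Nn N1 by linarith
    have np: "N \<le> real ?n * ?p"
    proof -
      \<comment> \<open>n * p is N ^ (b - a), and b - a is at least 1.\<close>
      have "N ^ 1 \<le> N ^ (b - a)" using ab N1 by (intro power_increasing) auto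
      also have "N ^ (b - a) = N ^ b * ?p" using ab N1 by (simp add: power_diff)
      finally show ?thesis by (simp add: n)
    qed
    have "measure_pmf.prob (binomial_graph ?n ?p) {E. \<not> pseudo_random ?n ?p E}
        \<le> ?n * exp (- (?n * ?p)) + exp (- real ?n) + 9 / ?n"
      by (rule prob_not_pseudo_random[OF p n2])
    also have "\<dots> \<le> N ^ s * exp (- N) + exp (- N) + 9 / N"
    proof (intro add_mono mult_mono)
      show "real ?n \<le> N ^ s" unfolding n using N1 bs by (intro power_increasing) auto
      show "9 / real ?n \<le> 9 / N" using Nn N1 by (intro divide_left_mono) auto
    qed (use np Nn N1 in auto)
    also note A
    finally have "measure_pmf.prob (binomial_graph ?n ?p) {E. \<not> pseudo_random ?n ?p E} \<le> 1 / 4" .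
    moreover have "{E. \<not> pseudo_random ?n ?p E} = space (measure_pmf (binomial_graph ?n ?p)) - {E. pseudo_random ?n ?p E}"
      by auto
    ultimately have "3 / 4 \<le> measure_pmf.prob (binomial_graph ?n ?p) {E. pseudo_random ?n ?p E}"
      using measure_pmf.prob_compl[of "{E. pseudo_random ?n ?p E}" "binomial_graph ?n ?p"] by simp
    then show "3 / 4 \<le> measure_pmf.prob (binomial_graph (size_at b i) (1 / real (base (2 * tow (8 * i))) ^ a))
      {E. pseudo_random (size_at b i) (1 / real (base (2 * tow (8 * i))) ^ a) E}"
      by (simp add: N_def s_def)
  qed
qed

text \<open>For h = 8 * i, q = 8 * k and C = 8, the condition h mod q = 0 becomes divisibility of i
  by k. The finitely many exceptional i do not depend on k.\<close>

lemma eventually_clock_iff: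
  assumes ab: "0 < a" "a < b" "coprime a b"
  shows "\<forall>\<^sub>F i in sequentially. \<forall>E k. 0 < k \<longrightarrow>
    pseudo_random (size_at b i) (1 / real (base (2 * tow (8 * i))) ^ a) E \<longrightarrow>
    (clock a b (8 * k) 8 {1..size_at b i} E \<longleftrightarrow> k dvd i)"
proof -
  have lim: "filterlim (\<lambda>i. 2 * tow (8 * i)) sequentially sequentially"
  proof (rule filterlim_at_top_mono[OF filterlim_ident always_eventually], rule allI)
    fix i show "i \<le> 2 * tow (8 * i)" using tow_ge[of "8 * i"] by simp
  qed
  note ev = eventually_compose_filterlim[OF eventually_conj[OF eventually_base_large eventually_ge_at_top[of b]] lim]
  show ?thesis
    using eventually_conj[OF ev eventually_ge_at_top[of 1]]
  proof (rule eventually_mono, intro allI impI)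
    fix i k :: nat and E
    define s where "s = 2 * tow (8 * i)"
    assume k: "0 < k" and pr: "pseudo_random (size_at b i) (1 / real (base (2 * tow (8 * i))) ^ a) E"
    assume A: "(base_large (2 * tow (8 * i)) \<and> b \<le> 2 * tow (8 * i)) \<and> 1 \<le> i"
    note A' = A[folded s_def]
    have i: "1 \<le> i" using A by blast
    have bs: "b \<le> s" using A' by blast
    have s1: "1 \<le> s" using bs ab by linarith
    have "(2::nat) ^ 2 \<le> base s" unfolding base_def
      using power_increasing[of 1 "2 ^ (2 ^ s)" "2::nat"] by (intro power_increasing) auto
    then have N3: "3 \<le> base s" by simp
    interpret G: pseudo_random_graph a b "base s" E
      by unfold_locales (use ab N3 pr in \<open>simp_all add: size_at_def s_def\<close>)
    have large: "G.large (s ^ 2) (G.bound3 s)" using A' by (intro G.large_bound3[OF bs s1 refl]) blast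
    have h: "0 < 8 * i" "2 * tow (8 * i) \<le> s" using i by (auto simp: s_def)
    have n: "base s ^ b < tow (8 * i + 8)"
      unfolding s_def by (rule base_power_less_tow) (use i bs in \<open>auto simp: s_def\<close>)
    have V: "{1..size_at b i} = {1..base s ^ b}" by (simp add: size_at_def s_def)
    show "clock a b (8 * k) 8 {1..size_at b i} E \<longleftrightarrow> k dvd i"
    proof
      assume "k dvd i"
      then have "8 * i mod (8 * k) = 0" by simp
      then show "clock a b (8 * k) 8 {1..size_at b i} E"
        unfolding V using k by (intro G.clock_true[OF large h n]) auto
    next
      assume c: "clock a b (8 * k) 8 {1..size_at b i} E"
      show "k dvd i"
      proof (rule ccontr)
        assume "\<not> k dvd i"
        then have "8 * i mod (8 * k) \<noteq> 0" by (simp add: mod_eq_0_iff_dvd)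
        then have "\<not> clock a b (8 * k) 8 {1..base s ^ b} E"
          using k by (intro G.clock_false[OF large h n]) auto
        then show False using c unfolding V by blast
      qed
    qed
  qed
qed

theorem theorem2:
  fixes \<alpha> :: real
  assumes "\<alpha> \<in> \<rat>" and "0 < \<alpha>" and "\<alpha> < 1"
  shows "\<not> totally_bounded (FOC (\<lambda>n. binomial_graph n (real n powr (- \<alpha>))))"
proof -
  obtain a b :: nat where ab: "b \<noteq> 0" "\<bar>\<alpha>\<bar> = real a / real b" "coprime a b"
    using Rats_abs_nat_div_natE[OF assms(1)] by blast
  then have \<alpha>: "\<alpha> = real a / real b" using assms(2) by simp
  have a: "0 < a" "a < b"
    using assms(2,3) ab(1) unfolding \<alpha> by (auto simp: field_simps zero_less_divide_iff)
  let ?D = "\<lambda>n. binomial_graph n (real n powr (- \<alpha>))"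
  have "\<forall>k. \<exists>\<phi>. sentence \<phi> \<and> (\<forall>V E. V \<noteq> {} \<longrightarrow> (models V E \<phi> \<longleftrightarrow> clock a b (8 * k) 8 (V :: nat set) E))"
    using clock_sentence by blast
  from choice[OF this] obtain \<phi> where \<phi>: "\<And>k. sentence (\<phi> k)"
    "\<And>k V E. V \<noteq> {} \<Longrightarrow> models V E (\<phi> k) \<longleftrightarrow> clock a b (8 * k) 8 (V :: nat set) E" by blast
  let ?P = "\<lambda>k n. measure_pmf.prob (?D n) {E. models {1..n} E (\<phi> k)}"
  \<comment> \<open>On the chosen sizes the edge probability is an exact power of the base, as the
    locale assumes.\<close>
  have p: "real (size_at b i) powr (- \<alpha>) = 1 / real (base (2 * tow (8 * i))) ^ a" for i
  proof -
    let ?N = "real (base (2 * tow (8 * i)))"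
    have N: "0 < ?N" by (simp add: base_def)
    have "real (size_at b i) = ?N powr real b" using N by (simp add: size_at_def powr_realpow)
    then have "real (size_at b i) powr (- \<alpha>) = ?N powr (- real a)"
      using ab(1) by (simp add: powr_powr \<alpha>)
    then show ?thesis using N by (simp add: powr_minus powr_realpow inverse_eq_divide)
  qed
  have P: "\<forall>\<^sub>F i in sequentially. \<forall>k>0. (k dvd i \<longrightarrow> 3 / 4 \<le> ?P k (size_at b i)) \<and> (\<not> k dvd i \<longrightarrow> ?P k (size_at b i) \<le> 1 / 4)"
    using eventually_conj[OF eventually_conj[OF eventually_pseudo_random[OF a] eventually_clock_iff[OF a ab(3)]] eventually_ge_at_top[of 1]]
  proof (rule eventually_mono, intro allI impI)
    fix i k :: nat
    let ?n = "size_at b i" and ?p = "1 / real (base (2 * tow (8 * i))) ^ a"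
    let ?G = "{E. pseudo_random ?n ?p E}" and ?M = "{E. models {1..?n} E (\<phi> k)}"
    assume k: "0 < k" and A: "(3 / 4 \<le> measure_pmf.prob (binomial_graph ?n ?p) ?G \<and>
      (\<forall>E k. 0 < k \<longrightarrow> pseudo_random ?n ?p E \<longrightarrow> (clock a b (8 * k) 8 {1..?n} E \<longleftrightarrow> k dvd i))) \<and> 1 \<le> i"
    have "1 \<le> ?n" using A size_at_ge[of b i] a by linarith
    then have ne: "{1..?n} \<noteq> {}" by simp
    have M: "E \<in> ?M \<longleftrightarrow> k dvd i" if "E \<in> ?G" for E
      using A k that \<phi>(2)[OF ne, of E k] by blast
    have D: "?D ?n = binomial_graph ?n ?p" unfolding p ..
    show "(k dvd i \<longrightarrow> 3 / 4 \<le> ?P k ?n) \<and> (\<not> k dvd i \<longrightarrow> ?P k ?n \<le> 1 / 4)"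
    proof (intro conjI impI)
      assume "k dvd i"
      then have "?G \<subseteq> ?M" using M by blast
      then have "measure_pmf.prob (binomial_graph ?n ?p) ?G \<le> measure_pmf.prob (binomial_graph ?n ?p) ?M"
        by (rule measure_pmf_mono)
      then show "3 / 4 \<le> ?P k ?n" using A unfolding D by linarith
    next
      assume "\<not> k dvd i"
      then have "?M \<subseteq> - ?G" using M by blast
      then have "measure_pmf.prob (binomial_graph ?n ?p) ?M \<le> measure_pmf.prob (binomial_graph ?n ?p) (- ?G)"
        by (rule measure_pmf_mono)
      also have "\<dots> = 1 - measure_pmf.prob (binomial_graph ?n ?p) ?G"
        using measure_pmf.prob_compl[of ?G "binomial_graph ?n ?p"] by (simp add: Compl_eq_Diff_UNIV)
      finally show "?P k ?n \<le> 1 / 4" using A unfolding D by linarith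
    qed
  qed
  have sep: "1 / 2 \<le> dist (c0_proj (prob_seq ?D (\<phi> (Suc j)))) (c0_proj (prob_seq ?D (\<phi> (Suc k))))" if "j < k" for j k
  proof (rule dist_c0_proj_ge)
    have ap: "apply_bcontfun (prob_seq ?D \<psi>) n = measure_pmf.prob (?D n) {E. models {1..n} E \<psi>}" for \<psi> n
      by (simp add: prob_seq.rep_eq)
    obtain I where I: "\<And>i k. I \<le> i \<Longrightarrow> 0 < k \<Longrightarrow> (k dvd i \<longrightarrow> 3 / 4 \<le> ?P k (size_at b i)) \<and> (\<not> k dvd i \<longrightarrow> ?P k (size_at b i) \<le> 1 / 4)"
      using P unfolding eventually_sequentially by blast
    show "\<exists>\<^sub>F n in sequentially. 1 / 2 \<le>
        \<bar>apply_bcontfun (prob_seq ?D (\<phi> (Suc j))) n - apply_bcontfun (prob_seq ?D (\<phi> (Suc k))) n\<bar>"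
      unfolding frequently_sequentially ap
    proof
      fix m
      \<comment> \<open>A multiple of Suc j that is congruent to Suc j modulo Suc k, hence not
        divisible by Suc k because j < k; the term I + m makes it as large as required.\<close>
      define i where "i = Suc j + Suc j * Suc k * (I + m)"
      have "I + m \<le> Suc j * Suc k * (I + m)" by simp
      then have Ii: "I \<le> i" "m \<le> i" unfolding i_def by linarith+
      have "Suc j dvd i" unfolding i_def by (intro dvd_add dvd_refl) (simp only: mult.assoc dvd_triv_left)
      moreover have "\<not> Suc k dvd i"
      proof
        assume "Suc k dvd i"
        moreover have "Suc k dvd Suc j * Suc k * (I + m)" by (intro dvd_mult2 dvd_triv_right)
        ultimately have "Suc k dvd Suc j" unfolding i_def using dvd_add_left_iff by blast
        then have "Suc k \<le> Suc j" by (rule dvd_imp_le) simp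
        then show False using \<open>j < k\<close> by simp
      qed
      ultimately have "3 / 4 \<le> ?P (Suc j) (size_at b i)" "?P (Suc k) (size_at b i) \<le> 1 / 4"
        using I[OF Ii(1), of "Suc j"] I[OF Ii(1), of "Suc k"] by auto
      moreover have "m \<le> size_at b i" using Ii(2) size_at_ge[of b i] a by linarith
      ultimately show "\<exists>n\<ge>m. 1 / 2 \<le> \<bar>?P (Suc j) n - ?P (Suc k) n\<bar>"
        by (intro exI[of _ "size_at b i"]) linarith
    qed
  qed
  show ?thesis
    by (rule not_totally_bounded_if_separated[where x = "\<lambda>k. c0_proj (prob_seq ?D (\<phi> (Suc k)))" and c = "1 / 2"])
      (use \<phi>(1) sep in \<open>auto simp: FOC_def\<close>)
qed

end
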